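(* Let $k\ge 1$ and let $G$ be a connected $k$-regular vertex-transitive graph of even order $|G|$. Then $G$ is super matched if and only if none of the following six conditions holds: (1) $k$ is odd, $k\le |G|-2$, and $G$ contains a clique of size $k$; (2) $G$ is isomorphic to a cycle of length at least six; (3) $G$ is isomorphic to $Z_{4n}(1,4n-1,2n)$ for some integer $n\ge 1$; (4) $G$ is isomorphic to $Z_{4n+2}(2,4n,2n+1)$ for some integer $n\ge 1$; (5) $G$ is isomorphic to $Z_{4n+2}(1,4n+1,2n,2n+2)$ for some integer $n\ge 1$; (6) $G$ is isomorphic to the Petersen graph.
   Context: All graphs are finite and simple. The order of $G$ is $|G|=|V(G)|$. A graph $G$ is vertex-transitive if for any two vertices $x,y$ there is an automorphism $\varphi$ of $G$ with $\varphi(x)=y$. A clique is a set of pairwise adjacent vertices. For a graph $G$ of even order, a matching preclusion set is a set $S\subseteq E(G)$ such that $G-S$ (the graph obtained by deleting the edges in $S$) has no perfect matching. The matching preclusion number $mp(G)$ is the minimum cardinality of a matching preclusion set. An optimal matching preclusion set (optimal solution) is a matching preclusion set of cardinality $mp(G)$. An optimal solution is trivial if it is the set of all edges incident with a single vertex. $G$ is super matched if all its optimal solutions are trivial. $Z_m(a_1,\dots,a_r)$ denotes the Cayley graph on the additive group $\mathbb{Z}_m$ of integers modulo $m$ with generating set $\{a_1,\dots,a_r\}$: two elements $x,y\in\mathbb{Z}_m$ are adjacent if and only if $x-y\in\{a_1,\dots,a_r\}$ modulo $m$. *)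

theory Defs
  imports "HOL-Number_Theory.Cong"
begin

record 'a ugraph =
  verts :: "'a set"
  edges :: "'a set set"

definition simple_graph :: "'a ugraph \<Rightarrow> bool" where
  "simple_graph G \<longleftrightarrow> finite (verts G) \<and> (\<forall>e\<in>edges G. e \<subseteq> verts G \<and> card e = 2)"

definition graph_order :: "'a ugraph \<Rightarrow> nat" where
  "graph_order G = card (verts G)"

definition adj :: "'a ugraph \<Rightarrow> 'a \<Rightarrow> 'a \<Rightarrow> bool" where
  "adj G x y \<longleftrightarrow> {x, y} \<in> edges G"

definition incident_edges :: "'a ugraph \<Rightarrow> 'a \<Rightarrow> 'a set set" where
  "incident_edges G v = {e \<in> edges G. v \<in> e}"

definition regular_graph :: "nat \<Rightarrow> 'a ugraph \<Rightarrow> bool" where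
  "regular_graph k G \<longleftrightarrow> (\<forall>v\<in>verts G. card (incident_edges G v) = k)"

(* The null graph is not connected. *)
definition connected_graph :: "'a ugraph \<Rightarrow> bool" where
  "connected_graph G \<longleftrightarrow> verts G \<noteq> {} \<and> (\<forall>x\<in>verts G. \<forall>y\<in>verts G. (adj G)\<^sup>*\<^sup>* x y)"

definition graph_isomorphism :: "'a ugraph \<Rightarrow> 'b ugraph \<Rightarrow> ('a \<Rightarrow> 'b) \<Rightarrow> bool" where
  "graph_isomorphism G H f \<longleftrightarrow> bij_betw f (verts G) (verts H) \<and>
     (\<forall>x\<in>verts G. \<forall>y\<in>verts G. adj G x y \<longleftrightarrow> adj H (f x) (f y))"

definition isomorphic :: "'a ugraph \<Rightarrow> 'b ugraph \<Rightarrow> bool" where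
  "isomorphic G H \<longleftrightarrow> (\<exists>f. graph_isomorphism G H f)"

definition vertex_transitive :: "'a ugraph \<Rightarrow> bool" where
  "vertex_transitive G \<longleftrightarrow>
     (\<forall>x\<in>verts G. \<forall>y\<in>verts G. \<exists>\<phi>. graph_isomorphism G G \<phi> \<and> \<phi> x = y)"

definition clique :: "'a ugraph \<Rightarrow> 'a set \<Rightarrow> bool" where
  "clique G C \<longleftrightarrow> C \<subseteq> verts G \<and> pairwise (adj G) C"

definition delete_edges :: "'a ugraph \<Rightarrow> 'a set set \<Rightarrow> 'a ugraph" where
  "delete_edges G S = G\<lparr>edges := edges G - S\<rparr>"

definition perfect_matching :: "'a ugraph \<Rightarrow> 'a set set \<Rightarrow> bool" where
  "perfect_matching G M \<longleftrightarrow> M \<subseteq> edges G \<and> pairwise disjnt M \<and> \<Union>M = verts G"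

definition matching_preclusion_set :: "'a ugraph \<Rightarrow> 'a set set \<Rightarrow> bool" where
  "matching_preclusion_set G S \<longleftrightarrow>
     S \<subseteq> edges G \<and> \<not> (\<exists>M. perfect_matching (delete_edges G S) M)"

(* The minimum exists for every nonempty simple graph, since S = edges G is then
   a matching preclusion set. *)
definition mp :: "'a ugraph \<Rightarrow> nat" where
  "mp G = (LEAST n. \<exists>S. matching_preclusion_set G S \<and> card S = n)"

definition optimal_solution :: "'a ugraph \<Rightarrow> 'a set set \<Rightarrow> bool" where
  "optimal_solution G S \<longleftrightarrow> matching_preclusion_set G S \<and> card S = mp G"

definition trivial_solution :: "'a ugraph \<Rightarrow> 'a set set \<Rightarrow> bool" where
  "trivial_solution G S \<longleftrightarrow> (\<exists>v\<in>verts G. S = incident_edges G v)"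

definition super_matched :: "'a ugraph \<Rightarrow> bool" where
  "super_matched G \<longleftrightarrow> (\<forall>S. optimal_solution G S \<longrightarrow> trivial_solution G S)"

definition cycle_graph :: "nat \<Rightarrow> nat ugraph" where
  "cycle_graph n = \<lparr>verts = {..<n}, edges = {{i, Suc i mod n} | i. i < n}\<rparr>"

(* The graph Z_m(a_1,...,a_r) with A = {a_1,...,a_r}; residues modulo m are represented by
   0,...,m-1. It is a simple graph with the intended adjacency when A is closed under
   negation modulo m and contains no multiple of m; see cayley_Z_simple and cayley_Z_adj. *)
definition cayley_Z :: "nat \<Rightarrow> int set \<Rightarrow> int ugraph" where
  "cayley_Z m A = \<lparr>verts = {0..<int m},
     edges = {{x, y} | x y. x \<in> {0..<int m} \<and> y \<in> {0..<int m} \<and> (\<exists>a\<in>A. [x - y = a] (mod int m))}\<rparr>"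

lemma cayley_Z_adj:
  assumes "\<And>a. a \<in> A \<Longrightarrow> \<exists>b\<in>A. [- a = b] (mod int m)"
    and "x \<in> verts (cayley_Z m A)" "y \<in> verts (cayley_Z m A)"
  shows "adj (cayley_Z m A) x y \<longleftrightarrow> (\<exists>a\<in>A. [x - y = a] (mod int m))"
proof -
  have "\<exists>b\<in>A. [u - v = b] (mod int m)" if a: "a \<in> A" "[v - u = a] (mod int m)" for u v a
  proof -
    obtain b where b: "b \<in> A" "[- a = b] (mod int m)" using assms(1)[OF a(1)] by blast
    have "[- (v - u) = - a] (mod int m)" using a(2) by (simp only: cong_minus_minus_iff)
    then have "[u - v = b] (mod int m)" using b(2) cong_trans by fastforce
    with b(1) show ?thesis by blast
  qed
  with assms(2,3) show ?thesis
    by (auto simp: adj_def cayley_Z_def doubleton_eq_iff)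
qed

lemma cayley_Z_simple:
  assumes "\<And>a. a \<in> A \<Longrightarrow> \<not> [a = 0] (mod int m)"
  shows "simple_graph (cayley_Z m A)"
proof -
  have "x \<noteq> y" if "a \<in> A" "[x - y = a] (mod int m)" for x y a
    using assms[OF that(1)] that(2) cong_sym by fastforce
  then show ?thesis by (fastforce simp: simple_graph_def cayley_Z_def card_2_iff)
qed

(* The Kneser graph K(5,2). *)
definition petersen_graph :: "nat set ugraph" where
  "petersen_graph = \<lparr>verts = {P. P \<subseteq> {..<5} \<and> card P = 2},
     edges = {{P, Q} | P Q. P \<subseteq> {..<5} \<and> card P = 2 \<and> Q \<subseteq> {..<5} \<and> card Q = 2 \<and> disjnt P Q}\<rparr>"

end

theory Submission
  imports Defs "HOL-Combinatorics.Permutations"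
begin

text \<open>
Deleting the \<open>k\<close> edges at a vertex destroys all perfect matchings, so the question is which
graphs have another preclusion set \<open>S\<close> with at most \<open>k\<close> edges.

By Tutte's theorem such an \<open>S\<close> yields a set \<open>U\<close> of vertices and at least \<open>card U + 2\<close>
odd parts of the rest without edges between them apart from those in \<open>S\<close>. As the edge
connectivity of a connected vertex-transitive graph equals its degree \<open>k\<close>
(\<open>edge_connectivity\<close>), every part sends out at least \<open>k\<close> edges, and the count is
tight (\<open>barrier_exists\<close>): \<open>U\<close> is independent, every part is bounded by exactly
\<open>k\<close> edges, and \<open>S\<close> consists of the edges between the parts. Edge cuts of size
\<open>k\<close> that do not isolate a vertex occur only if \<open>k \<le> 2\<close> or if the graph is partitioned by
cliques of size \<open>k\<close> (\<open>minimum_cuts\<close>). With odd sides they lead to the first two exceptions.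
In all other cases the parts are single vertices, so \<open>U\<close> is an independent set with
\<open>card V div 2 - 1\<close> vertices, and the remaining vertices span only the \<open>k\<close> edges of
\<open>S\<close>. If the graph is bipartite, these edges form another cut of size \<open>k\<close> between odd sides,
and \<open>S\<close> is a star after all (\<open>barrier_not_bipartite\<close>).

The rest of the proof rests on an averaging argument: in a vertex-transitive graph an independent set
is not denser than the largest independent set of any subgraph. Applied to a shortest odd cycle, of
length \<open>h\<close>, the size of \<open>U\<close> gives \<open>card V \<le> 2 * h\<close> (\<open>order_le\<close>). Except in
the complete graph on four vertices, a vertex has at most two neighbours on the cycle. Counting the
edges that leave the cycle therefore yields \<open>k \<le> 4\<close>. For \<open>k = 4\<close> the count is tight and the
graph is an odd cycle with all vertices doubled (\<open>tetravalent\<close>). For \<open>k = 3\<close> the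
number of pairs of neighbours of a vertex that lie on a common four-cycle decides: two pairs give a
ladder, which closes up to a prism or a Moebius ladder (\<open>ladder\<close>); no pair gives the Petersen
graph; exactly one pair would force \<open>card V = 2 * h\<close> with \<open>h\<close> odd, while the four-cycles
partition the vertices; and three pairs at every vertex do not occur.

Conversely, each exceptional graph has an odd set of vertices, or a set of more than half of the
vertices, such that at most \<open>k\<close> edges leave the former or lie inside the latter, and these edges
do not form a star.
\<close>

section \<open>The theorems of Hall and Tutte\<close>

text \<open>Induction on the index set, after Halmos and Vaughan. If every proper non-empty subfamily has a
neighbour to spare, then one index can be matched arbitrarily, since removing its partner costs
every other subfamily at most that spare element. Otherwise a tight proper subfamily \<open>J\<close> exists;
\<open>J\<close> and its complement (with the neighbours of \<open>J\<close> removed) are matched separately.\<close>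

lemma hall_marriage:
  fixes N :: "'i \<Rightarrow> 'b set"
  assumes "finite I" "\<And>i. i \<in> I \<Longrightarrow> finite (N i)"
    and "\<And>J. J \<subseteq> I \<Longrightarrow> card J \<le> card (\<Union>i\<in>J. N i)"
  shows "\<exists>f. inj_on f I \<and> (\<forall>i\<in>I. f i \<in> N i)"
  using assms
proof (induction "card I" arbitrary: I N rule: less_induct)
  case less
  note fin = less.prems(1) and finN = less.prems(2) and hall = less.prems(3)
  show ?case
  proof (cases "I = {}")
    case True
    then show ?thesis by simp
  next
    case False
    then obtain i where i: "i \<in> I" by blast
    show ?thesis
    proof (cases "\<exists>J. J \<subset> I \<and> J \<noteq> {} \<and> card J = card (\<Union>i\<in>J. N i)")
      case False
      have "card {i} \<le> card (\<Union>j\<in>{i}. N j)" using i by (intro hall) auto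
      then obtain x where x: "x \<in> N i" by (cases "N i = {}") auto
      have "\<exists>f. inj_on f (I - {i}) \<and> (\<forall>j\<in>I - {i}. f j \<in> N j - {x})"
      proof (rule less.hyps)
        show "card (I - {i}) < card I" using fin i by (rule card_Diff1_less)
        fix J assume J: "J \<subseteq> I - {i}"
        show "card J \<le> card (\<Union>j\<in>J. N j - {x})"
        proof (cases "J = {}")
          case nonempty: False
          have "J \<subset> I" using J i by blast
          then have "card J < card (\<Union>j\<in>J. N j)"
            using False nonempty hall[of J] by (metis less_le psubset_imp_subset)
          moreover have "(\<Union>j\<in>J. N j - {x}) = (\<Union>j\<in>J. N j) - {x}" by auto
          ultimately show ?thesis by (auto simp: card_Diff_singleton_if)
        qed simp
      qed (use fin finN in auto)
      then obtain f where f: "inj_on f (I - {i})" "\<forall>j\<in>I - {i}. f j \<in> N j - {x}" by blast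
      have "inj_on (f(i := x)) I" using f by (auto simp: inj_on_def)
      moreover have "\<forall>j\<in>I. (f(i := x)) j \<in> N j" using f x by auto
      ultimately show ?thesis by blast
    next
      case True
      then obtain J where J: "J \<subset> I" "J \<noteq> {}" "card J = card (\<Union>i\<in>J. N i)" by blast
      have finJ: "finite J" using J(1) fin by (meson finite_subset psubset_imp_subset)
      have finNJ: "finite (\<Union>i\<in>J. N i)" using finJ finN J(1) by blast
      have "\<exists>f. inj_on f J \<and> (\<forall>i\<in>J. f i \<in> N i)"
      proof (rule less.hyps)
        show "card J < card I" by (rule psubset_card_mono[OF fin J(1)])
        show "finite J" by (rule finJ)
        show "finite (N i)" if "i \<in> J" for i using that J(1) finN by blast
        show "card K \<le> card (\<Union>i\<in>K. N i)" if "K \<subseteq> J" for K using that J(1) by (intro hall) auto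
      qed
      then obtain f where f: "inj_on f J" "\<forall>i\<in>J. f i \<in> N i" by blast
      have "\<exists>g. inj_on g (I - J) \<and> (\<forall>i\<in>I - J. g i \<in> N i - (\<Union>i\<in>J. N i))"
      proof (rule less.hyps)
        show "card (I - J) < card I" using J fin by (intro psubset_card_mono) auto
        fix K assume K: "K \<subseteq> I - J"
        have finK: "finite K" using K fin by (meson Diff_subset finite_subset)
        have "card K + card J = card (K \<union> J)"
          using finK finJ K by (subst card_Un_disjoint) auto
        also have "\<dots> \<le> card (\<Union>i\<in>K \<union> J. N i)" by (rule hall) (use K J in auto)
        also have "(\<Union>i\<in>K \<union> J. N i) = (\<Union>i\<in>K. N i - (\<Union>i\<in>J. N i)) \<union> (\<Union>i\<in>J. N i)" by auto
        also have "card \<dots> \<le> card (\<Union>i\<in>K. N i - (\<Union>i\<in>J. N i)) + card (\<Union>i\<in>J. N i)"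
          by (rule card_Un_le)
        finally show "card K \<le> card (\<Union>i\<in>K. N i - (\<Union>i\<in>J. N i))" using J(3) by simp
      qed (use fin finN in auto)
      then obtain g where g: "inj_on g (I - J)" "\<forall>i\<in>I - J. g i \<in> N i - (\<Union>i\<in>J. N i)" by blast
      let ?h = "\<lambda>i. if i \<in> J then f i else g i"
      have "inj_on ?h I"
      proof (rule inj_onI)
        fix a b assume ab: "a \<in> I" "b \<in> I" "?h a = ?h b"
        show "a = b"
        proof (cases "a \<in> J \<longleftrightarrow> b \<in> J")
          case True
          then show ?thesis using ab f(1) g(1) by (cases "a \<in> J") (auto dest: inj_onD)
        next
          case False
          have apart: "f i \<noteq> g j" if "i \<in> J" "j \<in> I - J" for i j
            using bspec[OF f(2) that(1)] bspec[OF g(2) that(2)] that(1) by auto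
          show ?thesis
            using False ab apart[of a b] apart[of b a] by (cases "a \<in> J") simp_all
        qed
      qed
      moreover have "\<forall>i\<in>I. ?h i \<in> N i" using f g J by auto
      ultimately show ?thesis by blast
    qed
  qed
qed

text \<open>The members are pairwise disjoint unions of components, with an odd number of vertices, of the
subgraph induced on \<open>Y\<close>. Such families can be as large as the number of odd components and no
larger, so they serve in Tutte's condition, without a need to speak of components.\<close>

definition odd_family :: "'a set set \<Rightarrow> 'a set \<Rightarrow> 'a set set \<Rightarrow> bool" where
  "odd_family E Y F \<longleftrightarrow> pairwise disjnt F \<and>
     (\<forall>C\<in>F. C \<subseteq> Y \<and> odd (card C) \<and> (\<forall>e\<in>E. e \<subseteq> Y \<longrightarrow> e \<inter> C \<noteq> {} \<longrightarrow> e \<subseteq> C))"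

lemma odd_family_finite:
  assumes "odd_family E Y F" "finite Y"
  shows "finite F"
proof (rule finite_subset)
  show "F \<subseteq> Pow Y" using assms(1) by (auto simp: odd_family_def)
qed (use assms(2) in simp)

lemma odd_family_parity:
  assumes F: "odd_family E Y F" and Y: "finite Y"
  shows "even (card Y + card F + card (Y - \<Union>F))"
proof -
  have fin: "finite F" using odd_family_finite[OF F Y] .
  have sub: "\<Union>F \<subseteq> Y" using F by (auto simp: odd_family_def)
  have "finite C" if "C \<in> F" for C using sub that Y by (meson Union_upper finite_subset)
  then have "card (\<Union>F) = (\<Sum>C\<in>F. card C)"
    using F by (intro card_Union_disjoint) (auto simp: odd_family_def)
  moreover have "even ((\<Sum>C\<in>F. card C) + card F)"
    using fin F unfolding odd_family_def
  proof (induction F rule: finite_induct)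
    case (insert C F)
    then show ?case by (auto simp: pairwise_insert)
  qed simp
  moreover have "card Y = card (\<Union>F) + card (Y - \<Union>F)"
    using sub Y by (metis card_Diff_subset card_mono finite_subset le_add_diff_inverse)
  ultimately show ?thesis by presburger
qed

text \<open>If an odd number of vertices is left over by the family, then these vertices form one more member.\<close>

lemma odd_family_even_rest:
  assumes F: "odd_family E Y F" and Y: "finite Y" and two: "\<And>e. e \<in> E \<Longrightarrow> card e = 2"
  obtains F' where "odd_family E Y F'" "card F \<le> card F'" "even (card Y + card F')"
proof (cases "even (card (Y - \<Union>F))")
  case True
  then show ?thesis using that[of F] F odd_family_parity[OF F Y] by (auto simp: even_add)
next
  case False
  let ?R = "Y - \<Union>F"
  have ne: "?R \<noteq> {}" using False by (metis card.empty even_zero)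
  have new: "?R \<notin> F" using ne by blast
  have "odd_family E Y (insert ?R F)"
    unfolding odd_family_def
  proof (intro conjI ballI impI)
    show "pairwise disjnt (insert ?R F)"
      using F by (auto simp: odd_family_def pairwise_insert disjnt_def)
    fix C assume C: "C \<in> insert ?R F"
    show "C \<subseteq> Y" "odd (card C)" using C F False by (auto simp: odd_family_def)
    fix e assume e: "e \<in> E" "e \<subseteq> Y" "e \<inter> C \<noteq> {}"
    have *: "e \<subseteq> D" if "D \<in> F" "e \<inter> D \<noteq> {}" for D
      using F that e(1,2) by (auto simp: odd_family_def)
    show "e \<subseteq> C"
    proof (cases "C \<in> F")
      case False
      then have "C = ?R" using C by blast
      then show ?thesis using * e(2,3) by blast
    qed (use * e(3) in blast)
  qed
  moreover have "card (insert ?R F) = Suc (card F)"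
    using new odd_family_finite[OF F Y] by simp
  moreover have "even (card Y + Suc (card F))"
    using odd_family_parity[OF F Y] False by simp
  ultimately show ?thesis using that[of "insert ?R F"] by simp
qed

text \<open>Anderson's proof, by induction on the number of vertices. Take \<open>U\<close> maximal such that some odd
family attains equality in the condition. Maximality first forces the family \<open>F\<close> to cover
\<open>V - U\<close>, for a left-over vertex could be moved to \<open>U\<close>. It then forces \<open>C - {v}\<close> to
satisfy the condition for every member \<open>C\<close> and \<open>v \<in> C\<close>, since a violation \<open>T\<close> would
make \<open>U \<union> T \<union> {v}\<close> a larger tight set; so \<open>C - {v}\<close> has a perfect matching by induction.
Finally the condition is Hall's condition for matching the members of \<open>F\<close> with the vertices of
\<open>U\<close> adjacent to them, and equality of the two cardinalities makes this matching perfect.\<close>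

theorem tutte:
  fixes V :: "'a set"
  assumes "finite V" and two: "\<And>e. e \<in> E \<Longrightarrow> card e = 2"
    and "\<And>U F. U \<subseteq> V \<Longrightarrow> odd_family E (V - U) F \<Longrightarrow> card F \<le> card U"
  shows "\<exists>M\<subseteq>E. pairwise disjnt M \<and> \<Union>M = V"
  using assms(1,3)
proof (induction "card V" arbitrary: V rule: less_induct)
  case less
  note fin = less.prems(1) and tutte = less.prems(2)
  define tight where "tight U \<longleftrightarrow> U \<subseteq> V \<and> (\<exists>F. odd_family E (V - U) F \<and> card F = card U)" for U
  have "tight {}" unfolding tight_def by (auto simp: odd_family_def intro!: exI[of _ "{}"])
  then obtain U where U: "tight U" and max: "\<And>T. tight T \<Longrightarrow> card T \<le> card U"
    using fin ex_has_greatest_nat[of tight "{}" card "Suc (card V)"]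
    by (metis card_mono less_Suc_eq_le tight_def)
  then obtain F where UV: "U \<subseteq> V" and F: "odd_family E (V - U) F" and cF: "card F = card U"
    unfolding tight_def by blast
  have finU: "finite U" using UV fin by (rule finite_subset)
  have finF: "finite F" using odd_family_finite[OF F] fin by simp
  have FV: "C \<subseteq> V - U" if "C \<in> F" for C using F that by (auto simp: odd_family_def)
  have Fodd: "odd (card C)" if "C \<in> F" for C using F that by (auto simp: odd_family_def)
  have Fedge: "e \<subseteq> C" if "C \<in> F" "e \<in> E" "e \<subseteq> V - U" "e \<inter> C \<noteq> {}" for C e
    using F that by (auto simp: odd_family_def)
  have disj: "C \<inter> D = {}" if "C \<in> F" "D \<in> F" "C \<noteq> D" for C D
    using F that by (auto simp: odd_family_def pairwise_def disjnt_def)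
  have evenV: "even (card V)"
  proof (rule ccontr)
    assume "odd (card V)"
    then have "odd_family E (V - {}) {V}" by (auto simp: odd_family_def)
    from tutte[OF _ this] show False by simp
  qed
  have cover: "\<Union>F = V - U"
  proof (rule ccontr)
    assume "\<Union>F \<noteq> V - U"
    then obtain v where v: "v \<in> V - U - \<Union>F" using FV by blast
    let ?R = "V - U - \<Union>F"
    have cVU: "card (V - U) = card V - card U" "card U \<le> card V"
      using UV fin finU by (auto simp: card_Diff_subset card_mono)
    have "even (card ?R)"
      using odd_family_parity[OF F] cF evenV cVU fin by (metis Diff_Diff_Int Diff_subset add.commute
        even_add even_diff_nat finite_Diff le_add_diff_inverse2)
    then have oR: "odd (card (?R - {v}))" using v fin
      by (metis card_Suc_Diff1 even_Suc finite_Diff)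
    then have "?R - {v} \<noteq> {}" by (metis card.empty even_zero)
    then have new: "?R - {v} \<notin> F" by blast
    have "odd_family E (V - insert v U) (insert (?R - {v}) F)"
      unfolding odd_family_def
    proof (intro conjI ballI impI)
      show "pairwise disjnt (insert (?R - {v}) F)"
        using F by (auto simp: odd_family_def pairwise_insert disjnt_def)
    next
      fix C assume C: "C \<in> insert (?R - {v}) F"
      show "C \<subseteq> V - insert v U" using C FV v by auto
      show "odd (card C)" using C Fodd oR by auto
      fix e assume e: "e \<in> E" "e \<subseteq> V - insert v U" "e \<inter> C \<noteq> {}"
      have "e \<subseteq> V - U" using e by blast
      show "e \<subseteq> C"
      proof (cases "C \<in> F")
        case True
        then show ?thesis using Fedge[of C e] e by blast
      next
        case False
        then have C': "C = ?R - {v}" using C by blast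
        have "e \<inter> \<Union>F = {}"
        proof (rule ccontr)
          assume "e \<inter> \<Union>F \<noteq> {}"
          then obtain D where D: "D \<in> F" "e \<inter> D \<noteq> {}" by blast
          then have "e \<subseteq> D" using Fedge[of D e] e \<open>e \<subseteq> V - U\<close> by blast
          then show False using e(3) C' D by blast
        qed
        then show ?thesis using C' e by blast
      qed
    qed
    moreover have "card (insert (?R - {v}) F) = card (insert v U)"
      using new finF finU v cF by simp
    ultimately have "tight (insert v U)" using v UV unfolding tight_def by blast
    then show False using max[of "insert v U"] v finU by simp
  qed
  have inner: "\<exists>M\<subseteq>E. pairwise disjnt M \<and> \<Union>M = C - {v}" if C: "C \<in> F" and v: "v \<in> C" for C v
  proof (rule less.hyps)
    have finC: "finite C" using FV[OF C] fin by (meson finite_Diff finite_subset)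
    show "finite (C - {v})" using finC by simp
    have "C - {v} \<subset> V" using FV[OF C] v by blast
    then show "card (C - {v}) < card V" by (rule psubset_card_mono[OF fin])
    have ev: "even (card (C - {v}))" using Fodd[OF C] v finC
      by (metis card_Suc_Diff1 even_Suc)
    fix T D assume T: "T \<subseteq> C - {v}" and D: "odd_family E (C - {v} - T) D"
    show "card D \<le> card T"
    proof (rule ccontr)
      assume "\<not> card D \<le> card T"
      obtain D' where D': "odd_family E (C - {v} - T) D'" "card D \<le> card D'"
          "even (card (C - {v} - T) + card D')"
        using odd_family_even_rest[OF D] finC two by auto
      have finT: "finite T" using T finC by (meson finite_Diff finite_subset)
      have "card (C - {v} - T) + card T = card (C - {v})"
        using T finC finT by (metis Diff_Diff_Int card_Diff_subset card_mono finite_Diff le_add_diff_inverse2)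
      then have "even (card T + card D')" using ev D'(3) by presburger
      then have big: "card T + 2 \<le> card D'" using D'(2) \<open>\<not> card D \<le> card T\<close> by presburger
      have D'C: "X \<subseteq> C - {v} - T" if "X \<in> D'" for X using D'(1) that by (auto simp: odd_family_def)
      have D'ne: "X \<noteq> {}" if "X \<in> D'" for X using D'(1) that by (auto simp: odd_family_def)
      let ?U = "U \<union> T \<union> {v}" and ?F = "(F - {C}) \<union> D'"
      have finD': "finite D'" using odd_family_finite[OF D'(1)] finC by simp
      have dj: "(F - {C}) \<inter> D' = {}"
      proof -
        have "X \<notin> D'" if "X \<in> F - {C}" for X
        proof
          assume "X \<in> D'"
          then show False using disj[of X C] C that D'C[of X] D'ne[of X] by auto
        qed
        then show ?thesis by auto
      qed
      have "odd_family E (V - ?U) ?F"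
        unfolding odd_family_def
      proof (intro conjI ballI impI)
        show "pairwise disjnt ?F"
        proof (rule pairwiseI)
          fix X Y assume XY: "X \<in> ?F" "Y \<in> ?F" "X \<noteq> Y"
          have "X \<inter> Y = {}" if "X \<in> D'" "Y \<in> D'" using D'(1) that XY
            by (auto simp: odd_family_def pairwise_def disjnt_def)
          moreover have "X \<inter> Y = {}" if "X \<in> F - {C}" "Y \<in> D'"
            using disj[of X C] D'C[of Y] that C by blast
          moreover have "X \<inter> Y = {}" if "Y \<in> F - {C}" "X \<in> D'"
            using disj[of Y C] D'C[of X] that C by blast
          moreover have "X \<inter> Y = {}" if "X \<in> F - {C}" "Y \<in> F - {C}"
            using disj[of X Y] that XY by blast
          ultimately show "disjnt X Y" using XY unfolding disjnt_def by blast
        qed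
      next
        fix X assume X: "X \<in> ?F"
        show "X \<subseteq> V - ?U"
        proof (cases "X \<in> D'")
          case True
          then show ?thesis using D'C FV[OF C] by blast
        next
          case False
          then have "X \<in> F" "X \<inter> C = {}" using X disj C by auto
          then show ?thesis using FV[of X] T v by blast
        qed
        show "odd (card X)" using X D'(1) Fodd by (auto simp: odd_family_def)
        fix e assume e: "e \<in> E" "e \<subseteq> V - ?U" "e \<inter> X \<noteq> {}"
        have e': "e \<subseteq> V - U" using e by blast
        show "e \<subseteq> X"
        proof (cases "X \<in> D'")
          case True
          then have "e \<inter> C \<noteq> {}" using D'C e by blast
          then have "e \<subseteq> C" using Fedge C e e' by blast
          then have "e \<subseteq> C - {v} - T" using e by blast
          moreover have "\<forall>e\<in>E. e \<subseteq> C - {v} - T \<longrightarrow> e \<inter> X \<noteq> {} \<longrightarrow> e \<subseteq> X"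
            using D'(1) True by (simp add: odd_family_def)
          ultimately show ?thesis using e by blast
        next
          case False
          then show ?thesis using X Fedge e e' by blast
        qed
      qed
      moreover have "?U \<subseteq> V" using UV T v FV[OF C] by blast
      moreover have cU: "card ?U = card U + card T + 1"
      proof -
        have "U \<inter> T = {}" "v \<notin> U \<union> T" using FV[OF C] T v by blast+
        then show ?thesis using finU finT by (simp add: card_Un_disjoint)
      qed
      moreover have "card ?F \<ge> card ?U"
      proof -
        have "card ?F = card F - 1 + card D'"
          using dj finF finD' C by (simp add: card_Un_disjoint)
        moreover have "card F \<ge> 1" using C finF
          by (metis One_nat_def Suc_leI card_gt_0_iff empty_iff)
        ultimately show ?thesis using cU cF big by linarith
      qed
      ultimately have "tight ?U" using tutte[of ?U ?F] unfolding tight_def by (meson le_antisym)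
      then show False using max[of ?U] cU by simp
    qed
  qed
  define N where "N C = {u \<in> U. \<exists>v\<in>C. {u, v} \<in> E}" for C
  have "\<exists>f. inj_on f F \<and> (\<forall>C\<in>F. f C \<in> N C)"
  proof (rule hall_marriage[OF finF])
    show "finite (N C)" for C using finU by (simp add: N_def)
    fix J assume J: "J \<subseteq> F"
    let ?N = "\<Union>C\<in>J. N C"
    have "odd_family E (V - ?N) J"
      unfolding odd_family_def
    proof (intro conjI ballI impI)
      show "pairwise disjnt J" using F J by (auto simp: odd_family_def intro: pairwise_subset)
      fix C assume C: "C \<in> J"
      show "C \<subseteq> V - ?N" using FV C J by (fastforce simp: N_def)
      show "odd (card C)" using Fodd C J by blast
      fix e assume e: "e \<in> E" "e \<subseteq> V - ?N" "e \<inter> C \<noteq> {}"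
      have "e \<inter> U = {}"
      proof (rule ccontr)
        assume "e \<inter> U \<noteq> {}"
        then obtain u where u: "u \<in> e" "u \<in> U" by blast
        obtain v where v: "v \<in> e" "v \<in> C" using e by blast
        have "u \<noteq> v" using u v FV C J by blast
        then have "e = {u, v}" using two[OF e(1)] u v by (auto simp: card_2_iff)
        then have "u \<in> N C" using e(1) u v by (auto simp: N_def)
        then show False using e(2) u C by blast
      qed
      then show "e \<subseteq> C" using Fedge C J e by blast
    qed
    moreover have "?N \<subseteq> V" using UV by (auto simp: N_def)
    ultimately show "card J \<le> card ?N" by (rule tutte[rotated])
  qed
  then obtain f where f: "inj_on f F" "\<And>C. C \<in> F \<Longrightarrow> f C \<in> N C" by blast
  have "\<exists>v\<in>C. {f C, v} \<in> E" if "C \<in> F" for C using f(2)[OF that] by (auto simp: N_def)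
  then obtain p where p: "\<And>C. C \<in> F \<Longrightarrow> p C \<in> C" "\<And>C. C \<in> F \<Longrightarrow> {f C, p C} \<in> E" by metis
  have "\<exists>M\<subseteq>E. pairwise disjnt M \<and> \<Union>M = C - {p C}" if "C \<in> F" for C
    using inner[OF that p(1)[OF that]] .
  then obtain M where M: "\<And>C. C \<in> F \<Longrightarrow> M C \<subseteq> E" "\<And>C. C \<in> F \<Longrightarrow> pairwise disjnt (M C)"
      "\<And>C. C \<in> F \<Longrightarrow> \<Union>(M C) = C - {p C}" by metis
  have fU: "f ` F = U"
  proof (rule card_subset_eq[OF finU])
    show "f ` F \<subseteq> U" using f(2) by (auto simp: N_def)
    show "card (f ` F) = card U" using f(1) cF by (simp add: card_image)
  qed
  define M' where "M' C = insert {f C, p C} (M C)" for C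
  have UM': "\<Union>(M' C) = insert (f C) C" if "C \<in> F" for C
    using M(3)[OF that] p(1)[OF that] by (auto simp: M'_def)
  have pM': "pairwise disjnt (M' C)" if "C \<in> F" for C
  proof -
    have "f C \<notin> C" using FV[OF that] f(2)[OF that] by (auto simp: N_def)
    then have "disjnt {f C, p C} e" if "e \<in> M C" for e
      using M(3)[OF \<open>C \<in> F\<close>] that by (auto simp: disjnt_def)
    then show ?thesis using M(2)[OF that] by (auto simp: M'_def pairwise_insert disjnt_sym)
  qed
  have "pairwise disjnt (\<Union>C\<in>F. M' C)"
  proof (rule pairwiseI)
    fix a b assume ab: "a \<in> (\<Union>C\<in>F. M' C)" "b \<in> (\<Union>C\<in>F. M' C)" "a \<noteq> b"
    then obtain C D where CD: "C \<in> F" "a \<in> M' C" "D \<in> F" "b \<in> M' D" by blast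
    show "disjnt a b"
    proof (cases "C = D")
      case True
      then show ?thesis using pM'[OF CD(1)] CD ab by (auto simp: pairwise_def)
    next
      case False
      have "f C \<noteq> f D" using f(1) CD False by (auto simp: inj_on_def)
      moreover have "f C \<in> U" "f D \<in> U" using f(2) CD by (auto simp: N_def)
      moreover have "C \<inter> D = {}" using disj CD False by blast
      ultimately have "insert (f C) C \<inter> insert (f D) D = {}" using FV[OF CD(1)] FV[OF CD(3)] by blast
      then show ?thesis using UM'[OF CD(1)] UM'[OF CD(3)] CD unfolding disjnt_def by blast
    qed
  qed
  moreover have "(\<Union>C\<in>F. M' C) \<subseteq> E" using M(1) p(2) by (auto simp: M'_def)
  moreover have "\<Union>(\<Union>C\<in>F. M' C) = V"
  proof -
    have "\<Union>(\<Union>C\<in>F. M' C) = (\<Union>C\<in>F. \<Union>(M' C))" by blast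
    also have "\<dots> = (\<Union>C\<in>F. insert (f C) C)" using UM' by simp
    also have "\<dots> = f ` F \<union> \<Union>F" by auto
    also have "\<dots> = V" using fU cover UV by auto
    finally show ?thesis .
  qed
  ultimately show ?case by blast
qed

section \<open>Edge cuts of vertex-transitive graphs\<close>

lemma equal_card_diff:
  assumes "finite A" "finite B" "card A = card B" "A \<noteq> B"
  shows "A - B \<noteq> {}" "B - A \<noteq> {}"
  using assms card_subset_eq[of B A] card_subset_eq[of A B] by auto

locale vertex_transitive_graph =
  fixes G :: "'a ugraph" and k :: nat
  assumes simple: "simple_graph G"
    and connected: "connected_graph G"
    and regular: "regular_graph k G"
    and transitive: "vertex_transitive G"
begin

abbreviation V :: "'a set" where "V \<equiv> verts G"

abbreviation adjacent :: "'a \<Rightarrow> 'a \<Rightarrow> bool" (infix "\<sim>" 50) where "x \<sim> y \<equiv> adj G x y"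

definition nbrs :: "'a \<Rightarrow> 'a set" where "nbrs x = {y. x \<sim> y}"

text \<open>Each edge that leaves \<open>X\<close> is listed once, as an ordered pair that starts in \<open>X\<close>.\<close>

definition boundary :: "'a set \<Rightarrow> ('a \<times> 'a) set" where
  "boundary X = {(x, y). x \<in> X \<and> y \<notin> X \<and> x \<sim> y}"

definition cut_size :: "'a set \<Rightarrow> nat" where "cut_size X = card (boundary X)"

lemma fin: "finite V" using simple by (simp add: simple_graph_def)

lemma V_nonempty: "V \<noteq> {}" using connected by (simp add: connected_graph_def)

lemma adj_sym: "x \<sim> y \<Longrightarrow> y \<sim> x" by (simp add: adj_def insert_commute)

lemma adj_commute: "x \<sim> y \<longleftrightarrow> y \<sim> x" using adj_sym by blast

lemma adj_verts: "x \<sim> y \<Longrightarrow> x \<in> V \<and> y \<in> V"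
  using simple by (auto simp: simple_graph_def adj_def)

lemma adj_irrefl: "\<not> x \<sim> x"
  using simple by (force simp: simple_graph_def adj_def)

lemma edge_pair:
  assumes "e \<in> edges G"
  obtains x y where "e = {x, y}" "x \<sim> y"
proof -
  have "card e = 2" using assms simple by (simp add: simple_graph_def)
  then obtain x y where "e = {x, y}" by (auto simp: card_2_iff)
  then show ?thesis using that assms by (auto simp: adj_def)
qed

lemma nbrs_sub: "nbrs x \<subseteq> V" using adj_verts by (auto simp: nbrs_def)

lemma fin_nbrs: "finite (nbrs x)" using nbrs_sub fin by (rule finite_subset)

lemma card_nbrs:
  assumes "x \<in> V"
  shows "card (nbrs x) = k"
proof -
  have "bij_betw (\<lambda>y. {x, y}) (nbrs x) (incident_edges G x)"
  proof (rule bij_betw_imageI)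
    show "inj_on (\<lambda>y. {x, y}) (nbrs x)" by (auto simp: inj_on_def doubleton_eq_iff)
    show "(\<lambda>y. {x, y}) ` nbrs x = incident_edges G x"
    proof
      show "(\<lambda>y. {x, y}) ` nbrs x \<subseteq> incident_edges G x"
        by (auto simp: nbrs_def incident_edges_def adj_def)
      show "incident_edges G x \<subseteq> (\<lambda>y. {x, y}) ` nbrs x"
      proof
        fix e assume "e \<in> incident_edges G x"
        then have e: "e \<in> edges G" "x \<in> e" by (auto simp: incident_edges_def)
        from e(1) obtain a b where ab: "e = {a, b}" "a \<sim> b" by (rule edge_pair)
        then show "e \<in> (\<lambda>y. {x, y}) ` nbrs x"
          using e(2) adj_sym[OF ab(2)] by (auto simp: nbrs_def)
      qed
    qed
  qed
  then show ?thesis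
    using bij_betw_same_card regular assms unfolding regular_graph_def by fastforce
qed

lemma finite_boundary: "finite (boundary X)"
  by (rule finite_subset[of _ "V \<times> V"]) (use adj_verts fin in \<open>auto simp: boundary_def\<close>)

lemma cut_size_compl:
  assumes "X \<subseteq> V"
  shows "cut_size (V - X) = cut_size X"
proof -
  have "boundary (V - X) = prod.swap ` boundary X"
    unfolding boundary_def using adj_verts adj_sym assms by (auto simp: image_def)
  then show ?thesis unfolding cut_size_def by (simp add: card_image)
qed

text \<open>An edge that leaves \<open>X \<inter> Y\<close> or \<open>X \<union> Y\<close> leaves \<open>X\<close> or \<open>Y\<close>, and one that leaves
both \<open>X \<inter> Y\<close> and \<open>X \<union> Y\<close> leaves both \<open>X\<close> and \<open>Y\<close>.\<close>

lemma cut_size_submod: "cut_size (X \<inter> Y) + cut_size (X \<union> Y) \<le> cut_size X + cut_size Y"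
proof -
  have "card (boundary (X \<inter> Y)) + card (boundary (X \<union> Y)) =
      card (boundary (X \<inter> Y) \<union> boundary (X \<union> Y)) + card (boundary (X \<inter> Y) \<inter> boundary (X \<union> Y))"
    by (rule card_Un_Int) (rule finite_boundary)+
  also have "\<dots> \<le> card (boundary X \<union> boundary Y) + card (boundary X \<inter> boundary Y)"
    by (intro add_mono card_mono finite_UnI finite_Int disjI1 finite_boundary)
      (auto simp: boundary_def)
  also have "\<dots> = card (boundary X) + card (boundary Y)"
    by (rule card_Un_Int[symmetric]) (rule finite_boundary)+
  finally show ?thesis by (simp add: cut_size_def)
qed

text \<open>Submodularity for \<open>X\<close> and the complement of \<open>Y\<close>.\<close>

lemma cut_size_posimod:
  assumes "X \<subseteq> V" "Y \<subseteq> V"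
  shows "cut_size (X - Y) + cut_size (Y - X) \<le> cut_size X + cut_size Y"
proof -
  have "X \<inter> (V - Y) = X - Y" "X \<union> (V - Y) = V - (Y - X)" using assms by auto
  moreover have "Y - X \<subseteq> V" using assms by auto
  ultimately show ?thesis
    using cut_size_submod[of X "V - Y"] cut_size_compl[of Y] cut_size_compl[of "Y - X"] assms by simp
qed

lemma cut_size_sum:
  assumes "X \<subseteq> V"
  shows "cut_size X = (\<Sum>x\<in>X. card (nbrs x - X))"
proof -
  have "boundary X = (SIGMA x:X. nbrs x - X)" by (auto simp: boundary_def nbrs_def)
  then show ?thesis
    using assms fin fin_nbrs by (simp add: cut_size_def card_SigmaI finite_subset)
qed

lemma connected_closed:
  assumes "X \<subseteq> V" "X \<noteq> {}" "\<And>x y. x \<in> X \<Longrightarrow> x \<sim> y \<Longrightarrow> y \<in> X"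
  shows "X = V"
proof -
  obtain a where a: "a \<in> X" using assms(2) by blast
  have "b \<in> X" if "b \<in> V" for b
  proof -
    have "(adj G)\<^sup>*\<^sup>* a b" using connected a assms(1) that by (auto simp: connected_graph_def)
    then show ?thesis by (induction rule: rtranclp_induct) (use a assms(3) in auto)
  qed
  then show ?thesis using assms(1) by blast
qed

lemma cut_size_pos:
  assumes "X \<subseteq> V" "X \<noteq> {}" "X \<noteq> V"
  shows "cut_size X > 0"
proof -
  obtain x y where "x \<in> X" "x \<sim> y" "y \<notin> X" using connected_closed[of X] assms by blast
  then have "(x, y) \<in> boundary X" by (simp add: boundary_def)
  then show ?thesis using finite_boundary unfolding cut_size_def by (metis card_gt_0_iff empty_iff)
qed

text \<open>Automorphisms are normalised to be the identity outside the vertex set. This makes them a finite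
set, closed under composition and inverses, over which one can sum.\<close>

definition Aut :: "('a \<Rightarrow> 'a) set" where
  "Aut = {\<phi>. \<phi> permutes V \<and> (\<forall>x y. \<phi> x \<sim> \<phi> y \<longleftrightarrow> x \<sim> y)}"

lemma Aut_transitive:
  assumes "x \<in> V" "y \<in> V"
  obtains \<phi> where "\<phi> \<in> Aut" "\<phi> x = y"
proof -
  obtain f where f: "graph_isomorphism G G f" "f x = y"
    using transitive assms by (auto simp: vertex_transitive_def)
  define \<phi> where "\<phi> z = (if z \<in> V then f z else z)" for z
  have bij: "bij_betw f V V" using f(1) by (simp add: graph_isomorphism_def)
  have "\<phi> permutes V"
    by (rule bij_imp_permutes)
      (use bij in \<open>auto simp: \<phi>_def cong: bij_betw_cong\<close>)
  moreover have "\<phi> a \<sim> \<phi> b \<longleftrightarrow> a \<sim> b" for a b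
  proof (cases "a \<in> V \<and> b \<in> V")
    case True
    then show ?thesis using f(1) by (simp add: graph_isomorphism_def \<phi>_def)
  next
    case False
    then have "\<phi> a \<notin> V \<or> \<phi> b \<notin> V" by (auto simp: \<phi>_def)
    then show ?thesis using False adj_verts by blast
  qed
  ultimately show ?thesis using that[of \<phi>] f(2) assms(1) by (simp add: Aut_def \<phi>_def)
qed

lemma Aut_adj: "\<phi> \<in> Aut \<Longrightarrow> \<phi> x \<sim> \<phi> y \<longleftrightarrow> x \<sim> y" by (simp add: Aut_def)

lemma Aut_perm: "\<phi> \<in> Aut \<Longrightarrow> \<phi> permutes V" by (simp add: Aut_def)

lemma Aut_inj: "\<phi> \<in> Aut \<Longrightarrow> inj \<phi>" using Aut_perm permutes_inj by blast

lemma Aut_in_V: "\<phi> \<in> Aut \<Longrightarrow> \<phi> x \<in> V \<longleftrightarrow> x \<in> V" using Aut_perm permutes_in_image by metis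

lemma Aut_comp: "\<phi> \<in> Aut \<Longrightarrow> \<psi> \<in> Aut \<Longrightarrow> \<phi> \<circ> \<psi> \<in> Aut"
  by (auto simp: Aut_def intro: permutes_compose)

lemma Aut_inv:
  assumes "\<phi> \<in> Aut"
  shows "inv \<phi> \<in> Aut"
proof -
  have "\<phi> (inv \<phi> x) = x" for x using permutes_inverses(1)[OF Aut_perm[OF assms]] .
  then have "inv \<phi> x \<sim> inv \<phi> y \<longleftrightarrow> x \<sim> y" for x y using Aut_adj[OF assms, of "inv \<phi> x" "inv \<phi> y"] by simp
  then show ?thesis using permutes_inv[OF Aut_perm[OF assms]] by (simp add: Aut_def)
qed

lemma finite_Aut: "finite Aut"
  by (rule finite_subset[OF _ finite_permutations[OF fin]]) (auto simp: Aut_def)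

lemma Aut_nbrs: "\<phi> \<in> Aut \<Longrightarrow> nbrs (\<phi> x) = \<phi> ` nbrs x"
proof -
  assume \<phi>: "\<phi> \<in> Aut"
  have "y \<in> \<phi> ` nbrs x" if "y \<in> nbrs (\<phi> x)" for y
  proof
    show "y = \<phi> (inv \<phi> y)" using permutes_inverses(1)[OF Aut_perm[OF \<phi>]] by simp
    then show "inv \<phi> y \<in> nbrs x" using that Aut_adj[OF \<phi>, of x "inv \<phi> y"] by (simp add: nbrs_def)
  qed
  then show ?thesis using Aut_adj[OF \<phi>] by (auto simp: nbrs_def)
qed

lemma Aut_image_sub: "\<phi> \<in> Aut \<Longrightarrow> X \<subseteq> V \<Longrightarrow> \<phi> ` X \<subseteq> V" using Aut_in_V by blast

lemma Aut_image_card: "\<phi> \<in> Aut \<Longrightarrow> card (\<phi> ` X) = card X"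
  using Aut_inj by (metis card_image inj_on_subset subset_UNIV)

lemma Aut_cut_size:
  assumes "\<phi> \<in> Aut" "X \<subseteq> V"
  shows "cut_size (\<phi> ` X) = cut_size X"
proof -
  have "card (nbrs (\<phi> x) - \<phi> ` X) = card (nbrs x - X)" for x
    using Aut_nbrs[OF assms(1)] Aut_inj[OF assms(1)] Aut_image_card[OF assms(1)]
    by (metis image_set_diff)
  then show ?thesis
    using assms Aut_image_sub Aut_inj[OF assms(1)]
    by (subst (1 2) cut_size_sum) (auto simp: sum.reindex inj_on_def dest: injD)
qed

text \<open>A block of imprimitivity of the automorphism group.\<close>

definition block :: "'a set \<Rightarrow> bool" where
  "block X \<longleftrightarrow> X \<subseteq> V \<and> X \<noteq> {} \<and> (\<forall>\<phi>\<in>Aut. \<phi> ` X = X \<or> \<phi> ` X \<inter> X = {})"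

text \<open>Transitivity gives every vertex of a block \<open>X\<close> the same number \<open>m\<close> of neighbours inside, so
the cut has \<open>card X * (k - m)\<close> edges. Here \<open>m + 1 \<le> card X\<close> and \<open>m < k\<close>, whence
\<open>card X * (k - m) \<ge> (m + 1) * (k - m) = k + m * (k - m - 1) \<ge> k\<close>. Equality leaves only
\<open>m = 0\<close>, a single vertex, and \<open>m = k - 1\<close>, a clique of size \<open>k\<close>.\<close>

lemma block_cut:
  assumes X: "block X" "X \<noteq> V"
  shows "k \<le> cut_size X"
    and "cut_size X = k \<Longrightarrow> card X = 1 \<or> (card X = k \<and> clique G X)"
proof -
  have XV: "X \<subseteq> V" and ne: "X \<noteq> {}" using X by (auto simp: block_def)
  have finX: "finite X" using XV fin by (rule finite_subset)
  obtain a where a: "a \<in> X" using ne by blast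
  define m where "m = card (nbrs a \<inter> X)"
  have m: "card (nbrs x \<inter> X) = m" if x: "x \<in> X" for x
  proof -
    obtain \<phi> where \<phi>: "\<phi> \<in> Aut" "\<phi> a = x" using Aut_transitive XV a x by blast
    then have "\<phi> ` X = X" using X(1) a x unfolding block_def by blast
    then have "nbrs x \<inter> X = \<phi> ` (nbrs a \<inter> X)"
      using Aut_nbrs[OF \<phi>(1), of a] \<phi> image_Int[OF Aut_inj[OF \<phi>(1)]] by metis
    then show ?thesis using Aut_image_card[OF \<phi>(1)] by (simp add: m_def)
  qed
  have out: "card (nbrs x - X) = k - m" if "x \<in> X" for x
    using m[OF that] card_nbrs[of x] that XV card_Diff_subset_Int[of "nbrs x" X] fin_nbrs by auto
  have cut: "cut_size X = card X * (k - m)"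
    using cut_size_sum[OF XV] out by simp
  have mk: "m < k" using cut_size_pos[OF XV ne X(2)] cut by (cases "m < k") auto
  have sub: "nbrs x \<inter> X \<subseteq> X - {x}" for x using adj_irrefl by (auto simp: nbrs_def)
  have mX: "m + 1 \<le> card X"
    using card_mono[OF _ sub[of a]] finX a card_Diff_singleton[OF a]
    by (metis One_nat_def Suc_leI add.commute card_gt_0_iff finite_Diff le_diff_conv2 m_def ne plus_1_eq_Suc)
  have prod: "(m + 1) * (k - m) = k + m * (k - m - 1)"
    using mk by (cases "k - m") (auto simp: algebra_simps)
  have le: "(m + 1) * (k - m) \<le> cut_size X" unfolding cut using mX by (rule mult_le_mono1)
  then show "k \<le> cut_size X" using prod by simp
  assume dk: "cut_size X = k"
  then have "m * (k - m - 1) = 0" using le prod by simp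
  have "(m + 1) * (k - m) = card X * (k - m)" using le prod dk cut by simp
  then have cX: "card X = m + 1" using mk mult_cancel2[of "m + 1" "k - m" "card X"] by linarith
  consider "m = 0" | "k = m + 1" using \<open>m * (k - m - 1) = 0\<close> mk by fastforce
  then show "card X = 1 \<or> (card X = k \<and> clique G X)"
  proof cases
    case 2
    have "nbrs x \<inter> X = X - {x}" if "x \<in> X" for x
      using sub m[OF that] cX finX that by (intro card_subset_eq) auto
    then have "clique G X" using XV by (auto simp: clique_def pairwise_def nbrs_def)
    then show ?thesis using 2 cX by simp
  qed (use cX in simp)
qed

text \<open>The edge connectivity of a connected vertex-transitive graph is its degree (Mader, Watkins). Among
the minimum cuts take one with a smallest side \<open>X'\<close>, an atom. Uncrossing \<open>X'\<close> with an
image that meets it gives a smaller side, so \<open>X'\<close> is a block, and the bound for blocks applies.\<close>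

lemma edge_connectivity:
  assumes "X \<subseteq> V" "X \<noteq> {}" "X \<noteq> V"
  shows "k \<le> cut_size X"
proof -
  define P where "P X \<longleftrightarrow> X \<subseteq> V \<and> X \<noteq> {} \<and> X \<noteq> V" for X
  obtain Y where Y: "P Y" "\<And>Z. P Z \<Longrightarrow> cut_size Y \<le> cut_size Z"
    using ex_has_least_nat[of P X cut_size] assms unfolding P_def by blast
  obtain X' where X': "P X'" "cut_size X' = cut_size Y"
      "\<And>Z. P Z \<Longrightarrow> cut_size Z = cut_size Y \<Longrightarrow> card X' \<le> card Z"
    using ex_has_least_nat[of "\<lambda>Z. P Z \<and> cut_size Z = cut_size Y" Y card] Y by blast
  have XV: "X' \<subseteq> V" and ne: "X' \<noteq> {}" "X' \<noteq> V" using X'(1) by (auto simp: P_def)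
  have finX: "finite X'" using XV fin by (rule finite_subset)
  have "P (V - X')" using XV ne by (auto simp: P_def)
  then have "card X' \<le> card (V - X')" using X' cut_size_compl[OF XV] by metis
  then have half: "2 * card X' \<le> card V"
    using card_Diff_subset[OF finX XV] card_mono[OF fin XV] by linarith
  have "block X'"
    unfolding block_def
  proof (intro conjI XV ne ballI)
    fix \<phi> assume \<phi>: "\<phi> \<in> Aut"
    let ?Z = "\<phi> ` X'"
    have Z: "?Z \<subseteq> V" "card ?Z = card X'" "cut_size ?Z = cut_size X'" "finite ?Z"
      using Aut_image_sub[OF \<phi> XV] Aut_image_card[OF \<phi>] Aut_cut_size[OF \<phi> XV] finX by auto
    show "?Z = X' \<or> ?Z \<inter> X' = {}"
    proof (rule ccontr)
      assume *: "\<not> (?Z = X' \<or> ?Z \<inter> X' = {})"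
      have lt: "card (X' \<inter> ?Z) < card X'"
      proof (rule psubset_card_mono[OF finX])
        show "X' \<inter> ?Z \<subset> X'" using equal_card_diff[OF finX Z(4)] * Z(2) by auto
      qed
      have "card (X' \<union> ?Z) + card (X' \<inter> ?Z) = 2 * card X'"
        using card_Un_Int[OF finX Z(4)] Z(2) by simp
      moreover have "card (X' \<inter> ?Z) > 0" using * finX by (auto simp: card_gt_0_iff)
      ultimately have "X' \<union> ?Z \<noteq> V" using half by auto
      then have P: "P (X' \<inter> ?Z)" "P (X' \<union> ?Z)" using * XV Z(1) ne unfolding P_def by auto
      have "cut_size (X' \<inter> ?Z) \<noteq> cut_size Y" using X'(3)[OF P(1)] lt by auto
      then show False
        using Y(2)[OF P(1)] Y(2)[OF P(2)] cut_size_submod[of X' ?Z] Z(3) X'(2) by simp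
    qed
  qed
  then have "k \<le> cut_size X'" using block_cut(1) ne by blast
  also have "\<dots> = cut_size Y" by (rule X'(2))
  also have "\<dots> \<le> cut_size X" using Y(2) assms by (auto simp: P_def)
  finally show ?thesis .
qed

text \<open>By edge connectivity the two new cuts cannot have fewer than \<open>k\<close> edges, so the bounds for
their total are attained.\<close>

lemma cut_uncross:
  assumes "X \<subseteq> V" "Y \<subseteq> V" "cut_size X = k" "cut_size Y = k"
  shows "X \<inter> Y \<noteq> {} \<Longrightarrow> X \<union> Y \<noteq> V \<Longrightarrow> cut_size (X \<inter> Y) = k"
    and "X - Y \<noteq> {} \<Longrightarrow> Y - X \<noteq> {} \<Longrightarrow> cut_size (X - Y) = k"
proof -
  assume *: "X \<inter> Y \<noteq> {}" "X \<union> Y \<noteq> V"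
  have "k \<le> cut_size (X \<inter> Y)" "k \<le> cut_size (X \<union> Y)"
    using assms * by (intro edge_connectivity; blast)+
  then show "cut_size (X \<inter> Y) = k" using cut_size_submod[of X Y] assms by linarith
next
  assume *: "X - Y \<noteq> {}" "Y - X \<noteq> {}"
  have "k \<le> cut_size (X - Y)" "k \<le> cut_size (Y - X)"
    using assms * by (intro edge_connectivity; blast)+
  then show "cut_size (X - Y) = k" using cut_size_posimod[of X Y] assms by linarith
qed

text \<open>Each of the two vertices has at least \<open>k - 1\<close> neighbours outside the pair.\<close>

lemma cut_size_pair:
  assumes "X \<subseteq> V" "card X = 2"
  shows "2 * k \<le> cut_size X + 2"
proof -
  obtain a b where ab: "X = {a, b}" "a \<noteq> b" using assms(2) by (auto simp: card_2_iff)
  have "k \<le> card (nbrs x - X) + 1" if "x \<in> X" for x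
  proof -
    have "nbrs x - X = nbrs x - (X - {x})" using adj_irrefl by (auto simp: nbrs_def)
    moreover have "card (X - {x}) = 1" using assms(2) that by (simp add: card_Diff_singleton)
    ultimately show ?thesis
      using diff_card_le_card_Diff[of "X - {x}" "nbrs x"] card_nbrs[of x] that assms fin
      by (metis add.commute card.infinite finite_Diff le_diff_conv subsetD zero_neq_numeral)
  qed
  from this[of a] this[of b] show ?thesis using cut_size_sum[OF assms(1)] ab by simp
qed

text \<open>Suppose that some cut with \<open>k\<close> edges has at least two vertices on both sides, and let \<open>Q\<close> be
a smallest such side. If an image of \<open>Q\<close> met \<open>Q\<close> properly, then uncrossing would make both
the intersection and the difference singletons, so \<open>Q\<close> would be a pair, and pairs have cuts
with at least \<open>2 * k - 2 > k\<close> edges. So \<open>Q\<close> is a block, hence a clique of size \<open>k\<close>.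
The images of \<open>Q\<close> partition the vertices. If \<open>k\<close> is even, a set with an odd number of
vertices is not a union of images; if it has a cut with \<open>k\<close> edges, then uncrossing it with an
image that it splits shows that it, or its complement, is a single vertex.\<close>

lemma minimum_cuts:
  assumes k3: "k \<ge> 3"
    and "\<exists>X\<subseteq>V. cut_size X = k \<and> 2 \<le> card X \<and> 2 \<le> card (V - X)"
  obtains Q where "clique G Q" "card Q = k" "k + 2 \<le> card V"
    "even k \<Longrightarrow> \<forall>X\<subseteq>V. odd (card X) \<longrightarrow> odd (card (V - X)) \<longrightarrow> cut_size X = k \<longrightarrow>
       card X = 1 \<or> card (V - X) = 1"
proof -
  define P where "P X \<longleftrightarrow> X \<subseteq> V \<and> cut_size X = k \<and> 2 \<le> card X \<and> 2 \<le> card (V - X)" for X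
  obtain X0 where "P X0" using assms(2) unfolding P_def by blast
  from ex_has_least_nat[of P, OF this, of card]
  obtain Q where Q: "P Q" "\<And>Z. P Z \<Longrightarrow> card Q \<le> card Z" by blast
  have QV: "Q \<subseteq> V" and dQ: "cut_size Q = k" and cQ: "2 \<le> card Q" "2 \<le> card (V - Q)"
    using Q(1) by (auto simp: P_def)
  have finQ: "finite Q" using QV fin by (rule finite_subset)
  have cV: "card V = card Q + card (V - Q)"
    using card_Diff_subset[OF finQ QV] card_mono[OF fin QV] by linarith
  have small: "card Z = 1" if Z: "Z \<subseteq> V" "Z \<noteq> {}" "cut_size Z = k" "card Z < card Q" for Z
  proof (rule ccontr)
    assume "card Z \<noteq> 1"
    have finZ: "finite Z" using Z(1) fin by (rule finite_subset)
    have "card Z \<noteq> 0" using Z(2) finZ by simp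
    then have "2 \<le> card Z" using \<open>card Z \<noteq> 1\<close> by linarith
    moreover have "2 \<le> card (V - Z)"
      using card_Diff_subset[OF finZ Z(1)] cV cQ Z(4) by linarith
    ultimately show False using Q(2)[of Z] Z by (simp add: P_def)
  qed
  have "P (V - Q)" using Q(1) cut_size_compl[OF QV] QV by (simp add: P_def double_diff)
  then have half: "2 * card Q \<le> card V" using Q(2) cV by fastforce
  have img: "\<phi> ` Q \<subseteq> V" "card (\<phi> ` Q) = card Q" "cut_size (\<phi> ` Q) = k" "finite (\<phi> ` Q)"
    if "\<phi> \<in> Aut" for \<phi>
    using Aut_image_sub[OF that QV] Aut_image_card[OF that] Aut_cut_size[OF that QV] dQ finQ by auto
  have bl: "\<phi> ` Q = Q \<or> \<phi> ` Q \<inter> Q = {}" if \<phi>: "\<phi> \<in> Aut" for \<phi>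
  proof (rule ccontr)
    let ?Z = "\<phi> ` Q"
    note Z = img[OF \<phi>]
    assume *: "\<not> (?Z = Q \<or> ?Z \<inter> Q = {})"
    have ne: "Q - ?Z \<noteq> {}" "?Z - Q \<noteq> {}" using equal_card_diff[OF finQ Z(4)] * Z(2) by auto
    have sub: "Q \<inter> ?Z \<subset> Q" "Q - ?Z \<subset> Q" using ne * by auto
    have "card (Q \<union> ?Z) + card (Q \<inter> ?Z) = 2 * card Q"
      using card_Un_Int[OF finQ Z(4)] Z(2) by simp
    moreover have "card (Q \<inter> ?Z) > 0" using * finQ by (auto simp: card_gt_0_iff)
    ultimately have "Q \<union> ?Z \<noteq> V" using half by auto
    then have "cut_size (Q \<inter> ?Z) = k" using cut_uncross(1)[OF QV Z(1) dQ Z(3)] * by blast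
    then have 1: "card (Q \<inter> ?Z) = 1"
      using psubset_card_mono[OF finQ sub(1)] QV * by (intro small) auto

    have "cut_size (Q - ?Z) = k" using cut_uncross(2)[OF QV Z(1) dQ Z(3)] ne by blast
    then have 2: "card (Q - ?Z) = 1"
      using psubset_card_mono[OF finQ sub(2)] QV ne by (intro small) auto
    have "card Q = 2" using 1 2 card_Int_Diff[OF finQ, of ?Z] by simp
    then show False using cut_size_pair[OF QV] dQ k3 by simp
  qed
  then have "block Q" unfolding block_def using QV cQ by auto
  moreover have "Q \<noteq> V" using cQ by auto
  ultimately have Qk: "card Q = k" "clique G Q" using block_cut(2)[of Q] dQ cQ by auto
  have last: "card X = 1 \<or> card (V - X) = 1"
    if ek: "even k" and X: "X \<subseteq> V" "odd (card X)" "odd (card (V - X))" "cut_size X = k" for X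
  proof -
    have finX: "finite X" using X(1) fin by (rule finite_subset)
    obtain \<phi> where \<phi>: "\<phi> \<in> Aut" "\<phi> ` Q \<inter> X \<noteq> {}" "\<not> \<phi> ` Q \<subseteq> X"
    proof (rule ccontr)
      assume no: "\<not> thesis"
      \<comment> \<open>otherwise \<open>X\<close> is a union of images of \<open>Q\<close>, each with the even number \<open>k\<close> of vertices\<close>
      define C where "C = {\<phi> ` Q |\<phi>. \<phi> \<in> Aut \<and> \<phi> ` Q \<subseteq> X}"
      have XC: "X = \<Union>C"
      proof
        show "X \<subseteq> \<Union>C"
        proof
          fix x assume x: "x \<in> X"
          obtain q where q: "q \<in> Q" using cQ by fastforce
          obtain \<phi> where "\<phi> \<in> Aut" "\<phi> q = x" using Aut_transitive[of q x] q QV x X(1) by blast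
          then show "x \<in> \<Union>C" using no that[of \<phi>] q x unfolding C_def by blast
        qed
      qed (auto simp: C_def)
      have "k dvd card (\<Union>C)"
      proof (rule dvd_partition)
        show "finite (\<Union>C)" using finX XC by simp
        show "\<forall>c\<in>C. k dvd card c" using img(2) Qk by (auto simp: C_def)
        show "\<forall>c1\<in>C. \<forall>c2\<in>C. c1 \<noteq> c2 \<longrightarrow> c1 \<inter> c2 = {}"
        proof (intro ballI impI)
          fix c1 c2 assume c: "c1 \<in> C" "c2 \<in> C" "c1 \<noteq> c2"
          then obtain \<phi> \<psi> where p: "\<phi> \<in> Aut" "\<psi> \<in> Aut" "c1 = \<phi> ` Q" "c2 = \<psi> ` Q"
            by (auto simp: C_def)
          have i: "\<psi> ` (inv \<psi> ` A) = A" for A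
            using permutes_inverses(1)[OF Aut_perm[OF p(2)]] by (simp add: image_image)
          have "(inv \<psi> \<circ> \<phi>) ` Q = Q \<or> (inv \<psi> \<circ> \<phi>) ` Q \<inter> Q = {}"
            by (rule bl[OF Aut_comp[OF Aut_inv[OF p(2)] p(1)]])
          then have "inv \<psi> ` c1 = Q \<or> inv \<psi> ` c1 \<inter> Q = {}" by (simp add: p(3) image_comp)
          then have "c1 = c2 \<or> \<psi> ` (inv \<psi> ` c1 \<inter> Q) = {}" using i[of c1] p(4) by auto
          then show "c1 \<inter> c2 = {}"
            using c(3) i[of c1] p(4) image_Int[OF Aut_inj[OF p(2)]] by metis
        qed
      qed
      then have "even (card X)" using ek XC dvd_trans by metis
      then show False using X(2) by simp
    qed
    let ?Z = "\<phi> ` Q"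
    note Z = img[OF \<phi>(1)]
    have lt: "card (?Z \<inter> X) < card Q" "card (?Z - X) < card Q"
      using psubset_card_mono[OF Z(4), of "?Z \<inter> X"] psubset_card_mono[OF Z(4), of "?Z - X"] \<phi> Z(2)
      by auto
    consider "?Z \<union> X = V" | "X \<subseteq> ?Z" | "?Z \<union> X \<noteq> V" "X - ?Z \<noteq> {}" by blast
    then show ?thesis
    proof cases
      case 1
      then have "V - X = ?Z - X" using Z(1) by blast
      moreover have "cut_size (V - X) = k" using cut_size_compl X by simp
      ultimately show ?thesis using small[of "?Z - X"] lt \<phi>(3) Z(1) by auto
    next
      case 2
      then have "?Z \<inter> X = X" by blast
      then show ?thesis using small[of X] lt X(1,4) \<phi>(2) by auto
    next
      case 3
      have ne: "?Z - X \<noteq> {}" using \<phi>(3) by auto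
      have "cut_size (?Z \<inter> X) = k" "cut_size (?Z - X) = k"
        using cut_uncross(1)[OF Z(1) X(1) Z(3) X(4) \<phi>(2) 3(1)]
          cut_uncross(2)[OF Z(1) X(1) Z(3) X(4) ne 3(2)] by auto
      then have "card (?Z \<inter> X) = 1" "card (?Z - X) = 1"
        using small[OF _ \<phi>(2) _ lt(1)] small[OF _ ne _ lt(2)] Z(1) by auto
      then have "card Q = 2" using card_Int_Diff[OF Z(4), of X] Z(2) by simp
      then show ?thesis using Qk k3 by simp
    qed
  qed
  show ?thesis using that[OF Qk(2,1)] last cV cQ Qk by auto
qed

end

section \<open>Barriers behind small preclusion sets\<close>

context vertex_transitive_graph
begin

definition pairs :: "'a set \<Rightarrow> 'a set \<Rightarrow> ('a \<times> 'a) set" where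
  "pairs A B = {(x, y). x \<in> A \<and> y \<in> B \<and> x \<sim> y}"

lemma finite_pairs: "finite (pairs A B)"
  by (rule finite_subset[of _ "V \<times> V"]) (use adj_verts fin in \<open>auto simp: pairs_def\<close>)

lemma card_pairs_commute: "card (pairs A B) = card (pairs B A)"
proof -
  have "pairs B A = prod.swap ` pairs A B"
    using adj_sym by (auto simp: pairs_def image_def)
  then show ?thesis by (simp add: card_image)
qed

lemma card_pairs_all:
  assumes "A \<subseteq> V"
  shows "card (pairs A V) = k * card A"
proof -
  have "pairs A V = (SIGMA x:A. nbrs x)" using adj_verts by (auto simp: pairs_def nbrs_def)
  moreover have "finite A" using assms fin by (rule finite_subset)
  moreover have "card (nbrs x) = k" if "x \<in> A" for x using card_nbrs that assms by blast
  ultimately show ?thesis using fin_nbrs by simp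
qed

text \<open>What is left of Tutte's condition when \<open>S\<close> is a preclusion set with at most \<open>k\<close> edges other
than a star: \<open>U\<close> is independent, its complement has two more vertices, and \<open>S\<close> consists of the
\<open>k\<close> edges in that complement (counted twice below), which have no vertex in common.\<close>

definition barrier :: "'a set \<Rightarrow> bool" where
  "barrier U \<longleftrightarrow> U \<subseteq> V \<and> (\<forall>x\<in>U. \<forall>y\<in>U. \<not> x \<sim> y) \<and> card (V - U) = card U + 2 \<and>
     card (pairs (V - U) (V - U)) = 2 * k \<and>
     (\<forall>v\<in>V. \<exists>x y. x \<in> V - U \<and> y \<in> V - U \<and> x \<sim> y \<and> x \<noteq> v \<and> y \<noteq> v)"

definition tight_odd_cuts_trivial :: bool where
  "tight_odd_cuts_trivial \<longleftrightarrow> (\<forall>X\<subseteq>V. odd (card X) \<longrightarrow> odd (card (V - X)) \<longrightarrow> cut_size X = k \<longrightarrow>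
     card X = 1 \<or> card (V - X) = 1)"

lemma no_star_subset:
  assumes S: "S \<subseteq> edges G" "card S = k" "\<And>v. v \<in> V \<Longrightarrow> S \<noteq> incident_edges G v"
    and v: "v \<in> V"
  shows "\<exists>e\<in>S. v \<notin> e"
proof (rule ccontr)
  assume "\<not> ?thesis"
  then have "S \<subseteq> incident_edges G v" using S(1) by (auto simp: incident_edges_def)
  moreover have "finite (incident_edges G v)"
  proof (rule finite_subset)
    show "incident_edges G v \<subseteq> Pow V" using simple by (auto simp: incident_edges_def simple_graph_def)
  qed (use fin in simp)
  moreover have "card (incident_edges G v) = k" using regular v by (simp add: regular_graph_def)
  ultimately have "S = incident_edges G v" using S(2) card_subset_eq by metis
  then show False using S(3) v by blast
qed

text \<open>Tutte's condition gives \<open>U\<close> and an odd family \<open>F\<close> with, by parity, \<open>card F \<ge> card U + 2\<close>.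
Edge connectivity provides at least \<open>k * (card U + 2)\<close> pairs \<open>(x, y)\<close> with \<open>x\<close> in a member
of \<open>F\<close> and \<open>y\<close> outside that member. On the other hand each such pair ends in \<open>U\<close>, and there are
\<open>k * card U\<close> pairs of this kind, or its edge is in \<open>S\<close>, and this accounts for at most
\<open>2 * k\<close> more. So equality holds throughout: \<open>U\<close> is independent, \<open>F\<close> covers the other
vertices, \<open>S\<close> is the set of the \<open>k\<close> edges between members, and every member has a cut with
exactly \<open>k\<close> edges. By assumption the members are then singletons, as the
complement of a singleton would make \<open>S\<close> a star.\<close>

lemma barrier_exists:
  assumes k: "k \<ge> 1" and even: "even (card V)"
    and pre: "matching_preclusion_set G S" and cS: "card S \<le> k"
    and nontriv: "\<And>v. v \<in> V \<Longrightarrow> S \<noteq> incident_edges G v"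
    and oc: tight_odd_cuts_trivial
  obtains U where "barrier U"
proof -
  have SE: "S \<subseteq> edges G" using pre by (simp add: matching_preclusion_set_def)
  have finE: "finite (edges G)"
    by (rule finite_subset[of _ "Pow V"]) (use simple fin in \<open>auto simp: simple_graph_def\<close>)
  have finS: "finite S" using SE finE by (rule finite_subset)
  have two: "card e = 2" if "e \<in> edges G - S" for e using that simple by (auto simp: simple_graph_def)
  have "\<not> (\<exists>M\<subseteq>edges G - S. pairwise disjnt M \<and> \<Union>M = V)"
    using pre by (auto simp: matching_preclusion_set_def perfect_matching_def delete_edges_def)
  then obtain U F0 where U: "U \<subseteq> V" and F0: "odd_family (edges G - S) (V - U) F0" "card U < card F0"
    using tutte[OF fin, of "edges G - S"] two by (meson not_le)
  have finU: "finite U" using U fin by (rule finite_subset)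
  obtain F where F: "odd_family (edges G - S) (V - U) F" "card F0 \<le> card F"
      "even (card (V - U) + card F)"
    using odd_family_even_rest[OF F0(1)] fin two by auto
  have cVU: "card V = card (V - U) + card U"
    using card_Diff_subset[OF finU U] card_mono[OF fin U] by linarith
  then have cF: "card U + 2 \<le> card F" using F(2,3) F0(2) even by presburger
  have FV: "C \<subseteq> V - U" and Fodd: "odd (card C)" if "C \<in> F" for C
    using F(1) that by (auto simp: odd_family_def)
  have Fne: "C \<noteq> {}" if "C \<in> F" for C using Fodd[OF that] by auto
  have Fedge: "e \<subseteq> C" if "C \<in> F" "e \<in> edges G - S" "e \<subseteq> V - U" "e \<inter> C \<noteq> {}" for C e
    using F(1) that unfolding odd_family_def by blast
  have disj: "C \<inter> D = {}" if "C \<in> F" "D \<in> F" "C \<noteq> D" for C D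
    using F(1) that by (auto simp: odd_family_def pairwise_def disjnt_def)
  have finF: "finite F" using odd_family_finite[OF F(1)] fin by simp
  have other: "\<exists>D\<in>F. D \<noteq> C" for C
  proof (rule ccontr)
    assume "\<not> ?thesis"
    then have "F \<subseteq> {C}" by blast
    then have "card F \<le> 1" by (metis card.empty card_insert_le_m1 card_mono finite.emptyI
      finite.insertI le_numeral_extra(4) is_singletonI is_singleton_altdef)
    then show False using cF by simp
  qed
  have FneV: "C \<noteq> V" if C: "C \<in> F" for C
  proof
    assume CV: "C = V"
    obtain D where "D \<in> F" "D \<noteq> C" using other by blast
    then show False using disj[of C D] C CV FV[of D] Fne[of D] by blast
  qed
  have ge: "k \<le> cut_size C" if "C \<in> F" for C
    using edge_connectivity[of C] FV Fne FneV that by blast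
  define T where "T = (\<Union>C\<in>F. boundary C)"
  \<comment> \<open>pairs that end in \<open>U\<close>, and pairs whose edge is in \<open>S\<close>\<close>
  define TU where "TU = {(x, y). x \<sim> y \<and> y \<in> U}"
  define TS where "TS = {(x, y). {x, y} \<in> S}"
  have finTU: "finite TU"
    by (rule finite_subset[of _ "V \<times> V"]) (use adj_verts fin in \<open>auto simp: TU_def\<close>)
  have TS_adj: "x \<sim> y" if "(x, y) \<in> TS" for x y using that SE by (auto simp: TS_def adj_def)
  have TS_sym: "(y, x) \<in> TS" if "(x, y) \<in> TS" for x y using that by (simp add: TS_def insert_commute)
  have finTS: "finite TS"
    by (rule finite_subset[of _ "V \<times> V"]) (use TS_adj adj_verts fin in auto)
  have cT: "card T = (\<Sum>C\<in>F. cut_size C)"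
    unfolding T_def cut_size_def
  proof (rule card_UN_disjoint[OF finF])
    show "\<forall>C\<in>F. finite (boundary C)" using finite_boundary by blast
    show "\<forall>C\<in>F. \<forall>D\<in>F. C \<noteq> D \<longrightarrow> boundary C \<inter> boundary D = {}"
    proof (intro ballI impI)
      fix C D assume "C \<in> F" "D \<in> F" "C \<noteq> D"
      then have "C \<inter> D = {}" by (rule disj)
      then show "boundary C \<inter> boundary D = {}" by (auto simp: boundary_def)
    qed
  qed
  have cTU: "card TU = k * card U"
  proof -
    have "TU = pairs V U" using adj_verts by (auto simp: TU_def pairs_def)
    then show ?thesis using card_pairs_commute card_pairs_all[OF U] by simp
  qed
  have cTS: "card TS \<le> 2 * card S"
  proof -
    have "card {(x, y). {x, y} = e} \<le> 2" if "e \<in> S" for e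
    proof -
      have "e \<in> edges G" using that SE by blast
      then obtain a b where ab: "e = {a, b}" by (rule edge_pair)
      have "{(x, y). {x, y} = e} \<subseteq> {(a, b), (b, a)}" unfolding ab by (auto simp: doubleton_eq_iff)
      then have "card {(x, y). {x, y} = e} \<le> card {(a, b), (b, a)}" by (rule card_mono[rotated]) simp
      also have "\<dots> \<le> 2" by (cases "a = b") simp_all
      finally show ?thesis .
    qed
    moreover have "TS = (\<Union>e\<in>S. {(x, y). {x, y} = e})" by (auto simp: TS_def)
    ultimately show ?thesis
      using card_UN_le[OF finS, of "\<lambda>e. {(x, y). {x, y} = e}"]
        sum_bounded_above[of S "\<lambda>e. card {(x, y). {x, y} = e}" 2] by simp
  qed
  have sub: "T \<subseteq> TU \<union> TS"
  proof (clarify)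
    fix x y assume xy: "(x, y) \<in> T" "(x, y) \<notin> TS"
    then obtain C where C: "C \<in> F" "x \<in> C" "y \<notin> C" "x \<sim> y" by (auto simp: T_def boundary_def)
    show "(x, y) \<in> TU"
    proof (rule ccontr)
      assume "(x, y) \<notin> TU"
      then have "{x, y} \<subseteq> V - U" using C FV adj_verts by (auto simp: TU_def)
      moreover have "{x, y} \<in> edges G - S" using xy(2) C(4) by (auto simp: TS_def adj_def)
      ultimately show False using Fedge[OF C(1), of "{x, y}"] C by blast
    qed
  qed
  have l1: "card F * k \<le> card T" unfolding cT using sum_bounded_below[of F k cut_size] ge by simp
  have l2: "card T \<le> card (TU \<union> TS)" using sub finTU finTS by (intro card_mono) auto
  have l3: "card (TU \<union> TS) + card (TU \<inter> TS) = k * card U + card TS"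
    using card_Un_Int[OF finTU finTS] cTU by simp
  have l4: "(card U + 2) * k \<le> card F * k" using cF by (rule mult_le_mono1)
  have e1: "card F * k = (card U + 2) * k" "card T = card (TU \<union> TS)" "card (TU \<inter> TS) = 0"
    "card TS = 2 * k" "card S = k" "card T = card F * k"
    using l1 l2 l3 l4 cTS cS by (simp_all add: algebra_simps)
  have cF': "card F = card U + 2" using e1(1) k mult_cancel2[of "card F" k "card U + 2"] by linarith
  have TT: "T = TU \<union> TS" using sub e1(2) finTU finTS by (intro card_subset_eq) auto
  have dj: "TU \<inter> TS = {}" using e1(3) finTU by simp
  have cutk: "cut_size C = k" if C: "C \<in> F" for C
  proof (rule ccontr)
    assume "cut_size C \<noteq> k"
    then have "k < cut_size C" using ge[OF C] by simp
    then have "(\<Sum>C\<in>F. k) < (\<Sum>C\<in>F. cut_size C)"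
      using C finF ge by (intro sum_strict_mono2[of F] sum_strict_mono_ex1) auto
    then show False using e1(6) cT by simp
  qed
  have T1: "\<exists>C\<in>F. x \<in> C" if "(x, y) \<in> T" for x y using that by (auto simp: T_def boundary_def)
  have indep: "\<not> x \<sim> y" if "x \<in> U" "y \<in> U" for x y
  proof
    assume "x \<sim> y"
    then have "(x, y) \<in> T" using that TT by (auto simp: TU_def)
    then show False using T1 FV that by blast
  qed
  have cover: "\<Union>F = V - U"
  proof (rule ccontr)
    assume "\<Union>F \<noteq> V - U"
    define R where "R = V - U - \<Union>F"
    have "R \<noteq> {}" using \<open>\<Union>F \<noteq> V - U\<close> FV by (auto simp: R_def)
    moreover have "R \<noteq> V"
    proof -
      obtain D where "D \<in> F" using other by blast
      then show ?thesis using Fne[of D] FV[of D] by (auto simp: R_def)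
    qed
    moreover have "R \<subseteq> V" by (auto simp: R_def)
    ultimately obtain x y where xy: "x \<in> R" "x \<sim> y" "y \<notin> R" using connected_closed[of R] by blast
    have nx: "(x, z) \<notin> T" for z using T1[of x z] xy(1) by (auto simp: R_def)
    have "y \<in> V" using adj_verts xy(2) by blast
    then consider "y \<in> U" | C where "C \<in> F" "y \<in> C" using xy(3) by (auto simp: R_def)
    then show False
    proof cases
      case 1
      then show False using nx[of y] TT xy(2) by (auto simp: TU_def)
    next
      case (2 C)
      then have "(y, x) \<in> T" using adj_sym[OF xy(2)] xy(1) by (auto simp: T_def boundary_def R_def)
      then have "(y, x) \<in> TS" using TT xy(1) by (auto simp: TU_def R_def)
      then show False using TS_sym TT nx by blast
    qed
  qed
  note nostar = no_star_subset[OF SE e1(5) nontriv]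
  have single: "card C = 1" if C: "C \<in> F" for C
  proof (rule ccontr)
    assume "card C \<noteq> 1"
    have CV: "C \<subseteq> V" using FV C by blast
    have "odd (card (V - C))"
      using even Fodd[OF C] card_Diff_subset[OF finite_subset[OF CV fin] CV] card_mono[OF fin CV]
      by simp
    then have "card (V - C) = 1"
      using oc CV Fodd[OF C] cutk[OF C] \<open>card C \<noteq> 1\<close> unfolding tight_odd_cuts_trivial_def by blast
    then obtain v where v: "V - C = {v}" by (auto simp: card_1_singleton_iff)
    obtain e where e: "e \<in> S" "v \<notin> e" using nostar[of v] v by blast
    have "e \<in> edges G" using e(1) SE by blast
    then obtain x y where xy: "e = {x, y}" by (rule edge_pair)
    have "(x, y) \<in> T" using e(1) xy TT by (auto simp: TS_def)
    then obtain D where D: "D \<in> F" "x \<in> D" "y \<notin> D" "x \<sim> y" by (auto simp: T_def boundary_def)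
    have "x \<in> V - {v}" "y \<in> V - {v}" using adj_verts[OF D(4)] e xy by auto
    then have "x \<in> C" "y \<in> C" using v by auto
    then show False using disj[OF D(1) C] D by blast
  qed
  have cW: "card (V - U) = card U + 2"
  proof -
    have "card (\<Union>F) = (\<Sum>C\<in>F. card C)"
    proof (rule card_Union_disjoint)
      show "pairwise disjnt F" using F(1) by (simp add: odd_family_def)
      show "finite C" if "C \<in> F" for C using FV[OF that] fin by (meson finite_Diff finite_subset)
    qed
    then show ?thesis using cover single cF' by simp
  qed
  have WS: "pairs (V - U) (V - U) = TS"
  proof (rule set_eqI, clarify)
    fix x y
    show "(x, y) \<in> pairs (V - U) (V - U) \<longleftrightarrow> (x, y) \<in> TS"
    proof
      assume "(x, y) \<in> pairs (V - U) (V - U)"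
      then have xy: "x \<in> V - U" "y \<in> V - U" "x \<sim> y" by (auto simp: pairs_def)
      then obtain C where C: "C \<in> F" "x \<in> C" using cover by blast
      then obtain z where "C = {z}" using single[OF C(1)] by (auto simp: card_1_singleton_iff)
      then have "y \<notin> C" using C xy(3) adj_irrefl by auto
      then have "(x, y) \<in> T" using C xy(3) by (auto simp: T_def boundary_def)
      then show "(x, y) \<in> TS" using TT xy(2) by (auto simp: TU_def)
    next
      assume xy: "(x, y) \<in> TS"
      then have "(x, y) \<notin> TU" "(y, x) \<notin> TU" using dj TS_sym by blast+
      moreover have "x \<sim> y" "y \<sim> x" using TS_adj xy adj_sym by blast+
      ultimately show "(x, y) \<in> pairs (V - U) (V - U)" using adj_verts by (auto simp: TU_def pairs_def)
    qed
  qed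
  have "\<exists>x y. x \<in> V - U \<and> y \<in> V - U \<and> x \<sim> y \<and> x \<noteq> v \<and> y \<noteq> v" if v: "v \<in> V" for v
  proof -
    obtain e where e: "e \<in> S" "v \<notin> e" using nostar[OF _ v] by blast
    have "e \<in> edges G" using e(1) SE by blast
    then obtain x y where xy: "e = {x, y}" by (rule edge_pair)
    then have "(x, y) \<in> pairs (V - U) (V - U)" using e(1) WS by (simp add: TS_def)
    then show ?thesis using e(2) xy by (auto simp: pairs_def)
  qed
  then have "barrier U"
    using U indep cW WS e1(4) unfolding barrier_def by simp
  then show ?thesis by (rule that)
qed

text \<open>If \<open>A\<close> were one side of a bipartition, counting edges at \<open>W1\<close> and at \<open>W2\<close> would give
\<open>card W1 = card U2 + 1\<close> and \<open>card W2 = card U1 + 1\<close>. Then \<open>U1 \<union> W2\<close> has odd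
size, and the edges that leave it are the \<open>k\<close> edges between \<open>W1\<close> and \<open>W2\<close>. So one of
\<open>W1\<close>, \<open>W2\<close> is a single vertex, which all those edges share.\<close>

lemma barrier_not_bipartite:
  assumes k: "k \<ge> 1" and even: "even (card V)" and oc: tight_odd_cuts_trivial
    and bar: "barrier U"
  shows "\<exists>x y. x \<sim> y \<and> (x \<in> A \<longleftrightarrow> y \<in> A)"
proof (rule ccontr)
  assume no: "\<not> ?thesis"
  then have bip: "x \<in> A \<longleftrightarrow> y \<notin> A" if "x \<sim> y" for x y using that by blast
  have U: "U \<subseteq> V" "\<And>x y. x \<in> U \<Longrightarrow> y \<in> U \<Longrightarrow> \<not> x \<sim> y" "card (pairs (V - U) (V - U)) = 2 * k"
    using bar by (auto simp: barrier_def)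
  \<comment> \<open>the edges counted by \<open>barrier\<close> do not all meet in one vertex\<close>
  have nostar: "\<exists>x y. x \<in> V - U \<and> y \<in> V - U \<and> x \<sim> y \<and> x \<noteq> v \<and> y \<noteq> v" if "v \<in> V" for v
    using bar that by (simp add: barrier_def)
  define W1 W2 U1 U2 where "W1 = (V - U) \<inter> A" and "W2 = V - U - A" and "U1 = U \<inter> A" and "U2 = U - A"
  note defs = W1_def W2_def U1_def U2_def
  have subs: "W1 \<subseteq> V" "W2 \<subseteq> V" "U1 \<subseteq> V" "U2 \<subseteq> V" using U(1) by (auto simp: defs)
  have fins: "finite W1" "finite W2" "finite U1" "finite U2" using subs fin finite_subset by blast+
  have "pairs (V - U) (V - U) = pairs W1 W2 \<union> pairs W2 W1"
    using bip by (auto simp: pairs_def defs)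
  moreover have "pairs W1 W2 \<inter> pairs W2 W1 = {}" by (auto simp: pairs_def defs)
  ultimately have "card (pairs W1 W2) + card (pairs W2 W1) = 2 * k"
    using U(3) finite_pairs by (simp add: card_Un_disjoint)
  then have p: "card (pairs W1 W2) = k" "card (pairs W2 W1) = k"
    using card_pairs_commute[of W1 W2] by simp_all
  have c: "k * card W1 = k * card U2 + k"
  proof -
    have "pairs W1 V = pairs W1 U2 \<union> pairs W1 W2" using bip adj_verts U(1)
      by (auto simp: pairs_def defs)
    moreover have "pairs W1 U2 \<inter> pairs W1 W2 = {}" by (auto simp: pairs_def defs)
    moreover have "pairs U2 V = pairs U2 W1" using bip U(2) adj_verts by (fastforce simp: pairs_def defs)
    ultimately show ?thesis
      using card_pairs_all[OF subs(1)] card_pairs_all[OF subs(4)] finite_pairs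
        card_pairs_commute[of W1 U2] p(1) by (simp add: card_Un_disjoint)
  qed
  have c': "k * card W2 = k * card U1 + k"
  proof -
    have "pairs W2 V = pairs W2 U1 \<union> pairs W2 W1" using bip adj_verts U(1)
      by (auto simp: pairs_def defs)
    moreover have "pairs W2 U1 \<inter> pairs W2 W1 = {}" by (auto simp: pairs_def defs)
    moreover have "pairs U1 V = pairs U1 W2" using bip U(2) adj_verts by (fastforce simp: pairs_def defs)
    ultimately show ?thesis
      using card_pairs_all[OF subs(2)] card_pairs_all[OF subs(3)] finite_pairs
        card_pairs_commute[of W2 U1] p(2) by (simp add: card_Un_disjoint)
  qed
  have w: "card W1 = card U2 + 1" "card W2 = card U1 + 1"
  proof -
    have "k * card W1 = k * (card U2 + 1)" "k * card W2 = k * (card U1 + 1)" using c c' by auto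
    then show "card W1 = card U2 + 1" "card W2 = card U1 + 1" using k by (simp_all only: mult_cancel1) auto
  qed
  define X where "X = U1 \<union> W2"
  have X: "X \<subseteq> V" "V - X = U2 \<union> W1" using U(1) by (auto simp: X_def defs)
  have cX: "card X = 2 * card U1 + 1" using w fins by (subst X_def, subst card_Un_disjoint) (auto simp: defs)
  have cX': "card (V - X) = 2 * card U2 + 1" unfolding X(2) using w fins by (subst card_Un_disjoint) (auto simp: defs)
  have "boundary X = pairs W2 W1"
    unfolding boundary_def pairs_def X_def using bip U(1,2) adj_verts by (fastforce simp: defs)
  then have "cut_size X = k" using p by (simp add: cut_size_def)
  then have "card X = 1 \<or> card (V - X) = 1"
    using oc X(1) cX cX' by (auto simp: tight_odd_cuts_trivial_def)
  then have "card W2 = 1 \<or> card W1 = 1" using cX cX' w by auto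
  then obtain v where v: "W2 = {v} \<or> W1 = {v}" by (auto simp: card_1_singleton_iff)
  then have "v \<in> V" using subs by blast
  from nostar[OF this] obtain x y where "x \<in> V - U" "y \<in> V - U" "x \<sim> y" "x \<noteq> v" "y \<noteq> v" by blast
  then show False using v bip[of x y] unfolding defs by blast
qed

end

section \<open>Residues and periodic sequences\<close>

lemma card_range_periodic:
  assumes "L > 0" "\<And>i j. c i = c j \<longleftrightarrow> int L dvd j - i"
  shows "range c = c ` {0..<int L}" "card (range c) = L" "inj_on c {0..<int L}"
proof -
  have "c i \<in> c ` {0..<int L}" for i
  proof
    show "c i = c (i mod int L)" unfolding assms(2) by (metis dvd_minus_mod dvd_minus_iff minus_diff_eq)
    show "i mod int L \<in> {0..<int L}" using assms(1) by simp
  qed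
  then show r: "range c = c ` {0..<int L}" by auto
  show inj: "inj_on c {0..<int L}"
  proof (rule inj_onI)
    fix i j assume ij: "i \<in> {0..<int L}" "j \<in> {0..<int L}" "c i = c j"
    then have "int L dvd j - i" "\<bar>j - i\<bar> < int L" using assms(2) by auto
    then show "i = j" using dvd_imp_le_int[of "j - i" "int L"] by fastforce
  qed
  show "card (range c) = L" unfolding r using inj by (simp add: card_image)
qed

lemma odd_lift:
  fixes i :: int
  assumes "odd n"
  obtains j where "0 \<le> j" "j < 2 * int n" "int n dvd j - i" "even j \<longleftrightarrow> e"
proof -
  define r where "r = i mod int n"
  have n: "n > 0" using assms by (rule odd_pos)
  have r: "0 \<le> r" "r < int n" "int n dvd r - i" using n by (auto simp: r_def mod_eq_dvd_iff[symmetric])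
  show thesis
  proof (cases "even r \<longleftrightarrow> e")
    case True
    then show thesis using r that[of r] by auto
  next
    case False
    moreover have "int n dvd (r + int n) - i" using r(3) by (metis add_diff_eq add.commute dvd_add_triv_left_iff)
    ultimately show thesis using r assms that[of "r + int n"] by auto
  qed
qed

lemma dvd_half_iff:
  fixes h t :: int
  shows "h dvd t \<longleftrightarrow> 2 * h dvd t \<or> 2 * h dvd t - h"
proof
  assume "h dvd t"
  then obtain q where q: "t = h * q" by blast
  show "2 * h dvd t \<or> 2 * h dvd t - h"
  proof (cases "even q")
    case True
    then obtain r where "q = 2 * r" by blast
    then have "t = 2 * h * r" using q by simp
    then show ?thesis by simp
  next
    case False
    then obtain r where "q = 2 * r + 1" by (rule oddE)
    then have "t - h = 2 * h * r" using q by (simp add: algebra_simps)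
    then show ?thesis by simp
  qed
next
  assume "2 * h dvd t \<or> 2 * h dvd t - h"
  then have "h dvd t \<or> h dvd t - h" using dvd_mult_right[of 2 h] by blast
  then show "h dvd t" using dvd_add[of h "t - h" h] by auto
qed

lemma dvd_minus_minus_diff: "(m::int) dvd - a - (m - a)"
proof -
  have "- a - (m - a) = - m" by simp
  then show ?thesis by (metis dvd_minus_iff dvd_refl)
qed

section \<open>Independent sets and shortest odd cycles\<close>

context vertex_transitive_graph
begin

text \<open>Over all automorphisms \<open>\<phi>\<close>, the average number of vertices of \<open>X\<close> that are sent to \<open>U\<close>
is \<open>card U * card X / card V\<close>, because a random automorphism sends a vertex to each vertex with
the same probability.\<close>

lemma Aut_average:
  assumes X: "X \<subseteq> V" and U: "U \<subseteq> V"
    and a: "\<And>\<phi>. \<phi> \<in> Aut \<Longrightarrow> card {x \<in> X. \<phi> x \<in> U} \<le> a"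
  shows "card U * card X \<le> a * card V"
proof -
  define T where "T x y = {\<phi> \<in> Aut. \<phi> x = y}" for x y
  have finX: "finite X" and finU: "finite U" using X U fin finite_subset by blast+
  have finT: "finite (T x y)" for x y using finite_Aut by (simp add: T_def)
  have count: "card {x \<in> A. P x} = (\<Sum>x\<in>A. if P x then 1 else 0)" if "finite A" for A :: "'b set" and P
    using that by (simp add: sum.If_cases Int_def)
  have le: "card (T x y) \<le> card (T x z)" if yz: "y \<in> V" "z \<in> V" for x y z
  proof -
    obtain \<psi> where \<psi>: "\<psi> \<in> Aut" "\<psi> y = z" using Aut_transitive yz by blast
    have "inj_on ((\<circ>) \<psi>) (T x y)"
      using Aut_inj[OF \<psi>(1)] by (auto simp: inj_on_def fun_eq_iff dest: injD)
    moreover have "(\<circ>) \<psi> ` T x y \<subseteq> T x z"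
      using Aut_comp[OF \<psi>(1)] \<psi>(2) by (auto simp: T_def)
    ultimately show ?thesis using card_inj_on_le finT by blast
  qed
  have uniform: "card V * card (T x y) = card Aut" if xy: "x \<in> V" "y \<in> V" for x y
  proof -
    have "Aut = (\<Union>z\<in>V. T x z)" using Aut_in_V xy by (auto simp: T_def)
    then have "card Aut = (\<Sum>z\<in>V. card (T x z))"
      using card_UN_disjoint[of V "T x"] fin finT by (auto simp: T_def)
    also have "\<dots> = (\<Sum>z\<in>V. card (T x y))"
      using le xy by (intro sum.cong refl le_antisym) auto
    finally show ?thesis by simp
  qed
  have "(\<Sum>\<phi>\<in>Aut. card {x \<in> X. \<phi> x \<in> U}) = (\<Sum>\<phi>\<in>Aut. \<Sum>x\<in>X. \<Sum>y\<in>U. if \<phi> x = y then 1 else 0)"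
    using finU by (intro sum.cong refl) (simp add: count[OF finX] sum.delta)
  also have "\<dots> = (\<Sum>x\<in>X. \<Sum>\<phi>\<in>Aut. \<Sum>y\<in>U. if \<phi> x = y then 1 else 0)" by (rule sum.swap)
  also have "\<dots> = (\<Sum>x\<in>X. \<Sum>y\<in>U. \<Sum>\<phi>\<in>Aut. if \<phi> x = y then 1 else 0)"
    by (intro sum.cong refl sum.swap)
  also have "\<dots> = (\<Sum>x\<in>X. \<Sum>y\<in>U. card (T x y))"
    by (intro sum.cong refl) (simp add: T_def count[OF finite_Aut])
  finally have "card V * (\<Sum>\<phi>\<in>Aut. card {x \<in> X. \<phi> x \<in> U}) =
      (\<Sum>x\<in>X. \<Sum>y\<in>U. card V * card (T x y))" by (simp add: sum_distrib_left)
  also have "\<dots> = (\<Sum>x\<in>X. \<Sum>y\<in>U. card Aut)"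
    using uniform X U by (intro sum.cong refl) auto
  finally have "card Aut * (card U * card X) = card V * (\<Sum>\<phi>\<in>Aut. card {x \<in> X. \<phi> x \<in> U})"
    by (simp add: mult_ac)
  also have "\<dots> \<le> card V * (card Aut * a)"
    using a sum_bounded_above[of Aut "\<lambda>\<phi>. card {x \<in> X. \<phi> x \<in> U}" a] by (intro mult_le_mono2) simp
  finally have "card Aut * (card U * card X) \<le> card Aut * (a * card V)" by (simp add: mult_ac)
  moreover have "card Aut > 0"
  proof -
    obtain x where "x \<in> V" using V_nonempty by blast
    then obtain \<phi> where "\<phi> \<in> Aut" using Aut_transitive by blast
    then show ?thesis using finite_Aut by (auto simp: card_gt_0_iff)
  qed
  ultimately show ?thesis by simp
qed

definition independent :: "'a set \<Rightarrow> bool" where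
  "independent I \<longleftrightarrow> (\<forall>x\<in>I. \<forall>y\<in>I. \<not> x \<sim> y)"

text \<open>In a vertex-transitive graph no independent set is denser than the largest independent set of any
given subgraph (the no-homomorphism lemma).\<close>

lemma independent_average:
  assumes "X \<subseteq> V" "U \<subseteq> V" "independent U"
    and "\<And>I. I \<subseteq> X \<Longrightarrow> independent I \<Longrightarrow> card I \<le> a"
  shows "card U * card X \<le> a * card V"
proof (rule Aut_average[OF assms(1,2)])
  fix \<phi> assume \<phi>: "\<phi> \<in> Aut"
  have "independent {x \<in> X. \<phi> x \<in> U}"
    using assms(3) Aut_adj[OF \<phi>] unfolding independent_def by blast
  then show "card {x \<in> X. \<phi> x \<in> U} \<le> a" by (intro assms(4)) auto
qed

abbreviation walk :: "nat \<Rightarrow> 'a \<Rightarrow> 'a \<Rightarrow> bool" where "walk l \<equiv> adj G ^^ l"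

lemma walk_add: "walk l x y \<Longrightarrow> walk m y z \<Longrightarrow> walk (l + m) x z"
  by (auto simp: relpowp_add)

lemma walk_sym: "walk l x y \<Longrightarrow> walk l y x"
proof (induction l arbitrary: y)
  case (Suc l)
  then obtain z where "walk l x z" "z \<sim> y" by auto
  then have "walk l z x" "walk 1 y z" using Suc.IH adj_sym by auto
  then show ?case using walk_add[of 1 y z l x] by simp
qed simp

lemma walk_1: "x \<sim> y \<Longrightarrow> walk 1 x y" by (simp add: eq_OO)

end

text \<open>The independent set \<open>U\<close> has \<open>card V div 2 - 1\<close> vertices. This is so close to half of the
graph that, by averaging, an odd cycle of length \<open>h\<close> can only exist if \<open>card V \<le> 2 * h\<close>.
Hence a shortest odd cycle contains at least half of all vertices, and the graph can be read off
from the way in which the remaining vertices are attached to it.\<close>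

locale nonbipartite_barrier = vertex_transitive_graph +
  fixes U :: "'a set"
  assumes barrier: "barrier U"
    and nonbipartite: "\<And>A. \<exists>x y. x \<sim> y \<and> (x \<in> A \<longleftrightarrow> y \<in> A)"
begin

lemma U_sub: "U \<subseteq> V" and U_indep: "independent U" and card_V: "card V = 2 * card U + 2"
proof -
  show "U \<subseteq> V" "independent U" using barrier by (auto simp: barrier_def independent_def)
  then have "finite U" using fin finite_subset by blast
  then have "card (V - U) + card U = card V"
    using \<open>U \<subseteq> V\<close> card_Diff_subset card_mono[OF fin \<open>U \<subseteq> V\<close>] by fastforce
  then show "card V = 2 * card U + 2" using barrier by (simp add: barrier_def)
qed

lemma odd_closed_walk: "\<exists>l. odd l \<and> (\<exists>x. walk l x x)"
proof -
  obtain r where r: "r \<in> V" using V_nonempty by blast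
  define A where "A = {x. \<exists>l. even l \<and> walk l r x}"
  obtain x y where xy: "x \<sim> y" "x \<in> A \<longleftrightarrow> y \<in> A" using nonbipartite by blast
  have reach: "\<exists>l. walk l r z" if "z \<in> V" for z
  proof -
    have "(adj G)\<^sup>*\<^sup>* r z" using connected r that by (simp add: connected_graph_def)
    then show ?thesis using rtranclp_imp_relpowp by fast
  qed
  have "x \<in> A"
  proof (rule ccontr)
    assume x: "x \<notin> A"
    obtain l where l: "walk l r x" using reach adj_verts xy(1) by blast
    then have "odd l" using x by (auto simp: A_def)
    then have "walk (l + 1) r y" "even (l + 1)" using walk_add[OF l walk_1[OF xy(1)]] by auto
    then have "y \<in> A" unfolding A_def by blast
    then show False using xy(2) x by blast
  qed
  then obtain l m where "even l" "walk l r x" "even m" "walk m r y"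
    using xy(2) by (auto simp: A_def)
  then have "walk (l + 1 + m) r r" "odd (l + 1 + m)"
    using walk_add[OF walk_add[OF _ walk_1[OF xy(1)]] walk_sym] by auto
  then show ?thesis by blast
qed

text \<open>The odd girth.\<close>

definition h :: nat where "h = (LEAST l. odd l \<and> (\<exists>x. walk l x x))"

abbreviation hi :: int where "hi \<equiv> int h"

lemma odd_h: "odd h" and h_walk: "\<exists>x. walk h x x"
  using LeastI_ex[OF odd_closed_walk] unfolding h_def by auto

lemma h_le: "odd l \<Longrightarrow> walk l x x \<Longrightarrow> h \<le> l"
  unfolding h_def by (rule Least_le) blast

lemma h_ge_3: "h \<ge> 3"
proof -
  have "h \<noteq> 1" using h_walk adj_irrefl by auto
  then show ?thesis using odd_h by presburger
qed

text \<open>A shortest odd cycle, traversed periodically. Indexing it by the integers turns statements about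
positions on the cycle into divisibility by its length.\<close>

definition shortest :: "(int \<Rightarrow> 'a) \<Rightarrow> bool" where
  "shortest c \<longleftrightarrow> (\<forall>i. c i \<sim> c (i + 1) \<and> c (i + hi) = c i)"

lemma shortest_exists: "\<exists>c. shortest c"
proof -
  obtain x where "walk h x x" using h_walk by blast
  then obtain f where f: "f 0 = x" "f h = x" "\<And>i. i < h \<Longrightarrow> f i \<sim> f (Suc i)"
    by (auto simp: relpowp_fun_conv)
  define c where "c i = f (nat (i mod hi))" for i
  have h0: "hi > 0" using h_ge_3 by simp
  have "c i \<sim> c (i + 1)" for i
  proof -
    define j where "j = nat (i mod hi)"
    have ij: "i mod hi = int j" using h0 by (simp add: j_def)
    have j: "j < h" using h0 pos_mod_bound[of hi i] ij by simp
    have m: "(i + 1) mod hi = (int j + 1) mod hi" using ij by (metis mod_add_left_eq)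
    have "f (nat ((i + 1) mod hi)) = f (Suc j)"
    proof (cases "Suc j = h")
      case True
      then have "(i + 1) mod hi = 0" using m by (metis add.commute mod_self of_nat_Suc)
      then show ?thesis using True f by simp
    next
      case False
      then have "(i + 1) mod hi = int j + 1" using m j by simp
      then show ?thesis by (simp add: nat_add_distrib)
    qed
    then show ?thesis using f(3)[OF j] by (simp add: c_def j_def)
  qed
  moreover have "c (i + hi) = c i" for i by (simp add: c_def)
  ultimately show ?thesis unfolding shortest_def by blast
qed

context
  fixes c :: "int \<Rightarrow> 'a"
  assumes c: "shortest c"
begin

lemma cyc_step: "c i \<sim> c (i + 1)" "c i \<sim> c (i - 1)"
  using c adj_sym[of "c (i - 1)" "c i"] unfolding shortest_def by (auto, metis diff_add_cancel)

lemma cyc_period: "c (i + hi * t) = c i"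
proof (induction t rule: int_induct[of _ 0])
  case (step1 t)
  have "c (i + hi * (t + 1)) = c ((i + hi * t) + hi)" by (simp add: algebra_simps)
  then show ?case using c step1 by (simp only: shortest_def)
next
  case (step2 t)
  have "c (i + hi * t) = c ((i + hi * (t - 1)) + hi)" by (simp add: algebra_simps)
  then show ?case using c step2 by (simp only: shortest_def)
qed simp

lemma cyc_cong: "hi dvd j - i \<Longrightarrow> c i = c j"
proof -
  assume "hi dvd j - i"
  then obtain t where "j - i = hi * t" by (elim dvdE)
  then have "j = i + hi * t" by simp
  then show ?thesis using cyc_period by simp
qed

lemma cyc_walk: "walk s (c i) (c (i + int s))"
proof (induction s)
  case (Suc s)
  show ?case using walk_add[OF Suc walk_1[OF cyc_step(1)]] by (simp add: ac_simps)
qed simp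

text \<open>Shortest odd cycles are isometric. A walk of length \<open>l\<close> between two vertices of the cycle can be
closed up along either of the two arcs, of lengths \<open>s\<close> and \<open>h - s\<close>; one of these closed walks
is odd, hence not shorter than \<open>h\<close>.\<close>

lemma cyc_dist:
  assumes w: "walk l (c i) (c j)"
  obtains s where "s < h" "hi dvd j - i - int s" "even (l + s) \<and> s \<le> l \<or> odd (l + s) \<and> h \<le> l + s"
proof -
  define s where "s = nat ((j - i) mod hi)"
  have h0: "hi > 0" using h_ge_3 by simp
  have s: "int s = (j - i) mod hi" using h0 by (simp add: s_def)
  have "int s < hi" unfolding s by (rule pos_mod_bound[OF h0])
  then have sh: "s < h" by simp
  have d: "hi dvd j - i - int s" using s by (metis dvd_minus_mod)
  have "hi dvd j - (i + int s)" using d by (simp add: algebra_simps)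
  then have cj: "c (i + int s) = c j" by (rule cyc_cong)
  have "s \<le> l" if "even (l + s)"
  proof -
    have "walk (h - s) (c (i + int s)) (c (i + int s + int (h - s)))" by (rule cyc_walk)
    then have "walk (h - s) (c j) (c i)"
      using cyc_cong[of i "i + hi"] sh cj by (simp add: of_nat_diff)
    then have "walk (l + (h - s)) (c i) (c i)" using walk_add[OF w] by simp
    moreover have "odd (l + (h - s))" using that odd_h sh by auto
    ultimately show ?thesis using h_le[of "l + (h - s)"] sh by fastforce
  qed
  moreover have "h \<le> l + s" if "odd (l + s)"
    using h_le[OF that walk_add[OF w]] walk_sym[OF cyc_walk[of s i]] cj by metis
  ultimately show ?thesis using that[OF sh d] by blast
qed

lemma cyc_eq: "c i = c j \<longleftrightarrow> hi dvd j - i"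
proof
  assume "c i = c j"
  then have "walk 0 (c i) (c j)" by simp
  then obtain s where "s < h" "hi dvd j - i - int s" "even (0 + s) \<and> s \<le> 0 \<or> odd (0 + s) \<and> h \<le> 0 + s"
    by (rule cyc_dist)
  then show "hi dvd j - i" by auto
qed (rule cyc_cong)

lemma dvd_shift: "hi dvd j - i - int s \<Longrightarrow> s + t = h \<Longrightarrow> hi dvd j - i + int t"
proof -
  assume a: "hi dvd j - i - int s" "s + t = h"
  have "j - i + int t = (j - i - int s) + hi" using a(2) by auto
  then show ?thesis using a(1) by (metis dvd_add dvd_refl)
qed

lemma cyc_adj: "c i \<sim> c j \<longleftrightarrow> hi dvd j - i - 1 \<or> hi dvd j - i + 1"
proof
  assume "c i \<sim> c j"
  then obtain s where s: "s < h" "hi dvd j - i - int s" "even (1 + s) \<and> s \<le> 1 \<or> odd (1 + s) \<and> h \<le> 1 + s"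
    using cyc_dist[OF walk_1] by blast
  then consider "s = 1" | "s + 1 = h" by (cases "s = 0") auto
  then show "hi dvd j - i - 1 \<or> hi dvd j - i + 1"
    using s(2) dvd_shift[of j i s 1] by cases auto
next
  assume "hi dvd j - i - 1 \<or> hi dvd j - i + 1"
  then have "c (i + 1) = c j \<or> c (i - 1) = c j"
    unfolding cyc_eq by (simp add: algebra_simps)
  then show "c i \<sim> c j" using cyc_step by metis
qed

lemma cyc_common_nbr:
  assumes "c i \<sim> v" "c j \<sim> v"
  shows "hi dvd j - i \<or> hi dvd j - i - 2 \<or> hi dvd j - i + 2"
proof -
  have "walk (1 + 1) (c i) (c j)" using assms walk_add walk_1 adj_sym by blast
  then obtain s where s: "s < h" "hi dvd j - i - int s"
      "even (1 + 1 + s) \<and> s \<le> 1 + 1 \<or> odd (1 + 1 + s) \<and> h \<le> 1 + 1 + s"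
    by (rule cyc_dist)
  from s(1,3) have "s = 0 \<or> s = 2 \<or> s + 2 = h" using odd_h by presburger
  then consider "s = 0" | "s = 2" | "s + 2 = h" by blast
  then show ?thesis using s(2) dvd_shift[of j i s 2] by cases auto
qed

lemma cyc_walk_3:
  assumes "c i \<sim> v" "v \<sim> w" "w \<sim> c j"
  shows "hi dvd j - i - 1 \<or> hi dvd j - i + 1 \<or> hi dvd j - i - 3 \<or> hi dvd j - i + 3"
proof -
  have "walk (1 + 1 + 1) (c i) (c j)" using assms walk_add walk_1 by blast
  then obtain s where s: "s < h" "hi dvd j - i - int s"
      "even (1 + 1 + 1 + s) \<and> s \<le> 1 + 1 + 1 \<or> odd (1 + 1 + 1 + s) \<and> h \<le> 1 + 1 + 1 + s"
    by (rule cyc_dist)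
  from s(1,3) have "s = 1 \<or> s = 3 \<or> s + 1 = h \<or> s + 3 = h" using odd_h by presburger
  then consider "s = 1" | "s = 3" | "s + 1 = h" | "s + 3 = h" by blast
  then show ?thesis using s(2) dvd_shift[of j i s 1] dvd_shift[of j i s 3] by cases auto
qed

lemma small_not_dvd: "t \<noteq> 0 \<Longrightarrow> \<bar>t\<bar> < hi \<Longrightarrow> \<not> hi dvd t"
  using dvd_imp_le_int[of t hi] by auto

lemma cyc_V: "c i \<in> V" using cyc_step(1) adj_verts by blast

lemma range_cyc: "range c = c ` {0..<hi}" and card_range_cyc: "card (range c) = h"
    and inj_cyc: "inj_on c {0..<hi}"
  using card_range_periodic[of h c] cyc_eq h_ge_3 by auto

lemma range_cyc_V: "range c \<subseteq> V" using cyc_V by blast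

lemma finite_range_cyc: "finite (range c)" using range_cyc_V fin by (rule finite_subset)

text \<open>The set and its shift by one position along the cycle are disjoint, so twice its size is at most the
odd number \<open>h\<close>.\<close>

lemma independent_cyc:
  assumes I: "I \<subseteq> range c" "independent I"
  shows "card I \<le> (h - 1) div 2"
proof -
  define J where "J = {i \<in> {0..<hi}. c i \<in> I}"
  have IJ: "I = c ` J" using I(1) unfolding range_cyc J_def by auto
  have injJ: "inj_on c J" using inj_cyc by (rule inj_on_subset) (auto simp: J_def)
  have injJ': "inj_on (\<lambda>i. c (i + 1)) J"
  proof (rule inj_onI)
    fix i j assume "i \<in> J" "j \<in> J" "c (i + 1) = c (j + 1)"
    then show "i = j" using injJ by (auto simp: cyc_eq inj_on_def)
  qed
  have disj: "c ` J \<inter> (\<lambda>i. c (i + 1)) ` J = {}"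
    using I(2) cyc_step(1) unfolding IJ independent_def by (fastforce simp: J_def)
  have finJ: "finite J" by (rule finite_subset[of _ "{0..<hi}"]) (auto simp: J_def)
  have "card (c ` J \<union> (\<lambda>i. c (i + 1)) ` J) = 2 * card J"
    using finJ injJ injJ' disj by (simp add: card_Un_disjoint card_image)
  moreover have "card (c ` J \<union> (\<lambda>i. c (i + 1)) ` J) \<le> card (range c)"
    by (rule card_mono[OF finite_range_cyc]) auto
  ultimately have "2 * card I \<le> h" using card_range_cyc injJ IJ by (simp add: card_image)
  then show ?thesis using odd_h by presburger
qed

text \<open>Averaging over the cycle bounds \<open>card U / card V\<close> by \<open>(h - 1) / (2 * h)\<close>, whereas
\<open>2 * card U = card V - 2\<close>.\<close>

lemma order_le: "card V \<le> 2 * h"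
proof -
  have "card U * h \<le> (h - 1) div 2 * card V"
    using independent_average[OF range_cyc_V U_sub U_indep independent_cyc] card_range_cyc by simp
  then have "2 * card U * h \<le> (h - 1) * card V"
    using odd_h by (elim oddE) simp
  then have "(card V - 2) * h \<le> (h - 1) * card V" using card_V by simp
  moreover obtain m where m: "card V = m + 2" using card_V by blast
  moreover obtain g where g: "h = g + 1" using odd_h by (elim oddE) simp
  ultimately have "m * (g + 1) \<le> g * (m + 2)" by simp
  then show ?thesis unfolding m g by (simp add: algebra_simps)
qed

lemma nbrs_cyc: "nbrs (c i) \<inter> range c = {c (i - 1), c (i + 1)}" "c (i - 1) \<noteq> c (i + 1)"
proof -
  show "nbrs (c i) \<inter> range c = {c (i - 1), c (i + 1)}"
  proof
    show "nbrs (c i) \<inter> range c \<subseteq> {c (i - 1), c (i + 1)}"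
    proof
      fix x assume "x \<in> nbrs (c i) \<inter> range c"
      then obtain j where "x = c j" "c i \<sim> c j" by (auto simp: nbrs_def)
      then show "x \<in> {c (i - 1), c (i + 1)}"
        unfolding cyc_adj by (auto simp: cyc_eq algebra_simps intro: dvd_diff_commute[THEN iffD1])
    qed
  qed (use cyc_step in \<open>auto simp: nbrs_def\<close>)
  show "c (i - 1) \<noteq> c (i + 1)" using small_not_dvd[of 2] h_ge_3 by (simp add: cyc_eq)
qed

lemma cyc_cut: "cut_size (range c) = h * (k - 2)"
proof -
  have "card (nbrs x - range c) = k - 2" if x: "x \<in> range c" for x
  proof -
    obtain i where i: "x = c i" using x by blast
    have "card (nbrs x - range c) = card (nbrs x) - card (nbrs x \<inter> range c)"
      using fin_nbrs by (simp add: card_Diff_subset_Int)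
    then show ?thesis using card_nbrs[OF cyc_V] nbrs_cyc i by simp
  qed
  then show ?thesis using cut_size_sum[OF range_cyc_V] card_range_cyc by simp
qed

text \<open>The edges that leave the cycle, counted at their outer ends.\<close>

lemma outside_sum: "(\<Sum>v\<in>V - range c. card (nbrs v \<inter> range c)) = h * (k - 2)"
proof -
  have "nbrs v - (V - range c) = nbrs v \<inter> range c" for v using nbrs_sub range_cyc_V by blast
  then show ?thesis
    using cut_size_sum[of "V - range c"] cut_size_compl[OF range_cyc_V] cyc_cut by simp
qed

lemma card_outside: "card (V - range c) = card V - h"
  using card_Diff_subset[OF finite_range_cyc range_cyc_V] card_range_cyc by simp

text \<open>Otherwise nothing leaves the cycle, which then contains all vertices; but their number is even.\<close>

lemma degree_ge_3: "k \<ge> 3"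
proof (rule ccontr)
  assume "\<not> k \<ge> 3"
  then have "cut_size (range c) = 0" using cyc_cut by simp
  then have "range c = V" using cut_size_pos[OF range_cyc_V] by auto
  then have "h = 2 * card U + 2" using card_range_cyc card_V by simp
  then show False using odd_h by presburger
qed

end

text \<open>An independent set has at most one vertex in a clique, so averaging gives \<open>4 * card U \<le> card V\<close>.\<close>

lemma clique_4_order:
  assumes "clique G Q" "card Q = 4"
  shows "card V = 4"
proof -
  have QV: "Q \<subseteq> V" using assms by (simp add: clique_def)
  have "card I \<le> 1" if "I \<subseteq> Q" "independent I" for I
  proof (rule ccontr)
    assume "\<not> card I \<le> 1"
    then obtain x y where "x \<in> I" "y \<in> I" "x \<noteq> y"
      by (metis One_nat_def card_le_Suc0_iff_eq card.infinite zero_le)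
    then show False using that assms(1) unfolding clique_def pairwise_def independent_def by blast
  qed
  then have "card U * card Q \<le> 1 * card V" by (rule independent_average[OF QV U_sub U_indep])
  moreover have "4 \<le> card V" using card_mono[OF fin QV] assms by simp
  ultimately show ?thesis using card_V assms(2) by simp
qed

end

locale nonbipartite_barrier_no_K4 = nonbipartite_barrier +
  assumes no_K4: "\<not> (\<exists>Q. clique G Q \<and> card Q = 4)"
begin

lemma cyc_two_nbrs:
  assumes c: "shortest c" and "v \<sim> c i" "v \<sim> c j" "c i \<noteq> c j"
  shows "c j = c (i + 2) \<or> c j = c (i - 2)"
proof -
  have "hi dvd j - i - 2 \<or> hi dvd j - i + 2"
    using cyc_common_nbr[OF c, of i v j] assms adj_sym cyc_eq[OF c] by blast
  then show ?thesis using cyc_eq[OF c, of "i + 2" j] cyc_eq[OF c, of "i - 2" j]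
    by (metis (no_types, lifting) add.commute diff_add_eq diff_diff_eq diff_diff_eq2)
qed

text \<open>Three neighbours on the cycle would be pairwise two steps apart. This is possible only around a
triangle, which together with the common neighbour is a clique of size four.\<close>

lemma cyc_nbrs_le_2:
  assumes c: "shortest c"
  shows "card (nbrs v \<inter> range c) \<le> 2"
proof (rule ccontr)
  assume "\<not> ?thesis"
  then have "3 \<le> card (nbrs v \<inter> range c)" by simp
  then obtain T where T: "T \<subseteq> nbrs v \<inter> range c" "card T = 3"
    using obtain_subset_with_card_n by metis
  then obtain x y z where xyz: "T = {x, y, z}" "x \<noteq> y" "x \<noteq> z" "y \<noteq> z"
    by (auto simp: card_3_iff)
  have "x \<in> range c" "y \<in> range c" "z \<in> range c" using T(1) xyz(1) by auto
  then obtain i j l where e: "x = c i" "y = c j" "z = c l" by (elim rangeE)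
  have a: "v \<sim> c i" "v \<sim> c j" "v \<sim> c l" using T(1) xyz e by (auto simp: nbrs_def)
  have "c j = c (i + 2) \<or> c j = c (i - 2)" "c l = c (i + 2) \<or> c l = c (i - 2)"
    using cyc_two_nbrs[OF c] a xyz e by metis+
  then have "{c j, c l} = {c (i + 2), c (i - 2)}" using xyz e by auto
  then have "v \<sim> c (i - 2)" "v \<sim> c (i + 2)" "c (i - 2) \<noteq> c (i + 2)"
    using a xyz(4) e by (auto simp: doubleton_eq_iff)
  then have "hi dvd 4 \<or> hi dvd 2 \<or> hi dvd 6"
    using cyc_common_nbr[OF c, of "i - 2" v "i + 2"] adj_sym by auto
  then have "hi \<le> 6" using zdvd_imp_le by fastforce
  then have "h = 3 \<or> h = 5" using h_ge_3 odd_h by presburger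
  then have h3: "h = 3" using \<open>hi dvd 4 \<or> hi dvd 2 \<or> hi dvd 6\<close> by auto
  have eqs: "c (i + 2) = c (i - 1)" "c (i - 2) = c (i + 1)" using h3 by (auto simp: cyc_eq[OF c])
  have ad: "v \<sim> c i" "v \<sim> c (i + 1)" "v \<sim> c (i - 1)" "c i \<sim> c (i + 1)" "c i \<sim> c (i - 1)"
      "c (i - 1) \<sim> c (i + 1)"
    using a \<open>v \<sim> c (i - 2)\<close> \<open>v \<sim> c (i + 2)\<close> eqs h3 by (auto simp: cyc_adj[OF c])
  have "clique G {v, c i, c (i + 1), c (i - 1)}"
    using ad adj_sym adj_verts unfolding clique_def pairwise_def by auto
  moreover have "card {v, c i, c (i + 1), c (i - 1)} = 4"
  proof -
    have "v \<noteq> c i" "v \<noteq> c (i + 1)" "v \<noteq> c (i - 1)" "c i \<noteq> c (i + 1)" "c i \<noteq> c (i - 1)"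
      "c (i + 1) \<noteq> c (i - 1)" using ad adj_irrefl by metis+
    then show ?thesis by simp
  qed
  ultimately show False using no_K4 by blast
qed

text \<open>Each of the \<open>h\<close> cycle vertices sends \<open>k - 2\<close> edges to the at most \<open>h\<close> other vertices, and
each of these receives at most two.\<close>

lemma degree_le_4: "k \<le> 4"
proof -
  obtain c where c: "shortest c" using shortest_exists by blast
  have "h * (k - 2) \<le> (\<Sum>v\<in>V - range c. 2)"
    unfolding outside_sum[OF c, symmetric] by (intro sum_mono cyc_nbrs_le_2[OF c])
  also have "\<dots> \<le> h * 2" using order_le[OF c] card_outside[OF c] by simp
  finally show ?thesis using h_ge_3 by simp
qed

end

context vertex_transitive_graph
begin

lemma isomorphic_cayleyI:
  fixes f :: "int \<Rightarrow> 'a"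
  assumes onto: "V \<subseteq> f ` {0..<int m}" and card: "card V = m"
    and sym: "\<And>a. a \<in> A \<Longrightarrow> \<exists>b\<in>A. int m dvd - a - b"
    and adj: "\<And>x y. x \<in> {0..<int m} \<Longrightarrow> y \<in> {0..<int m} \<Longrightarrow>
      f x \<sim> f y \<longleftrightarrow> (\<exists>a\<in>A. int m dvd x - y - a)"
  shows "isomorphic G (cayley_Z m A)"
proof -
  let ?I = "{0..<int m}"
  have "card (f ` ?I) \<le> m" using card_image_le[of ?I f] by simp
  then have V: "V = f ` ?I" using onto card card_seteq[of "f ` ?I" V] by auto
  have inj: "inj_on f ?I" using V card by (intro eq_card_imp_inj_on) auto
  define g where "g = inv_into ?I f"
  have bij: "bij_betw g V ?I" unfolding g_def V by (rule bij_betw_inv_into) (use inj in \<open>auto simp: bij_betw_def\<close>)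
  have fg: "f (g x) = x" if "x \<in> V" for x using that V f_inv_into_f[of x f ?I] by (simp add: g_def)
  have "x \<sim> y \<longleftrightarrow> adj (cayley_Z m A) (g x) (g y)" if xy: "x \<in> V" "y \<in> V" for x y
  proof -
    have gI: "g x \<in> ?I" "g y \<in> ?I" using bij xy by (auto simp: bij_betw_def)
    have "adj (cayley_Z m A) (g x) (g y) \<longleftrightarrow> (\<exists>a\<in>A. [g x - g y = a] (mod int m))"
      using sym gI by (intro cayley_Z_adj) (auto simp: cong_iff_dvd_diff cayley_Z_def)
    then show ?thesis using adj[OF gI] fg xy by (simp add: cong_iff_dvd_diff)
  qed
  then have "graph_isomorphism G (cayley_Z m A) g"
    using bij by (simp add: graph_isomorphism_def cayley_Z_def)
  then show ?thesis unfolding isomorphic_def by blast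
qed

end

context nonbipartite_barrier
begin

text \<open>A vertex adjacent to \<open>c (i - 1)\<close> and \<open>c (i + 1)\<close> can replace \<open>c i\<close>. Applying what is known
about shortest odd cycles to the new cycle gives information about the edges at \<open>v\<close>.\<close>

lemma swap_shortest:
  assumes c: "shortest c" and v: "v \<sim> c (i - 1)" "v \<sim> c (i + 1)"
  shows "shortest (\<lambda>j. if hi dvd j - i then v else c j)" (is "shortest ?c")
  unfolding shortest_def
proof (intro allI conjI)
  fix j
  have n1: "\<not> hi dvd 1" using h_ge_3 by simp
  consider "hi dvd j - i" | "hi dvd j + 1 - i" | "\<not> hi dvd j - i" "\<not> hi dvd j + 1 - i" by blast
  then show "?c j \<sim> ?c (j + 1)"
  proof cases
    case 1
    then have "\<not> hi dvd j + 1 - i" using n1 dvd_diff[of hi "j + 1 - i" "j - i"] by auto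
    moreover have "c (j + 1) = c (i + 1)" using 1 by (simp add: cyc_eq[OF c] dvd_diff_commute)
    ultimately show ?thesis using 1 v by simp
  next
    case 2
    then have "\<not> hi dvd j - i" using n1 dvd_diff[of hi "j + 1 - i" "j - i"] by auto
    moreover have "hi dvd j - (i - 1)" using 2 by (simp add: algebra_simps)
    then have "c (i - 1) = c j" by (simp add: cyc_eq[OF c])
    ultimately show ?thesis using 2 v adj_sym by simp
  next
    case 3
    then show ?thesis using c by (simp add: shortest_def)
  qed
  have "hi dvd j + hi - i \<longleftrightarrow> hi dvd j - i"
    by (metis add_diff_eq add.commute dvd_add_triv_left_iff)
  then show "?c (j + hi) = ?c j" using c by (simp add: shortest_def)
qed

end

section \<open>The tetravalent case\<close>

context nonbipartite_barrier_no_K4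
begin

lemma three_nbrs_absurd:
  assumes c: "shortest c" and "v \<sim> c i" "v \<sim> c j" "v \<sim> c l" "c i \<noteq> c j" "c i \<noteq> c l" "c j \<noteq> c l"
  shows False
proof -
  have "card {c i, c j, c l} \<le> card (nbrs v \<inter> range c)"
    using assms fin_nbrs by (intro card_mono) (auto simp: nbrs_def)
  then show False using cyc_nbrs_le_2[OF c, of v] assms by simp
qed

lemma two_nbrs_between:
  assumes c: "shortest c" and two: "card (nbrs v \<inter> range c) = 2"
  obtains i where "nbrs v \<inter> range c = {c (i - 1), c (i + 1)}"
proof -
  obtain x y where xy: "nbrs v \<inter> range c = {x, y}" "x \<noteq> y" using two by (auto simp: card_2_iff)
  then have "x \<in> nbrs v \<inter> range c" "y \<in> nbrs v \<inter> range c" by auto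
  then obtain l j where lj: "x = c l" "y = c j" "v \<sim> c l" "v \<sim> c j" by (auto simp: nbrs_def)
  then consider "c j = c (l + 2)" | "c j = c (l - 2)" using cyc_two_nbrs[OF c] xy(2) by blast
  then show thesis
  proof cases
    case 1
    then show thesis using that[of "l + 1"] xy(1) lj by (simp add: algebra_simps)
  next
    case 2
    then show thesis using that[of "l - 1"] xy(1) lj by (simp add: insert_commute)
  qed
qed

text \<open>For \<open>k = 4\<close> the count of edges that leave the cycle is tight.\<close>

lemma order_4:
  assumes c: "shortest c" and k4: "k = 4"
  shows "card V = 2 * h" and "v \<in> V - range c \<Longrightarrow> card (nbrs v \<inter> range c) = 2"
proof -
  let ?R = "V - range c"
  have finR: "finite ?R" using fin by simp
  have le: "(\<Sum>v\<in>?R. card (nbrs v \<inter> range c)) \<le> (\<Sum>v\<in>?R. 2)"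
    by (intro sum_mono cyc_nbrs_le_2[OF c])
  have s: "(\<Sum>v\<in>?R. card (nbrs v \<inter> range c)) = h * 2" using outside_sum[OF c] k4 by simp
  have cR: "card ?R \<le> h" using order_le[OF c] card_outside[OF c] by simp
  then have "card ?R = h" using le s by simp
  then show "card V = 2 * h" using card_outside[OF c] h_ge_3 by linarith
  show "card (nbrs v \<inter> range c) = 2" if "v \<in> ?R"
  proof (rule ccontr)
    assume "card (nbrs v \<inter> range c) \<noteq> 2"
    then have "card (nbrs v \<inter> range c) < 2" using cyc_nbrs_le_2[OF c, of v] by simp
    then have "(\<Sum>v\<in>?R. card (nbrs v \<inter> range c)) < (\<Sum>v\<in>?R. 2)"
      using that finR cyc_nbrs_le_2[OF c] by (intro sum_strict_mono_ex1) auto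
    then show False using s \<open>card ?R = h\<close> by simp
  qed
qed

text \<open>Every vertex off the cycle is adjacent to \<open>c (j - 1)\<close> and \<open>c (j + 1)\<close> for one \<open>j\<close>. If
\<open>X j\<close> collects the vertices of this kind, then \<open>card (X (j - 1)) + card (X (j + 1)) = 2\<close>, as
\<open>c j\<close> has two outer neighbours. Going around the cycle in steps of two, an odd number of times,
turns \<open>card (X j)\<close> into \<open>2 - card (X j)\<close>, so \<open>X j\<close> is a single vertex \<open>v j\<close>. Replacing
\<open>c i\<close> by \<open>v i\<close> on the cycle shows that \<open>v i\<close> is adjacent to \<open>v j\<close> only for
\<open>j = i \<plusminus> 1\<close>. So the graph is the odd cycle with every vertex doubled, which by the
Chinese remainder theorem is the stated Cayley graph: the residue modulo \<open>h\<close> is the position on the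
cycle, and parity distinguishes the two copies.\<close>

lemma tetravalent:
  assumes k4: "k = 4"
  shows "\<exists>n::nat\<ge>1. isomorphic G (cayley_Z (4 * n + 2) {1, 4 * int n + 1, 2 * int n, 2 * int n + 2})"
proof -
  obtain c where c: "shortest c" using shortest_exists by blast
  let ?R = "V - range c"
  note cV = order_4(1)[OF c k4] and two = order_4(2)[OF c k4]
  note eq = cyc_eq[OF c]
  have n4: "\<not> hi dvd 4" "\<not> hi dvd 2"
  proof -
    have "hi = 3 \<or> hi > 4" using h_ge_3 odd_h by presburger
    then show "\<not> hi dvd 4" "\<not> hi dvd 2" using small_not_dvd[OF c, of 4] small_not_dvd[OF c, of 2] by auto
  qed
  define X where "X j = {v \<in> ?R. v \<sim> c (j - 1) \<and> v \<sim> c (j + 1)}" for j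
  have finX: "finite (X j)" for j using fin by (simp add: X_def)
  have Xcong: "X i = X j" if "hi dvd j - i" for i j
  proof -
    have "c (i - 1) = c (j - 1)" "c (i + 1) = c (j + 1)" using that by (auto simp: eq)
    then show ?thesis by (simp add: X_def)
  qed
  have nb: "nbrs v \<inter> range c = {c (j - 1), c (j + 1)}" if v: "v \<in> X j" for v j
  proof (rule card_subset_eq[symmetric])
    show "finite (nbrs v \<inter> range c)" using fin_nbrs by simp
    show "{c (j - 1), c (j + 1)} \<subseteq> nbrs v \<inter> range c" using v by (auto simp: X_def nbrs_def)
    show "card {c (j - 1), c (j + 1)} = card (nbrs v \<inter> range c)"
      using two[of v] v nbrs_cyc(2)[OF c, of j] by (simp add: X_def)
  qed
  have Xex: "\<exists>j. v \<in> X j" if v: "v \<in> ?R" for v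
  proof -
    obtain i where "nbrs v \<inter> range c = {c (i - 1), c (i + 1)}"
      using two_nbrs_between[OF c two[OF v]] by blast
    then have "v \<in> X i" using v by (auto simp: X_def nbrs_def)
    then show ?thesis by blast
  qed
  have Xout: "nbrs (c j) - range c = X (j - 1) \<union> X (j + 1)" for j
  proof
    show "nbrs (c j) - range c \<subseteq> X (j - 1) \<union> X (j + 1)"
    proof
      fix v assume v: "v \<in> nbrs (c j) - range c"
      then have vR: "v \<in> ?R" and vj: "v \<sim> c j" using nbrs_sub adj_sym by (auto simp: nbrs_def)
      obtain i where i: "v \<in> X i" using Xex[OF vR] by blast
      then have "c j = c (i - 1) \<or> c j = c (i + 1)" using nb[OF i] vj by (auto simp: nbrs_def)
      then have "X i = X (j + 1) \<or> X i = X (j - 1)"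
      proof
        assume "c j = c (i - 1)"
        then have "hi dvd (i - 1) - j" by (simp add: eq)
        then have "hi dvd i - (j + 1)" by (simp add: algebra_simps)
        then show ?thesis using Xcong by metis
      next
        assume "c j = c (i + 1)"
        then have "hi dvd (i + 1) - j" by (simp add: eq)
        then have "hi dvd i - (j - 1)" by (simp add: algebra_simps)
        then show ?thesis using Xcong by metis
      qed
      then show "v \<in> X (j - 1) \<union> X (j + 1)" using i by blast
    qed
    show "X (j - 1) \<union> X (j + 1) \<subseteq> nbrs (c j) - range c"
      using adj_sym by (auto simp: X_def nbrs_def)
  qed
  have Xdisj: "X (j - 1) \<inter> X (j + 1) = {}" for j
  proof (rule ccontr)
    assume "X (j - 1) \<inter> X (j + 1) \<noteq> {}"
    then obtain v where "v \<sim> c (j - 2)" "v \<sim> c j" "v \<sim> c (j + 2)" by (auto simp: X_def algebra_simps)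
    moreover have "c (j - 2) \<noteq> c j" "c (j - 2) \<noteq> c (j + 2)" "c j \<noteq> c (j + 2)" using n4 by (auto simp: eq)
    ultimately show False using three_nbrs_absurd[OF c] by blast
  qed
  have x_step: "card (X (j - 1)) + card (X (j + 1)) = 2" for j
  proof -
    have "card (nbrs (c j) - range c) = k - 2"
      using card_Diff_subset_Int[of "nbrs (c j)" "range c"] fin_nbrs nbrs_cyc[OF c] card_nbrs[OF cyc_V[OF c]]
      by auto
    then show ?thesis using Xout Xdisj finX k4 by (simp add: card_Un_disjoint)
  qed
  \<comment> \<open>used below for \<open>m = h\<close>, after which the position is \<open>j\<close> again\<close>
  have x_even: "card (X (j + 2 * int m)) = (if even m then card (X j) else 2 - card (X j))" for j m
  proof (induction m)
    case (Suc m)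
    have "card (X (j + 2 * int m)) + card (X (j + 2 * int (Suc m))) = 2"
      using x_step[of "j + 2 * int m + 1"] by (simp add: algebra_simps)
    moreover have "card (X j) \<le> 2" using x_step[of "j + 1"] by simp
    ultimately show ?case using Suc by auto
  qed simp
  have "card (X j) = 1" for j
  proof -
    have "X (j + 2 * hi) = X j" by (rule Xcong) simp
    then have "card (X j) = 2 - card (X j)" using x_even[of j h] odd_h by simp
    then show ?thesis by linarith
  qed
  then have "\<forall>j. \<exists>v. X j = {v}" by (auto simp: card_1_singleton_iff)
  then obtain v where v: "X j = {v j}" for j by metis
  have vR: "v j \<in> ?R" "v j \<sim> c (j - 1)" "v j \<sim> c (j + 1)" for j using v[of j] by (auto simp: X_def)
  have vcong: "v i = v j" if "hi dvd j - i" for i j using Xcong[OF that] v by auto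
  have Rv: "?R = range v" using Xex v vR by fastforce
  have cv: "c i \<sim> v j \<longleftrightarrow> hi dvd i - j - 1 \<or> hi dvd i - j + 1" for i j
  proof -
    have "c i \<sim> v j \<longleftrightarrow> c i \<in> nbrs (v j) \<inter> range c" using adj_commute by (auto simp: nbrs_def)
    also have "\<dots> \<longleftrightarrow> c (j - 1) = c i \<or> c (j + 1) = c i" using nb[of "v j" j] v by auto
    also have "\<dots> \<longleftrightarrow> hi dvd i - j - 1 \<or> hi dvd i - j + 1" unfolding eq by (auto simp: algebra_simps)
    finally show ?thesis .
  qed
  have vv1: "hi dvd j - i - 1 \<or> hi dvd j - i + 1" if a: "v i \<sim> v j" for i j
  proof (rule ccontr)
    assume no: "\<not> ?thesis"
    let ?c = "\<lambda>l. if hi dvd l - i then v i else c l"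
    have sc: "shortest ?c" by (rule swap_shortest[OF c vR(2,3)])
    have 1: "\<not> hi dvd (j - 1) - i" "\<not> hi dvd (j + 1) - i" using no by (auto simp: algebra_simps)
    have e: "?c i = v i" "?c (j - 1) = c (j - 1)" "?c (j + 1) = c (j + 1)" using 1 by auto
    have "v j \<sim> ?c i" "v j \<sim> ?c (j - 1)" "v j \<sim> ?c (j + 1)" unfolding e using a vR adj_sym by auto
    moreover have "?c i \<noteq> ?c (j - 1)" "?c i \<noteq> ?c (j + 1)" "?c (j - 1) \<noteq> ?c (j + 1)"
      unfolding e using vR(1)[of i] nbrs_cyc(2)[OF c] by auto
    ultimately show False by (rule three_nbrs_absurd[OF sc])
  qed
  have vv: "v i \<sim> v j \<longleftrightarrow> hi dvd j - i - 1 \<or> hi dvd j - i + 1" for i j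
  proof
    assume d: "hi dvd j - i - 1 \<or> hi dvd j - i + 1"
    have "nbrs (v i) - range c \<subseteq> {v (i + 1), v (i - 1)}"
    proof
      fix x assume x: "x \<in> nbrs (v i) - range c"
      then have "x \<in> ?R" using nbrs_sub by blast
      then obtain l where l: "x = v l" using Rv by blast
      then have "hi dvd l - (i + 1) \<or> hi dvd l - (i - 1)" using vv1[of i l] x by (auto simp: nbrs_def algebra_simps)
      then show "x \<in> {v (i + 1), v (i - 1)}" using vcong l by (metis insert_iff)
    qed
    moreover have "card (nbrs (v i) - range c) = 2"
      using card_Diff_subset_Int[of "nbrs (v i)" "range c"] fin_nbrs two[OF vR(1)] card_nbrs[of "v i"]
        vR(1)[of i] k4 by simp
    moreover have "card {v (i + 1), v (i - 1)} \<le> 2" by (cases "v (i + 1) = v (i - 1)") auto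
    ultimately have "nbrs (v i) - range c = {v (i + 1), v (i - 1)}"
      by (intro card_seteq) auto
    then have "v i \<sim> v (i + 1)" "v i \<sim> v (i - 1)" by (auto simp: nbrs_def)
    moreover have "v (i + 1) = v j \<or> v (i - 1) = v j"
      using d vcong[of j "i + 1"] vcong[of j "i - 1"] by (auto simp: algebra_simps)
    ultimately show "v i \<sim> v j" by metis
  qed (rule vv1)
  define f where "f x = (if even x then c x else v x)" for x :: int
  have fadj: "f x \<sim> f y \<longleftrightarrow> hi dvd x - y - 1 \<or> hi dvd x - y + 1" for x y
  proof -
    have sw: "hi dvd y - x - 1 \<longleftrightarrow> hi dvd x - y + 1" "hi dvd y - x + 1 \<longleftrightarrow> hi dvd x - y - 1"
      by (metis diff_diff_eq2 diff_diff_eq dvd_diff_commute diff_add_eq add.commute)+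
    show ?thesis
      using cyc_adj[OF c, of x y] cv[of x y] cv[of y x] vv[of x y] adj_commute[of "v x" "c y"] sw
      by (auto simp: f_def)
  qed
  obtain n where n: "h = 2 * n + 1" using odd_h by (rule oddE)
  have "isomorphic G (cayley_Z (4 * n + 2) {1, 4 * int n + 1, 2 * int n, 2 * int n + 2})"
  proof (rule isomorphic_cayleyI)
    show "card V = 4 * n + 2" using cV n by simp
    show "V \<subseteq> f ` {0..<int (4 * n + 2)}"
    proof
      fix x assume "x \<in> V"
      have m: "int (4 * n + 2) = 2 * hi" using n by simp
      consider i where "x = c i" | i where "x = v i" using Rv \<open>x \<in> V\<close> by blast
      then show "x \<in> f ` {0..<int (4 * n + 2)}"
      proof cases
        case (1 i)
        obtain j where j: "0 \<le> j" "j < 2 * hi" "hi dvd j - i" "even j \<longleftrightarrow> True"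
          by (rule odd_lift[OF odd_h])
        then have "x = f j" using 1 by (simp add: f_def eq)
        then show ?thesis using j m by auto
      next
        case (2 i)
        obtain j where j: "0 \<le> j" "j < 2 * hi" "hi dvd j - i" "even j \<longleftrightarrow> False"
          by (rule odd_lift[OF odd_h])
        then have "x = f j" using 2 vcong by (simp add: f_def)
        then show ?thesis using j m by auto
      qed
    qed
    show "\<exists>b\<in>{1, 4 * int n + 1, 2 * int n, 2 * int n + 2}. int (4 * n + 2) dvd - a - b"
      if "a \<in> {1, 4 * int n + 1, 2 * int n, 2 * int n + 2}" for a
    proof -
      let ?b = "if a = 4 * int n + 1 then 1 else 4 * int n + 2 - a"
      have "?b \<in> {1, 4 * int n + 1, 2 * int n, 2 * int n + 2}" using that by auto
      moreover have "- a - ?b = - int (4 * n + 2)" using that by auto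
      then have "int (4 * n + 2) dvd - a - ?b" by (metis dvd_minus_iff dvd_refl)
      ultimately show ?thesis by blast
    qed
    fix x y :: int
    have m: "int (4 * n + 2) = 2 * hi" using n by simp
    have s: "2 * hi dvd x - y + 1 \<longleftrightarrow> 2 * hi dvd x - y - (4 * int n + 1)"
    proof -
      have "x - y + 1 = (x - y - (4 * int n + 1)) + 2 * hi" using n by simp
      then show ?thesis by (metis dvd_add_triv_right_iff)
    qed
    have "hi dvd x - y - 1 \<longleftrightarrow> 2 * hi dvd x - y - 1 \<or> 2 * hi dvd x - y - (2 * int n + 2)"
      using dvd_half_iff[of hi "x - y - 1"] n by (simp add: algebra_simps)
    moreover have "hi dvd x - y + 1 \<longleftrightarrow> 2 * hi dvd x - y + 1 \<or> 2 * hi dvd x - y - 2 * int n"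
      using dvd_half_iff[of hi "x - y + 1"] n by (simp add: algebra_simps)
    ultimately show "f x \<sim> f y \<longleftrightarrow>
        (\<exists>a\<in>{1, 4 * int n + 1, 2 * int n, 2 * int n + 2}. int (4 * n + 2) dvd x - y - a)"
      unfolding fadj m using s by auto
  qed
  moreover have "n \<ge> 1" using n h_ge_3 by simp
  ultimately show ?thesis by blast
qed

end

section \<open>Two-regular relations\<close>

text \<open>A walk that never turns back is determined by its first two vertices.\<close>

lemma two_regular_unique:
  fixes a b :: "int \<Rightarrow> 'a"
  assumes a: "\<And>i. {y. R (a i) y} = {a (i - 1), a (i + 1)}"
    and b: "\<And>i. {y. R (b i) y} = {b (i - 1), b (i + 1)}"
    and start: "a 0 = b 0" "a 1 = b 1"
  shows "a i = b i"
proof -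
  have "a i = b i \<and> a (i + 1) = b (i + 1)"
  proof (induction i rule: int_induct[of _ 0])
    case (step1 i)
    then have "{a i, a (i + 2)} = {b i, b (i + 2)}" using a[of "i + 1"] b[of "i + 1"] by (simp add: ac_simps)
    then show ?case using step1 by (auto simp: doubleton_eq_iff ac_simps)
  next
    case (step2 i)
    then have "{a (i - 1), a (i + 1)} = {b (i - 1), b (i + 1)}" using a[of i] b[of i] by simp
    then show ?case using step2 by (auto simp: doubleton_eq_iff)
  qed (use start in simp)
  then show ?thesis by simp
qed

text \<open>The component of \<open>x0\<close> is a cycle, parametrised periodically. Moving a directed edge on by one step
is an injective map of a finite set, so some least power \<open>L\<close> of it fixes the first
directed edge. The sequence of starting points could still run through a vertex twice in one period,
in opposite directions. In that case the sequence is symmetric under a reflection of the indices, and at the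
centre of the reflection it would turn back or have two equal neighbours.\<close>

lemma two_regular_cycle:
  fixes R :: "'a \<Rightarrow> 'a \<Rightarrow> bool"
  assumes fin: "finite S" and x0: "x0 \<in> S"
    and two: "\<And>x. x \<in> S \<Longrightarrow> \<exists>a\<in>S. \<exists>b\<in>S. a \<noteq> b \<and> {y. R x y} = {a, b}"
    and sym: "\<And>x y. R x y \<Longrightarrow> R y x" and irrefl: "\<And>x. \<not> R x x"
  obtains c :: "int \<Rightarrow> 'a" and L :: nat
  where "L \<ge> 3" "c 0 = x0" "\<And>i. {y. R (c i) y} = {c (i - 1), c (i + 1)}"
    "\<And>i. c i \<in> S" "\<And>i j. c i = c j \<longleftrightarrow> int L dvd j - i"
proof -
  define oth where "oth x y = (THE z. R x z \<and> z \<noteq> y)" for x y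
  have oth: "{z. R x z} = {y, oth x y}" "oth x y \<noteq> y" "oth x (oth x y) = y" "oth x y \<in> S" "R x (oth x y)"
    if x: "x \<in> S" and y: "R x y" for x y
  proof -
    obtain a b where ab: "a \<in> S" "b \<in> S" "a \<noteq> b" "{y. R x y} = {a, b}" using two[OF x] by blast
    have r: "R x z \<longleftrightarrow> z = a \<or> z = b" for z using ab(4) by auto
    have o: "oth x a = b" "oth x b = a" unfolding oth_def using ab(3) r by (intro the_equality; blast)+
    show "{z. R x z} = {y, oth x y}" "oth x y \<noteq> y" "oth x (oth x y) = y" "oth x y \<in> S" "R x (oth x y)"
      using y r[of y] o ab r by auto
  qed
  have inS: "y \<in> S" if x: "x \<in> S" and y: "R x y" for x y
  proof -
    obtain a b where "a \<in> S" "b \<in> S" "{y. R x y} = {a, b}" using two[OF x] by blast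
    moreover have "y \<in> {y. R x y}" using y by simp
    ultimately show ?thesis by auto
  qed
  define D where "D = {(x, y). x \<in> S \<and> R x y}"
  define p where "p d = (if d \<in> D then (snd d, oth (snd d) (fst d)) else d)" for d
  have finD: "finite D" by (rule finite_subset[of _ "S \<times> S"]) (use inS fin in \<open>auto simp: D_def\<close>)
  have pD: "p d \<in> D" if d: "d \<in> D" for d
  proof -
    have "snd d \<in> S" "R (snd d) (fst d)" using d inS sym by (auto simp: D_def)
    then show ?thesis using oth(5) d by (simp add: p_def D_def)
  qed
  have inj: "inj p"
  proof (rule injI)
    fix d e assume eq: "p d = p e"
    then have iff: "d \<in> D \<longleftrightarrow> e \<in> D" using pD by (metis p_def)
    show "d = e"
    proof (cases "d \<in> D")
      case True
      then have "p d = (snd d, oth (snd d) (fst d))" "p e = (snd e, oth (snd e) (fst e))"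
        using iff by (simp_all add: p_def)
      then have "snd d = snd e" "oth (snd d) (fst d) = oth (snd e) (fst e)"
        using eq by (metis prod.inject)+
      moreover have "snd d \<in> S" "R (snd d) (fst d)" "R (snd e) (fst e)"
        using True iff inS sym by (auto simp: D_def)
      ultimately have "fst d = fst e" using oth(3) by metis
      then show ?thesis using \<open>snd d = snd e\<close> by (simp add: prod_eq_iff)
    qed (use eq iff in \<open>simp add: p_def\<close>)
  qed
  obtain x1 where x1: "R x0 x1" using two[OF x0] by blast
  let ?d = "(x0, x1)"
  have dD: "?d \<in> D" using x0 x1 by (simp add: D_def)
  have powD: "(p ^^ n) ?d \<in> D" for n by (induction n) (use dD pD in auto)
  have "finite {y. \<exists>n. y = (p ^^ n) ?d}" by (rule finite_subset[OF _ finD]) (use powD in auto)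
  then have "\<exists>n>0. (p ^^ n) ?d = ?d" using funpow_inj_finite[OF inj] by blast
  then have ex: "\<exists>n. n > 0 \<and> (p ^^ n) ?d = ?d" by blast
  define L where "L = (LEAST n. n > 0 \<and> (p ^^ n) ?d = ?d)"
  have L: "L > 0" "(p ^^ L) ?d = ?d" using LeastI_ex[OF ex] by (auto simp: L_def)
  have Lmin: "L \<le> n" if "n > 0" "(p ^^ n) ?d = ?d" for n unfolding L_def using that by (intro Least_le) simp
  define dart where "dart i = (p ^^ nat (i mod int L)) ?d" for i
  have dart_D: "dart i \<in> D" for i by (simp add: dart_def powD)
  have dart_Suc: "dart (i + 1) = p (dart i)" for i
  proof -
    define j where "j = nat (i mod int L)"
    have ij: "i mod int L = int j" using L(1) by (simp add: j_def)
    have "int j < int L" unfolding ij[symmetric] using L(1) by (intro pos_mod_bound) simp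
    then have j: "j < L" by simp
    have m: "(i + 1) mod int L = (int j + 1) mod int L" using ij by (metis mod_add_left_eq)
    have "(p ^^ nat ((i + 1) mod int L)) ?d = (p ^^ Suc j) ?d"
    proof (cases "Suc j = L")
      case True
      then have "(i + 1) mod int L = 0" using m by (metis add.commute mod_self of_nat_Suc)
      then show ?thesis using True L(2) by simp
    next
      case False
      then have "(i + 1) mod int L = int j + 1" using m j by simp
      then show ?thesis by (simp add: nat_add_distrib)
    qed
    then show ?thesis by (simp add: dart_def j_def)
  qed
  have dart_inj: "int L dvd j - i" if eq: "dart i = dart j" for i j
  proof -
    have key: "m = n" if "m \<le> n" "n < L" "(p ^^ m) ?d = (p ^^ n) ?d" for m n
    proof (rule ccontr)
      assume "m \<noteq> n"
      have "(p ^^ m) ((p ^^ (n - m)) ?d) = (p ^^ m) ?d"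
        using that by (metis comp_apply funpow_add le_add_diff_inverse)
      moreover have "inj (p ^^ m)" using inj by (rule inj_fn)
      ultimately have "(p ^^ (n - m)) ?d = ?d" by (simp add: inj_eq)
      then show False using Lmin[of "n - m"] that \<open>m \<noteq> n\<close> by simp
    qed
    have lt: "nat (l mod int L) < L" for l using L(1) pos_mod_bound[of "int L" l]
      by (metis nat_less_iff of_nat_0_less_iff pos_mod_sign)
    have "nat (i mod int L) = nat (j mod int L)"
      using key[of "nat (i mod int L)" "nat (j mod int L)"] key[of "nat (j mod int L)" "nat (i mod int L)"]
        lt[of i] lt[of j] eq by (metis dart_def nat_le_linear)
    then have "i mod int L = j mod int L" using L(1) by (metis nat_0_le of_nat_0_less_iff pos_mod_sign)
    then show ?thesis by (metis mod_eq_dvd_iff)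
  qed
  define c where "c i = fst (dart i)" for i
  have dart_c: "dart i = (c i, c (i + 1))" for i
  proof -
    have "c (i + 1) = snd (dart i)" unfolding c_def dart_Suc using dart_D[of i] by (simp add: p_def)
    then show ?thesis by (simp add: c_def prod_eq_iff)
  qed
  have cS: "c i \<in> S" and cR: "R (c i) (c (i + 1))" for i using dart_D[of i] by (auto simp: dart_c D_def)
  have c2: "c (i + 1) = oth (c i) (c (i - 1))" for i
    using dart_Suc[of "i - 1"] dart_D[of "i - 1"] by (auto simp: dart_c p_def)
  have nb: "{y. R (c i) y} = {c (i - 1), c (i + 1)}" "c (i + 1) \<noteq> c (i - 1)" for i
    using oth(1,2)[OF cS sym, of "c (i - 1)" i] cR[of "i - 1"] by (auto simp: c2)
  have cyc: "int L dvd j - i" if eq: "c i = c j" for i j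
  proof -
    have "c (j + 1) = c (i + 1) \<or> c (j + 1) = c (i - 1)" using nb(1)[of i] cR[of j] eq by auto
    then show ?thesis
    proof
      assume "c (j + 1) = c (i + 1)"
      then show ?thesis using dart_inj eq by (simp add: dart_c)
    next
      assume bk: "c (j + 1) = c (i - 1)"
      have refl: "c (j + s) = c (i - s)" for s
      proof (rule two_regular_unique[of R "\<lambda>s. c (j + s)" "\<lambda>s. c (i - s)"])
        show "{y. R (c (j + l)) y} = {c (j + (l - 1)), c (j + (l + 1))}" for l
          using nb(1)[of "j + l"] by (simp add: algebra_simps)
        show "{y. R (c (i - l)) y} = {c (i - (l - 1)), c (i - (l + 1))}" for l
          using nb(1)[of "i - l"] by (simp add: algebra_simps insert_commute)
      qed (use eq bk in auto)
      show ?thesis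
      proof (cases "even (i - j)")
        case True
        then obtain s where "i - j = 2 * s" by blast
        then have "j + (s + 1) = (j + s) + 1" "i - (s + 1) = (j + s) - 1" by auto
        then show ?thesis using refl[of "s + 1"] nb(2)[of "j + s"] by metis
      next
        case False
        then obtain s where "i - j = 2 * s + 1" by (rule oddE)
        then have "i - s = (j + s) + 1" by simp
        then show ?thesis using refl[of s] cR[of "j + s"] irrefl by metis
      qed
    qed
  qed
  have per: "c (i + int L * s) = c i" for i s by (simp add: c_def dart_def)
  have cyc': "c i = c j \<longleftrightarrow> int L dvd j - i" for i j
  proof
    assume "int L dvd j - i"
    then obtain s where "j - i = int L * s" by blast
    then have "j = i + int L * s" by simp
    then show "c i = c j" using per by simp
  qed (rule cyc)
  have "L \<noteq> 1" using cyc'[of 0 1] cR[of 0] irrefl by auto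
  moreover have "L \<noteq> 2" using cyc'[of 0 2] nb(2)[of 1] by auto
  ultimately have "L \<ge> 3" using L(1) by simp
  moreover have "c 0 = x0" by (simp add: c_def dart_def)
  ultimately show ?thesis using that nb(1) cS cyc' by blast
qed

section \<open>Ladders\<close>

context nonbipartite_barrier
begin

text \<open>The edges \<open>{x, \<tau> x}\<close> are the rungs of a ladder and the other edges, the relation \<open>R\<close>, its
rails, along which \<open>\<tau>\<close> is an automorphism. Let \<open>c\<close> be the cycle formed by one rail
and \<open>t\<close> its image under \<open>\<tau>\<close>. If the two are disjoint, the graph is a prism over a
cycle, which has odd length as the graph is not bipartite. If they meet, they have the same vertices, and
\<open>\<tau>\<close> acts on this cycle as a rotation or a reflection. A reflection would fix a vertex or
exchange the ends of a rail. A rotation without fixed points that is an involution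
is the half turn, so the graph is a Moebius ladder; it is bipartite unless the number of its
vertices is divisible by four.\<close>

lemma ladder:
  fixes \<tau> :: "'a \<Rightarrow> 'a"
  assumes k3: "k = 3"
    and rung: "\<And>x. x \<in> V \<Longrightarrow> x \<sim> \<tau> x" and invol: "\<And>x. x \<in> V \<Longrightarrow> \<tau> (\<tau> x) = x"
    and rails: "\<And>x y. x \<sim> y \<Longrightarrow> y \<noteq> \<tau> x \<Longrightarrow> \<tau> x \<sim> \<tau> y"
  shows "(\<exists>n::nat\<ge>1. isomorphic G (cayley_Z (4 * n) {1, 4 * int n - 1, 2 * int n}))
    \<or> (\<exists>n::nat\<ge>1. isomorphic G (cayley_Z (4 * n + 2) {2, 4 * int n, 2 * int n + 1}))"
proof -
  define R where "R x y \<longleftrightarrow> x \<sim> y \<and> y \<noteq> \<tau> x" for x y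
  have RV: "x \<in> V" "y \<in> V" if "R x y" for x y using that adj_verts by (auto simp: R_def)
  have R_sym: "R y x" if "R x y" for x y
    using that invol[of y] adj_verts adj_sym by (auto simp: R_def)
  have R_irrefl: "\<not> R x x" for x using adj_irrefl by (simp add: R_def)
  have R_rail: "R (\<tau> x) (\<tau> y)" if "R x y" for x y
  proof -
    have "x \<in> V" "y \<in> V" using that RV by auto
    then have "\<tau> y \<noteq> \<tau> (\<tau> x)" using invol R_sym[OF that] by (metis R_def)
    then show ?thesis using rails that by (simp add: R_def)
  qed
  have two: "\<exists>a\<in>V. \<exists>b\<in>V. a \<noteq> b \<and> {y. R x y} = {a, b}" if x: "x \<in> V" for x
  proof -
    have "{y. R x y} = nbrs x - {\<tau> x}" by (auto simp: R_def nbrs_def)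
    moreover have "card (nbrs x - {\<tau> x}) = 2"
      using card_nbrs[OF x] rung[OF x] k3 by (simp add: nbrs_def card_Diff_singleton)
    ultimately obtain a b where "{y. R x y} = {a, b}" "a \<noteq> b" by (auto simp: card_2_iff)
    then show ?thesis using RV(2)[of x a] RV(2)[of x b] by blast
  qed
  obtain x0 where x0: "x0 \<in> V" using V_nonempty by blast
  obtain c L where L: "L \<ge> 3" and cR: "\<And>i. {y. R (c i) y} = {c (i - 1), c (i + 1)}"
    and cV: "\<And>i. c i \<in> V" and ceq: "\<And>i j. c i = c j \<longleftrightarrow> int L dvd j - i"
    using two_regular_cycle[of V x0 R, OF fin x0 two R_sym R_irrefl] by metis
  define t where "t i = \<tau> (c i)" for i
  have tV: "t i \<in> V" for i using rung[OF cV] adj_verts by (auto simp: t_def)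
  have ct: "c i \<sim> t i" for i using rung cV by (simp add: t_def)
  have tt: "\<tau> (t i) = c i" for i using invol cV by (simp add: t_def)
  have teq: "t i = t j \<longleftrightarrow> int L dvd j - i" for i j using ceq tt by (metis t_def)
  have cstep: "R (c i) (c (i - 1))" "R (c i) (c (i + 1))" for i using cR[of i] by auto
  have tR: "{y. R (t i) y} = {t (i - 1), t (i + 1)}" for i
  proof -
    obtain a b where ab: "{y. R (t i) y} = {a, b}" using two[OF tV] by blast
    have "R (t i) (t (i - 1))" "R (t i) (t (i + 1))" using R_rail cstep by (auto simp: t_def)
    moreover have "t (i - 1) \<noteq> t (i + 1)"
      using dvd_imp_le_int[of 2 "int L"] L by (auto simp: teq)
    ultimately have "t (i - 1) \<in> {a, b}" "t (i + 1) \<in> {a, b}" using ab by auto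
    then show ?thesis using ab \<open>t (i - 1) \<noteq> t (i + 1)\<close> by auto
  qed
  have nbr: "x \<sim> y \<longleftrightarrow> y = \<tau> x \<or> R x y" if "x \<in> V" for x y using rung that by (auto simp: R_def)
  have cc: "R (c i) (c j) \<longleftrightarrow> int L dvd i - j - 1 \<or> int L dvd i - j + 1" for i j
  proof -
    have "R (c i) (c j) \<longleftrightarrow> c j = c (i - 1) \<or> c j = c (i + 1)" using cR[of i] by auto
    then show ?thesis unfolding ceq by (auto simp: algebra_simps)
  qed
  have tt': "R (t i) (t j) \<longleftrightarrow> int L dvd i - j - 1 \<or> int L dvd i - j + 1" for i j
  proof -
    have "R (t i) (t j) \<longleftrightarrow> t j = t (i - 1) \<or> t j = t (i + 1)" using tR[of i] by auto
    then show ?thesis unfolding teq by (auto simp: algebra_simps)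
  qed
  show ?thesis
  proof (cases "\<exists>i j. t i = c j")
    case False
    then have ne: "t i \<noteq> c j" for i j by blast
    have "range c \<union> range t = V"
    proof (rule connected_closed)
      fix x y assume x: "x \<in> range c \<union> range t" and xy: "x \<sim> y"
      show "y \<in> range c \<union> range t"
      proof (cases "x \<in> range c")
        case True
        then obtain i where i: "x = c i" by blast
        then have "y = t i \<or> y \<in> {y. R (c i) y}" using nbr[OF cV, of i y] xy by (auto simp: t_def)
        then show ?thesis unfolding cR by auto
      next
        case False
        then obtain i where i: "x = t i" using x by blast
        then have "y = c i \<or> y \<in> {y. R (t i) y}" using nbr[OF tV, of i y] xy tt by auto
        then show ?thesis unfolding tR by auto
      qed
    qed (use cV tV in auto)
    have a1: "c i \<sim> c j \<longleftrightarrow> int L dvd i - j - 1 \<or> int L dvd i - j + 1" for i j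
      using nbr[OF cV, of i "c j"] cc ne[of i j] by (auto simp: t_def)
    have a2: "t i \<sim> t j \<longleftrightarrow> int L dvd i - j - 1 \<or> int L dvd i - j + 1" for i j
      using nbr[OF tV, of i "t j"] tt' ne[of j i] tt by auto
    have a3: "c i \<sim> t j \<longleftrightarrow> int L dvd i - j" for i j
    proof -
      have "\<not> R (c i) (t j)" using cR[of i] ne by auto
      then show ?thesis using nbr[OF cV, of i "t j"] teq[of j i] by (simp add: t_def)
    qed
    have "odd L"
    proof
      assume "even L"
      then have par: "even i \<longleftrightarrow> even j" if "int L dvd j - i" for i j
        using dvd_trans[of 2 "int L" "j - i"] that \<open>even L\<close> by auto
      define A where "A = {c i |i. even i} \<union> {t i |i. odd i}"
      have cA: "c i \<in> A \<longleftrightarrow> even i" for i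
      proof
        assume "c i \<in> A"
        then obtain j where "c i = c j \<and> even j \<or> c i = t j" unfolding A_def by blast
        then have "c i = c j" "even j" using ne[of j i] by auto
        then show "even i" using par[of j i] unfolding ceq by simp
      qed (auto simp: A_def)
      have tA: "t i \<in> A \<longleftrightarrow> odd i" for i
      proof
        assume "t i \<in> A"
        then obtain j where "t i = c j \<or> t i = t j \<and> odd j" unfolding A_def by blast
        then have "t i = t j" "odd j" using ne[of i j] by auto
        then show "odd i" using par[of j i] unfolding teq by simp
      qed (auto simp: A_def)
      have odd_diff: "even i \<noteq> even j" if "int L dvd i - j - 1 \<or> int L dvd i - j + 1" for i j
        using that par[of "i - j" 1] par[of "i - j" "- 1"] by auto
      obtain x y where xy: "x \<sim> y" "x \<in> A \<longleftrightarrow> y \<in> A" using nonbipartite by blast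
      have "x \<in> range c \<union> range t" "y \<in> range c \<union> range t"
        using xy(1) adj_verts \<open>range c \<union> range t = V\<close> by auto
      then consider i j where "x = c i" "y = c j" | i j where "x = c i" "y = t j"
        | i j where "x = t i" "y = c j" | i j where "x = t i" "y = t j" by blast
      then show False
      proof cases
        case (1 i j)
        then show False using xy a1 odd_diff cA by blast
      next
        case (2 i j)
        then have "int L dvd i - j" using xy(1) a3 by blast
        then have "even i \<longleftrightarrow> even j" using par by blast
        then show False using xy(2) 2 cA tA by blast
      next
        case (3 i j)
        then have "int L dvd j - i" using xy(1) a3 adj_sym by blast
        then have "even i \<longleftrightarrow> even j" using par by blast
        then show False using xy(2) 3 cA tA by blast
      next
        case (4 i j)
        then show False using xy a2 odd_diff tA by blast
      qed
    qed
    then obtain n where n: "L = 2 * n + 1" by (rule oddE)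
    let ?l = "int L"
    define f where "f x = (if even x then c ((int n + 1) * x) else t ((int n + 1) * x))" for x
    have m: "int (4 * n + 2) = 2 * ?l" using n by simp
    \<comment> \<open>\<open>int n + 1\<close> is the inverse of \<open>2\<close> modulo \<open>L = 2 * n + 1\<close>\<close>
    have halve: "?l dvd (int n + 1) * z - y \<longleftrightarrow> ?l dvd z - 2 * y" for z y
    proof
      assume "?l dvd (int n + 1) * z - y"
      then have "?l dvd 2 * ((int n + 1) * z - y) - ?l * z" by (meson dvd_diff dvd_mult dvd_triv_left)
      moreover have "2 * ((int n + 1) * z - y) - ?l * z = z - 2 * y" using n by (simp add: algebra_simps)
      ultimately show "?l dvd z - 2 * y" by (simp only:)
    next
      assume "?l dvd z - 2 * y"
      then have "?l dvd (int n + 1) * (z - 2 * y) + ?l * y" by (meson dvd_add dvd_mult dvd_triv_left)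
      moreover have "(int n + 1) * (z - 2 * y) + ?l * y = (int n + 1) * z - y" using n by (simp add: algebra_simps)
      ultimately show "?l dvd (int n + 1) * z - y" by (simp only:)
    qed
    have "isomorphic G (cayley_Z (4 * n + 2) {2, 4 * int n, 2 * int n + 1})"
    proof (rule isomorphic_cayleyI)
      have "card (range c) = L" "card (range t) = L"
        using card_range_periodic(2)[of L c] card_range_periodic(2)[of L t] ceq teq L by auto
      moreover have "range c \<inter> range t = {}"
      proof (rule equals0I)
        fix x assume "x \<in> range c \<inter> range t"
        then obtain i j where "x = c j" "x = t i" by blast
        then show False using ne by metis
      qed
      moreover have "finite (range c)" "finite (range t)"
        using cV tV fin by (auto intro: finite_subset[of _ V])
      ultimately show "card V = 4 * n + 2"
        using card_Un_disjoint[of "range c" "range t"] n unfolding \<open>range c \<union> range t = V\<close> by simp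
      show "V \<subseteq> f ` {0..<int (4 * n + 2)}"
      proof
        fix x assume "x \<in> V"
        then consider i where "x = c i" | i where "x = t i" using \<open>range c \<union> range t = V\<close> by blast
        then show "x \<in> f ` {0..<int (4 * n + 2)}"
        proof cases
          case (1 i)
          obtain j where j: "0 \<le> j" "j < 2 * ?l" "?l dvd j - 2 * i" "even j \<longleftrightarrow> True"
            using odd_lift[OF \<open>odd L\<close>, of "2 * i" True] by blast
          have "x = f j" using 1 j halve[of j i] by (auto simp: f_def ceq)
          then show ?thesis using j m by auto
        next
          case (2 i)
          obtain j where j: "0 \<le> j" "j < 2 * ?l" "?l dvd j - 2 * i" "even j \<longleftrightarrow> False"
            using odd_lift[OF \<open>odd L\<close>, of "2 * i" False] by blast
          have "x = f j" using 2 j halve[of j i] by (auto simp: f_def teq)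
          then show ?thesis using j m by auto
        qed
      qed
      show "\<exists>b\<in>{2, 4 * int n, 2 * int n + 1}. int (4 * n + 2) dvd - a - b"
        if "a \<in> {2, 4 * int n, 2 * int n + 1}" for a
      proof -
        have "int (4 * n + 2) - a \<in> {2, 4 * int n, 2 * int n + 1}" using that by auto
        moreover have "int (4 * n + 2) dvd - a - (int (4 * n + 2) - a)" by (rule dvd_minus_minus_diff)
        ultimately show ?thesis by blast
      qed
      fix x y :: int
      have par: "even z" if "2 * ?l dvd z" for z using that dvd_mult_left by blast
      have e1: "2 * ?l dvd x - y - 2 \<longleftrightarrow> (even x \<longleftrightarrow> even y) \<and> ?l dvd x - y - 2"
        using dvd_half_iff[of ?l "x - y - 2"] par[of "x - y - 2"] par[of "x - y - 2 - ?l"] \<open>odd L\<close> by auto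
      have e2: "2 * ?l dvd x - y - 4 * int n \<longleftrightarrow> (even x \<longleftrightarrow> even y) \<and> ?l dvd x - y + 2"
      proof -
        have "x - y + 2 = (x - y - 4 * int n) + 2 * ?l" using n by simp
        then have "2 * ?l dvd x - y - 4 * int n \<longleftrightarrow> 2 * ?l dvd x - y + 2" by (metis dvd_add_triv_right_iff)
        then show ?thesis
          using dvd_half_iff[of ?l "x - y + 2"] par[of "x - y + 2"] par[of "x - y + 2 - ?l"] \<open>odd L\<close> by auto
      qed
      have e3: "2 * ?l dvd x - y - (2 * int n + 1) \<longleftrightarrow> (even x \<noteq> even y) \<and> ?l dvd x - y"
      proof -
        have l: "2 * int n + 1 = ?l" using n by simp
        show ?thesis unfolding l
          using dvd_half_iff[of ?l "x - y"] par[of "x - y"] par[of "x - y - ?l"] \<open>odd L\<close> by auto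
      qed
      have h1: "?l dvd (int n + 1) * x - (int n + 1) * y - 1 \<longleftrightarrow> ?l dvd x - y - 2"
        using halve[of "x - y" 1] by (simp add: algebra_simps)
      have h2: "?l dvd (int n + 1) * x - (int n + 1) * y + 1 \<longleftrightarrow> ?l dvd x - y + 2"
        using halve[of "x - y" "- 1"] by (simp add: algebra_simps)
      have h3: "?l dvd (int n + 1) * x - (int n + 1) * y \<longleftrightarrow> ?l dvd x - y"
        using halve[of "x - y" 0] by (simp add: algebra_simps)
      have h4: "?l dvd (int n + 1) * y - (int n + 1) * x \<longleftrightarrow> ?l dvd x - y"
        using h3 by (simp add: dvd_diff_commute)
      show "f x \<sim> f y \<longleftrightarrow> (\<exists>a\<in>{2, 4 * int n, 2 * int n + 1}. int (4 * n + 2) dvd x - y - a)"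
        unfolding m using e1 e2 e3 a1 a2 a3[of "(int n + 1) * x" "(int n + 1) * y"]
          a3[of "(int n + 1) * y" "(int n + 1) * x"] h1 h2 h3 h4
          adj_commute[of "t ((int n + 1) * x)" "c ((int n + 1) * y)"]
        by (auto simp: f_def)
    qed
    moreover have "n \<ge> 1" using n L by simp
    ultimately show ?thesis by blast
  next
    case True
    then obtain i0 j0 where ij: "t i0 = c j0" by blast
    have "R (t i0) (t (i0 + 1))" using tR by auto
    then have "t (i0 + 1) = c (j0 + 1) \<or> t (i0 + 1) = c (j0 - 1)" using ij cR[of j0] by auto
    then have "\<exists>m. t = (\<lambda>i. c (i + m))"
    proof
      assume s: "t (i0 + 1) = c (j0 + 1)"
      have "t (i0 + l) = c (j0 + l)" for l
      proof (rule two_regular_unique[of R "\<lambda>l. t (i0 + l)" "\<lambda>l. c (j0 + l)"])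
        show "{y. R (t (i0 + l)) y} = {t (i0 + (l - 1)), t (i0 + (l + 1))}" for l
          using tR[of "i0 + l"] by (simp add: algebra_simps)
        show "{y. R (c (j0 + l)) y} = {c (j0 + (l - 1)), c (j0 + (l + 1))}" for l
          using cR[of "j0 + l"] by (simp add: algebra_simps)
      qed (use ij s in auto)
      from this[of "i - i0" for i] have "t i = c (i + (j0 - i0))" for i by (simp add: algebra_simps)
      then show ?thesis by blast
    next
      assume s: "t (i0 + 1) = c (j0 - 1)"
      have refl: "t (i0 + l) = c (j0 - l)" for l
      proof (rule two_regular_unique[of R "\<lambda>l. t (i0 + l)" "\<lambda>l. c (j0 - l)"])
        show "{y. R (t (i0 + l)) y} = {t (i0 + (l - 1)), t (i0 + (l + 1))}" for l
          using tR[of "i0 + l"] by (simp add: algebra_simps)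
        show "{y. R (c (j0 - l)) y} = {c (j0 - (l - 1)), c (j0 - (l + 1))}" for l
          using cR[of "j0 - l"] by (simp add: algebra_simps insert_commute)
      qed (use ij s in auto)
      show ?thesis
      proof (cases "even (j0 - i0)")
        case True
        then obtain l where l: "j0 - i0 = 2 * l" by blast
        have "j0 - l = i0 + l" using l by simp
        then have "t (i0 + l) = c (i0 + l)" using refl[of l] by metis
        then show ?thesis using ct[of "i0 + l"] adj_irrefl by simp
      next
        case False
        then obtain l where l: "j0 - i0 = 2 * l + 1" by (rule oddE)
        have "j0 - l = i0 + l + 1" using l by simp
        then have "t (i0 + l) = c (i0 + l + 1)" using refl[of l] by metis
        then show ?thesis using cstep(2)[of "i0 + l"] by (simp add: R_def t_def)
      qed
    qed
    then obtain m where tm: "t i = c (i + m)" for i by blast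
    have "int L dvd 2 * m"
    proof -
      have "c 0 = \<tau> (c m)" using tt[of 0] tm[of 0] by simp
      also have "\<dots> = c (2 * m)" using tm[of m] by (simp add: t_def)
      finally show ?thesis by (simp add: ceq)
    qed
    moreover have nm: "\<not> int L dvd m"
    proof
      assume "int L dvd m"
      then have "c 0 = t 0" using tm[of 0] ceq[of 0 m] by simp
      then show False using ct[of 0] adj_irrefl by simp
    qed
    have "range c = V"
    proof (rule connected_closed)
      fix x y assume x: "x \<in> range c" and xy: "x \<sim> y"
      then obtain i where i: "x = c i" by blast
      then have "y = c (i + m) \<or> y \<in> {y. R (c i) y}" using nbr[OF cV, of i y] xy tm[of i] by (auto simp: t_def)
      then show "y \<in> range c" unfolding cR by auto
    qed (use cV in auto)
    then have cardV: "card V = L" using card_range_periodic(2)[of L c] ceq L by simp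
    then have "even L" using card_V by presburger
    then obtain M where M: "L = 2 * M" by (rule evenE)
    have mM: "int L dvd z - m \<longleftrightarrow> int L dvd z - int M" for z
    proof -
      have "int M dvd m" using \<open>int L dvd 2 * m\<close> M by simp
      then have "int L dvd m - int M" using dvd_half_iff[of "int M" m] nm M by auto
      then show ?thesis
        using dvd_add[of "int L" "z - m" "m - int M"] dvd_diff[of "int L" "z - int M" "m - int M"] by auto
    qed
    have adj: "c i \<sim> c j \<longleftrightarrow> int L dvd i - j - 1 \<or> int L dvd i - j + 1 \<or> int L dvd i - j - int M" for i j
    proof -
      have "c i \<sim> c j \<longleftrightarrow> c j \<sim> c i" by (rule adj_commute)
      also have "\<dots> \<longleftrightarrow> c i = t j \<or> R (c j) (c i)" using nbr[OF cV] by (simp add: t_def)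
      also have "c i = t j \<longleftrightarrow> int L dvd i - j - m"
        unfolding tm ceq by (metis diff_diff_eq dvd_diff_commute)
      also have "R (c j) (c i) \<longleftrightarrow> R (c i) (c j)" using R_sym by blast
      finally show ?thesis using cc mM by auto
    qed
    have "even M"
    proof (rule ccontr)
      assume oM: "odd M"
      have par: "even i \<longleftrightarrow> even j" if "int L dvd j - i" for i j
        using dvd_trans[of 2 "int L" "j - i"] that M by auto
      define A where "A = {c i |i. even i}"
      have cA: "c i \<in> A \<longleftrightarrow> even i" for i
      proof
        assume "c i \<in> A"
        then obtain j where "c i = c j" "even j" unfolding A_def by blast
        then show "even i" using par[of j i] unfolding ceq by simp
      qed (auto simp: A_def)
      obtain x y where xy: "x \<sim> y" "x \<in> A \<longleftrightarrow> y \<in> A" using nonbipartite by blast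
      then have "x \<in> range c" "y \<in> range c" using adj_verts \<open>range c = V\<close> by auto
      then obtain i j where "x = c i" "y = c j" by blast
      then show False
        using xy adj[of i j] cA par[of "i - j" 1] par[of "i - j" "- 1"] par[of "i - j" "int M"] oM by auto
    qed
    then obtain n where n: "M = 2 * n" by blast
    have "isomorphic G (cayley_Z (4 * n) {1, 4 * int n - 1, 2 * int n})"
    proof (rule isomorphic_cayleyI)
      show "card V = 4 * n" using cardV M n by simp
      show "V \<subseteq> c ` {0..<int (4 * n)}"
        using card_range_periodic(1)[of L c] ceq L \<open>range c = V\<close> M n by simp
      show "\<exists>b\<in>{1, 4 * int n - 1, 2 * int n}. int (4 * n) dvd - a - b"
        if "a \<in> {1, 4 * int n - 1, 2 * int n}" for a
      proof -
        have "int (4 * n) - a \<in> {1, 4 * int n - 1, 2 * int n}" using that by auto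
        moreover have "int (4 * n) dvd - a - (int (4 * n) - a)" by (rule dvd_minus_minus_diff)
        ultimately show ?thesis by blast
      qed
      fix x y :: int
      have m: "int (4 * n) = int L" using M n by simp
      have "x - y + 1 = (x - y - (4 * int n - 1)) + int L" using m by simp
      then have "int L dvd x - y + 1 \<longleftrightarrow> int L dvd x - y - (4 * int n - 1)" by (metis dvd_add_triv_right_iff)
      then show "c x \<sim> c y \<longleftrightarrow> (\<exists>a\<in>{1, 4 * int n - 1, 2 * int n}. int (4 * n) dvd x - y - a)"
        unfolding m adj using n by auto
    qed
    moreover have "n \<ge> 1" using n M L by (cases n) auto
    ultimately show ?thesis by blast
  qed
qed

end

lemma isomorphic_by_index:
  assumes e: "bij_betw e I (verts G)" and p: "bij_betw p I (verts H)"
    and adj: "\<And>i j. i \<in> I \<Longrightarrow> j \<in> I \<Longrightarrow> adj G (e i) (e j) \<longleftrightarrow> adj H (p i) (p j)"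
  shows "isomorphic G H"
proof -
  let ?f = "p \<circ> inv_into I e"
  have i: "inv_into I e x \<in> I" "e (inv_into I e x) = x" if "x \<in> verts G" for x
    using that e by (auto simp: bij_betw_def inv_into_into f_inv_into_f)
  have "bij_betw ?f (verts G) (verts H)"
    using bij_betw_trans[OF bij_betw_inv_into[OF e] p] .
  moreover have "adj G x y \<longleftrightarrow> adj H (?f x) (?f y)" if "x \<in> verts G" "y \<in> verts G" for x y
    using adj[OF i(1)[OF that(1)] i(1)[OF that(2)]] i(2) that by simp
  ultimately show ?thesis unfolding isomorphic_def graph_isomorphism_def by blast
qed

text \<open>An enumeration of the Petersen graph with indices \<open>0, \<dots>, 4\<close> along an outer cycle and
\<open>5, \<dots>, 9\<close> for the inner neighbours in the same order: the outer vertices are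
\<open>{2i, 2i + 1}\<close> and the inner ones \<open>{2i + 2, 2i + 4}\<close> modulo five.\<close>

definition petersen_vertex :: "nat \<Rightarrow> nat set" where
  "petersen_vertex i = (if i < 5 then {2 * i mod 5, (2 * i + 1) mod 5}
     else {(2 * i + 2) mod 5, (2 * i + 4) mod 5})"

definition petersen_index_adj :: "nat \<Rightarrow> nat \<Rightarrow> bool" where
  "petersen_index_adj i j \<longleftrightarrow>
     (if i < 5 \<and> j < 5 then 5 dvd int j - int i - 1 \<or> 5 dvd int j - int i + 1
      else if 5 \<le> i \<and> 5 \<le> j then 5 dvd int j - int i - 3 \<or> 5 dvd int j - int i + 3
      else 5 dvd int j - int i)"

lemma petersen_index: "{0..<10} = {0, 1, 2, 3, 4, 5, 6, 7, 8, 9::nat}"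
  by auto

lemma petersen_vertex_in:
  assumes "i \<in> {0..<10}"
  shows "petersen_vertex i \<subseteq> {..<5} \<and> card (petersen_vertex i) = 2"
proof -
  have "\<forall>i\<in>{0..<10}. petersen_vertex i \<subseteq> {..<5} \<and> card (petersen_vertex i) = 2"
    unfolding petersen_index by (simp add: petersen_vertex_def)
  then show ?thesis using assms by blast
qed

lemma petersen_vertex_disjoint:
  assumes "i \<in> {0..<10}" "j \<in> {0..<10}"
  shows "disjnt (petersen_vertex i) (petersen_vertex j) \<longleftrightarrow> petersen_index_adj i j"
    "petersen_vertex i = petersen_vertex j \<longleftrightarrow> i = j"
proof -
  have "\<forall>i\<in>{0..<10}. \<forall>j\<in>{0..<10}.
      (disjnt (petersen_vertex i) (petersen_vertex j) \<longleftrightarrow> petersen_index_adj i j) \<and>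
      (petersen_vertex i = petersen_vertex j \<longleftrightarrow> i = j)"
    unfolding petersen_index by (simp add: petersen_vertex_def petersen_index_adj_def disjnt_def doubleton_eq_iff)
  then show "disjnt (petersen_vertex i) (petersen_vertex j) \<longleftrightarrow> petersen_index_adj i j"
    "petersen_vertex i = petersen_vertex j \<longleftrightarrow> i = j" using assms by blast+
qed

lemma petersen_vertex_bij: "bij_betw petersen_vertex {0..<10} (verts petersen_graph)"
proof -
  have inj: "inj_on petersen_vertex {0..<10}" using petersen_vertex_disjoint(2) by (auto intro: inj_onI)
  have vs: "verts petersen_graph = {P. P \<subseteq> {..<5} \<and> card P = 2}" by (simp add: petersen_graph_def)
  have "card {P. P \<subseteq> {..<5::nat} \<and> card P = 2} = 5 choose 2" using n_subsets[of "{..<5::nat}" 2] by simp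
  also have "(5::nat) choose 2 = 10" by (simp add: choose_two)
  finally have cv: "card {P. P \<subseteq> {..<5::nat} \<and> card P = 2} = 10" .
  have "petersen_vertex ` {0..<10} = verts petersen_graph"
    unfolding vs
  proof (rule card_subset_eq)
    show "finite {P. P \<subseteq> {..<5::nat} \<and> card P = 2}" by (rule finite_subset[of _ "Pow {..<5}"]) auto
    show "petersen_vertex ` {0..<10} \<subseteq> {P. P \<subseteq> {..<5} \<and> card P = 2}"
      using petersen_vertex_in by blast
    show "card (petersen_vertex ` {0..<10}) = card {P. P \<subseteq> {..<5::nat} \<and> card P = 2}"
      unfolding cv using inj by (simp add: card_image)
  qed
  then show ?thesis using inj by (simp add: bij_betw_def)
qed

lemma petersen_vertex_adj:
  assumes "i \<in> {0..<10}" "j \<in> {0..<10}"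
  shows "adj petersen_graph (petersen_vertex i) (petersen_vertex j) \<longleftrightarrow> petersen_index_adj i j"
proof -
  have "adj petersen_graph P Q \<longleftrightarrow> disjnt P Q"
    if "P \<subseteq> {..<5}" "card P = 2" "Q \<subseteq> {..<5}" "card Q = 2" for P Q
    using that disjnt_sym by (auto simp: adj_def petersen_graph_def doubleton_eq_iff)
  then show ?thesis using petersen_vertex_in assms petersen_vertex_disjoint(1)[OF assms] by simp
qed

section \<open>The cubic case\<close>

context vertex_transitive_graph
begin

text \<open>The neighbours \<open>a\<close> and \<open>b\<close> of \<open>x\<close> lie with \<open>x\<close> on a common cycle of length four.
The cubic case is divided according to how many of the three pairs of neighbours of a vertex
have this property. This number is the same at all vertices.\<close>

definition square :: "'a \<Rightarrow> 'a \<Rightarrow> 'a \<Rightarrow> bool" where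
  "square x a b \<longleftrightarrow> (\<exists>z. z \<noteq> x \<and> a \<sim> z \<and> b \<sim> z)"

lemma square_sym: "square x a b \<longleftrightarrow> square x b a" by (auto simp: square_def)

lemma squareI: "a \<sim> z \<Longrightarrow> b \<sim> z \<Longrightarrow> z \<noteq> x \<Longrightarrow> square x a b" by (auto simp: square_def)

lemma Aut_surj:
  assumes "\<phi> \<in> Aut"
  obtains y where "\<phi> y = x"
  using permutes_inverses(1)[OF Aut_perm[OF assms]] by blast

lemma Aut_square:
  assumes \<phi>: "\<phi> \<in> Aut"
  shows "square (\<phi> x) (\<phi> a) (\<phi> b) \<longleftrightarrow> square x a b"
proof
  assume "square (\<phi> x) (\<phi> a) (\<phi> b)"
  then obtain z where z: "z \<noteq> \<phi> x" "\<phi> a \<sim> z" "\<phi> b \<sim> z" by (auto simp: square_def)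
  obtain y where "\<phi> y = z" using Aut_surj[OF \<phi>] by blast
  then show "square x a b" using z Aut_adj[OF \<phi>] by (intro squareI[of _ y]) auto
next
  assume "square x a b"
  then obtain z where "z \<noteq> x" "a \<sim> z" "b \<sim> z" by (auto simp: square_def)
  then show "square (\<phi> x) (\<phi> a) (\<phi> b)"
    using Aut_adj[OF \<phi>] Aut_inj[OF \<phi>] by (intro squareI[of _ "\<phi> z"]) (auto dest: injD)
qed

definition some_square :: "'a \<Rightarrow> bool" where
  "some_square x \<longleftrightarrow> (\<exists>a b. x \<sim> a \<and> x \<sim> b \<and> a \<noteq> b \<and> square x a b)"

definition not_every_square :: "'a \<Rightarrow> bool" where
  "not_every_square x \<longleftrightarrow> (\<exists>a b. x \<sim> a \<and> x \<sim> b \<and> a \<noteq> b \<and> \<not> square x a b)"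

text \<open>Both pairs of neighbours of \<open>x\<close> that contain \<open>r\<close> lie on squares, as at a rung of a ladder.\<close>

definition has_rung :: "'a \<Rightarrow> bool" where
  "has_rung x \<longleftrightarrow> (\<exists>r. x \<sim> r \<and> (\<forall>b. x \<sim> b \<longrightarrow> b \<noteq> r \<longrightarrow> square x r b))"

lemma some_square_transfer:
  assumes "some_square x" "x \<in> V" "y \<in> V"
  shows "some_square y"
proof -
  obtain \<phi> where \<phi>: "\<phi> \<in> Aut" "\<phi> x = y" using Aut_transitive assms by blast
  obtain a b where "x \<sim> a" "x \<sim> b" "a \<noteq> b" "square x a b" using assms(1) by (auto simp: some_square_def)
  then have "y \<sim> \<phi> a" "y \<sim> \<phi> b" "\<phi> a \<noteq> \<phi> b" "square y (\<phi> a) (\<phi> b)"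
    using Aut_adj[OF \<phi>(1)] Aut_square[OF \<phi>(1)] Aut_inj[OF \<phi>(1)] \<phi>(2) by (auto dest: injD)
  then show ?thesis unfolding some_square_def by blast
qed

lemma not_every_square_transfer:
  assumes "not_every_square x" "x \<in> V" "y \<in> V"
  shows "not_every_square y"
proof -
  obtain \<phi> where \<phi>: "\<phi> \<in> Aut" "\<phi> x = y" using Aut_transitive assms by blast
  obtain a b where "x \<sim> a" "x \<sim> b" "a \<noteq> b" "\<not> square x a b"
    using assms(1) by (auto simp: not_every_square_def)
  then have "y \<sim> \<phi> a" "y \<sim> \<phi> b" "\<phi> a \<noteq> \<phi> b" "\<not> square y (\<phi> a) (\<phi> b)"
    using Aut_adj[OF \<phi>(1)] Aut_square[OF \<phi>(1)] Aut_inj[OF \<phi>(1)] \<phi>(2) by (auto dest: injD)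
  then show ?thesis unfolding not_every_square_def by blast
qed

lemma has_rung_transfer:
  assumes "has_rung x" "x \<in> V" "y \<in> V"
  shows "has_rung y"
proof -
  obtain \<phi> where \<phi>: "\<phi> \<in> Aut" "\<phi> x = y" using Aut_transitive assms by blast
  obtain r where r: "x \<sim> r" "\<And>b. x \<sim> b \<Longrightarrow> b \<noteq> r \<Longrightarrow> square x r b"
    using assms(1) by (auto simp: has_rung_def)
  have "square y (\<phi> r) b" if b: "y \<sim> b" "b \<noteq> \<phi> r" for b
  proof -
    obtain b' where b': "\<phi> b' = b" using Aut_surj[OF \<phi>(1)] by blast
    then have "x \<sim> b'" "b' \<noteq> r" using b Aut_adj[OF \<phi>(1)] \<phi>(2) by auto
    then show ?thesis using r(2) Aut_square[OF \<phi>(1)] \<phi>(2) b' by blast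
  qed
  moreover have "y \<sim> \<phi> r" using r(1) Aut_adj[OF \<phi>(1)] \<phi>(2) by blast
  ultimately show ?thesis unfolding has_rung_def by blast
qed

end

locale cubic_barrier = nonbipartite_barrier_no_K4 +
  assumes cubic: "k = 3"
begin

lemma nbrs_cases:
  assumes x: "x \<in> V" and "x \<sim> a" "x \<sim> b" "x \<sim> d" "a \<noteq> b" "a \<noteq> d" "b \<noteq> d"
  shows "x \<sim> y \<longleftrightarrow> y = a \<or> y = b \<or> y = d"
proof -
  have "{a, b, d} = nbrs x"
    using assms fin_nbrs card_nbrs[OF x] cubic by (intro card_subset_eq) (auto simp: nbrs_def)
  then show ?thesis by (auto simp: nbrs_def)
qed

lemma third_nbr:
  assumes x: "x \<in> V" and "x \<sim> a" "x \<sim> b" "a \<noteq> b"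
  obtains d where "x \<sim> d" "d \<noteq> a" "d \<noteq> b"
proof -
  have "card (nbrs x - {a, b}) = 1"
    using assms card_nbrs[OF x] cubic by (subst card_Diff_subset) (auto simp: nbrs_def)
  then obtain d where "nbrs x - {a, b} = {d}" by (auto simp: card_1_singleton_iff)
  then have "x \<sim> d" "d \<noteq> a" "d \<noteq> b" by (auto simp: nbrs_def)
  then show ?thesis by (rule that)
qed

lemma not_dvd_2_4: "\<not> hi dvd 2" "\<not> hi dvd 4"
proof -
  obtain c where c: "shortest c" using shortest_exists by blast
  have "hi = 3 \<or> hi > 4" using h_ge_3 odd_h by presburger
  then show "\<not> hi dvd 2" "\<not> hi dvd 4" using small_not_dvd[OF c, of 4] small_not_dvd[OF c, of 2] by auto
qed

lemma outer_nbr: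
  assumes c: "shortest c"
  obtains w where "\<And>i. c i \<sim> w i" "\<And>i. w i \<in> V - range c" "\<And>i v. c i \<sim> v \<Longrightarrow> v \<notin> range c \<Longrightarrow> v = w i"
    "\<And>i j. hi dvd j - i \<Longrightarrow> w i = w j"
proof -
  have "card (nbrs x - range c) = 1" if x: "x \<in> range c" for x
  proof -
    obtain i where i: "x = c i" using x by blast
    have "card (nbrs x - range c) = card (nbrs x) - card (nbrs x \<inter> range c)"
      using fin_nbrs by (simp add: card_Diff_subset_Int)
    then show ?thesis using card_nbrs[OF cyc_V[OF c]] nbrs_cyc[OF c] i cubic by simp
  qed
  then have "\<forall>x\<in>range c. \<exists>w. nbrs x - range c = {w}" by (auto simp: card_1_singleton_iff)
  then obtain W where W: "\<And>x. x \<in> range c \<Longrightarrow> nbrs x - range c = {W x}" by metis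
  define w where "w i = W (c i)" for i
  have n: "nbrs (c i) - range c = {w i}" for i using W by (simp add: w_def)
  have "c i \<sim> w i" "w i \<in> V - range c" for i using n[of i] nbrs_sub by (auto simp: nbrs_def)
  moreover have "v = w i" if "c i \<sim> v" "v \<notin> range c" for i v using n[of i] that by (auto simp: nbrs_def)
  moreover have "w i = w j" if "hi dvd j - i" for i j using cyc_cong[OF c that] by (simp add: w_def)
  ultimately show ?thesis using that by blast
qed

text \<open>It suffices to find one vertex. If \<open>c (i - 1)\<close> and \<open>c (i + 1)\<close> had a further common
neighbour for every \<open>i\<close>, it would be the outer neighbour of both, so the outer neighbours of
\<open>c 0\<close>, \<open>c 2\<close> and \<open>c 4\<close> would coincide; but no vertex has three neighbours on the cycle.\<close>

lemma every_vertex_not_every_square: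
  assumes y: "y \<in> V"
  shows "not_every_square y"
proof -
  obtain c where c: "shortest c" using shortest_exists by blast
  note eq = cyc_eq[OF c]
  have "\<exists>i. \<not> square (c i) (c (i - 1)) (c (i + 1))"
  proof (rule ccontr)
    assume "\<not> ?thesis"
    then have sq: "square (c i) (c (i - 1)) (c (i + 1))" for i by blast
    obtain w where w: "\<And>i. c i \<sim> w i" "\<And>i v. c i \<sim> v \<Longrightarrow> v \<notin> range c \<Longrightarrow> v = w i"
      using outer_nbr[OF c] by metis
    have step: "w (i - 1) = w (i + 1)" for i
    proof -
      obtain z where z: "z \<noteq> c i" "c (i - 1) \<sim> z" "c (i + 1) \<sim> z" using sq[of i] by (auto simp: square_def)
      have "z \<notin> range c"
      proof
        assume "z \<in> range c"
        then have "z \<in> nbrs (c (i - 1)) \<inter> range c" "z \<in> nbrs (c (i + 1)) \<inter> range c"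
          using z by (auto simp: nbrs_def)
        then have "z = c (i - 2)" "z = c (i + 2)" using z(1) nbrs_cyc(1)[OF c] by (auto simp: algebra_simps)
        then show False using not_dvd_2_4(2) eq[of "i - 2" "i + 2"] by auto
      qed
      then show ?thesis using w(2) z by metis
    qed
    have "w 0 = w 2" "w 2 = w 4" using step[of 1] step[of 3] by auto
    then have "w 0 \<sim> c 0" "w 0 \<sim> c 2" "w 0 \<sim> c 4" using w(1) adj_sym by metis+
    then show False using three_nbrs_absurd[OF c, of "w 0" 0 2 4] not_dvd_2_4 by (auto simp: eq)
  qed
  then obtain i where i: "\<not> square (c i) (c (i - 1)) (c (i + 1))" by blast
  then have "not_every_square (c i)"
    using cyc_step[OF c] nbrs_cyc(2)[OF c] unfolding not_every_square_def by blast
  then show ?thesis using not_every_square_transfer cyc_V[OF c] y by blast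
qed

lemma not_three_squares:
  assumes x: "x \<in> V" and n: "x \<sim> a" "x \<sim> b" "x \<sim> d" "a \<noteq> b" "a \<noteq> d" "b \<noteq> d"
    and sq: "square x a b" "square x a d" "square x b d"
  shows False
proof -
  obtain p q where pq: "x \<sim> p" "x \<sim> q" "p \<noteq> q" "\<not> square x p q"
    using every_vertex_not_every_square[OF x] by (auto simp: not_every_square_def)
  have "p \<in> {a, b, d}" "q \<in> {a, b, d}" using nbrs_cases[OF x n] pq by auto
  then show False using pq(3,4) sq square_sym by auto
qed

text \<open>Let \<open>\<tau> x\<close> be the neighbour of \<open>x\<close> that is in both square pairs at \<open>x\<close>; as the third pair
is not on a square, it is unique. The two squares over the edge from \<open>x\<close> to \<open>\<tau> x\<close> are
distinct apart from this edge, which is thus also in both square pairs at \<open>\<tau> x\<close>. The square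
over a further edge from \<open>x\<close> to \<open>a\<close> then closes with \<open>\<tau> a\<close>.\<close>

lemma rungs_ladder:
  assumes rung: "\<And>x. x \<in> V \<Longrightarrow> has_rung x"
  shows "(\<exists>n::nat\<ge>1. isomorphic G (cayley_Z (4 * n) {1, 4 * int n - 1, 2 * int n}))
    \<or> (\<exists>n::nat\<ge>1. isomorphic G (cayley_Z (4 * n + 2) {2, 4 * int n, 2 * int n + 1}))"
proof -
  obtain \<tau> where \<tau>: "\<And>x. x \<in> V \<Longrightarrow> x \<sim> \<tau> x"
      "\<And>x b. x \<in> V \<Longrightarrow> x \<sim> b \<Longrightarrow> b \<noteq> \<tau> x \<Longrightarrow> square x (\<tau> x) b"
    using rung unfolding has_rung_def by metis
  have only: "\<tau> x = a \<or> \<tau> x = b" if x: "x \<sim> a" "x \<sim> b" "a \<noteq> b" "square x a b" for x a b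
  proof (rule ccontr)
    assume "\<not> ?thesis"
    moreover have "x \<in> V" using adj_verts x by blast
    ultimately show False using not_three_squares[of x "\<tau> x" a b] \<tau> x by blast
  qed
  have inv: "\<tau> (\<tau> x) = x" if x: "x \<in> V" for x
  proof -
    let ?y = "\<tau> x"
    have y: "?y \<in> V" "?y \<sim> x" using \<tau>(1)[OF x] adj_verts adj_sym by blast+
    have "card (nbrs x - {?y}) = 2"
      using card_nbrs[OF x] \<tau>(1)[OF x] cubic by (simp add: nbrs_def card_Diff_singleton)
    then obtain a b where ab: "nbrs x - {?y} = {a, b}" "a \<noteq> b" by (auto simp: card_2_iff)
    then have n: "x \<sim> a" "x \<sim> b" "a \<noteq> ?y" "b \<noteq> ?y" by (auto simp: nbrs_def)
    obtain z z' where z: "z \<noteq> x" "?y \<sim> z" "a \<sim> z" "z' \<noteq> x" "?y \<sim> z'" "b \<sim> z'"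
      using \<tau>(2)[OF x] n unfolding square_def by metis
    have "z \<noteq> z'"
    proof
      assume "z = z'"
      then have "square x a b" using z by (intro squareI[of _ z]) auto
      then show False using only n ab(2) by metis
    qed
    have "square ?y x z" using z n adj_sym by (intro squareI[of _ a]) auto
    moreover have "square ?y x z'" using z n adj_sym by (intro squareI[of _ b]) auto
    ultimately show ?thesis using only[of ?y x z] only[of ?y x z'] y(2) z \<open>z \<noteq> z'\<close> by metis
  qed
  have rail: "\<tau> x \<sim> \<tau> a" if a: "x \<sim> a" "a \<noteq> \<tau> x" for x a
  proof -
    have xV: "x \<in> V" "a \<in> V" using a adj_verts by auto
    obtain z where z: "z \<noteq> x" "\<tau> x \<sim> z" "a \<sim> z" using \<tau>(2)[OF xV(1) a] by (auto simp: square_def)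
    have "square a x z" using z a \<tau>(1)[OF xV(1)] adj_sym by (intro squareI[of _ "\<tau> x"]) auto
    then have "\<tau> a = x \<or> \<tau> a = z" using only[of a x z] z a adj_sym by blast
    moreover have "\<tau> a \<noteq> x" using inv[OF xV(2)] a(2) by auto
    ultimately show ?thesis using z(2) by blast
  qed
  show ?thesis by (rule ladder[OF cubic \<tau>(1) inv rail])
qed

text \<open>Without squares the outer neighbours \<open>w i\<close> are distinct, so they are all the vertices off the
cycle. Isometry allows an edge from \<open>w i\<close> to \<open>w j\<close> only for \<open>j = i \<plusminus> 1\<close>, which would
close a square, and for \<open>j = i \<plusminus> 3\<close>. So \<open>w i\<close> is adjacent to both \<open>w (i + 3)\<close> and
\<open>w (i - 3)\<close>. The walk \<open>c 0, w 0, w 3, w 6, c 6\<close> of length four contradicts isometry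
when \<open>h \<ge> 7\<close>, and for \<open>h = 3\<close> the vertices \<open>w (i + 3)\<close> and \<open>w (i - 3)\<close> coincide.\<close>

lemma no_squares_petersen_structure:
  assumes no: "\<forall>x\<in>V. \<not> some_square x"
  shows "\<exists>c w. shortest c \<and> h = 5 \<and> V = range c \<union> range w \<and>
    (\<forall>i j. c i \<sim> w j \<longleftrightarrow> hi dvd j - i) \<and>
    (\<forall>i j. w i \<sim> w j \<longleftrightarrow> hi dvd j - i - 3 \<or> hi dvd j - i + 3) \<and>
    (\<forall>i j. w i = w j \<longleftrightarrow> hi dvd j - i) \<and> (\<forall>i j. c i \<noteq> w j)"
proof -
  obtain c where c: "shortest c" using shortest_exists by blast
  note eq = cyc_eq[OF c]
  obtain w where w: "\<And>i. c i \<sim> w i" "\<And>i. w i \<in> V - range c"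
      "\<And>i v. c i \<sim> v \<Longrightarrow> v \<notin> range c \<Longrightarrow> v = w i" "\<And>i j. hi dvd j - i \<Longrightarrow> w i = w j"
    using outer_nbr[OF c] by metis
  have nosq: "\<not> square x a b" if "x \<sim> a" "x \<sim> b" "a \<noteq> b" for x a b
    using no that adj_verts unfolding some_square_def by blast
  have weq: "w i = w j \<longleftrightarrow> hi dvd j - i" for i j
  proof
    assume e: "w i = w j"
    have sq: False if "w l = w (l + 2)" for l
    proof -
      have "square (c (l + 1)) (c l) (c (l + 2))"
        using w(1)[of l] w(1)[of "l + 2"] w(2)[of l] that by (intro squareI[of _ "w l"]) auto
      moreover have "c (l + 1) \<sim> c l" "c (l + 1) \<sim> c (l + 2)" "c l \<noteq> c (l + 2)"
        using cyc_step[OF c, of "l + 1"] not_dvd_2_4 by (auto simp: eq add.commute)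
      ultimately show False using nosq by blast
    qed
    have "hi dvd j - i \<or> hi dvd j - i - 2 \<or> hi dvd j - i + 2"
      using cyc_common_nbr[OF c, of i "w i" j] w(1) e by metis
    moreover have "\<not> hi dvd j - i - 2"
    proof
      assume "hi dvd j - i - 2"
      then have "hi dvd j - (i + 2)" by (simp add: diff_diff_eq)
      then show False using sq[of i] w(4) e by metis
    qed
    moreover have "\<not> hi dvd j - i + 2"
    proof
      assume "hi dvd j - i + 2"
      then have "hi dvd (j + 2) - i" by (simp add: algebra_simps)
      then show False using sq[of j] w(4) e by metis
    qed
    ultimately show "hi dvd j - i" by blast
  qed (rule w(4))
  have cw: "c i \<sim> w j \<longleftrightarrow> hi dvd j - i" for i j
  proof -
    have "w j \<notin> range c" using w(2) by blast
    then show ?thesis using w(1)[of i] w(3)[of i "w j"] weq[of i j] by metis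
  qed
  have crw: "card (range w) = h" using card_range_periodic(2)[of h w] weq h_ge_3 by simp
  have "range w \<subseteq> V - range c" by (intro image_subsetI w(2))
  then have "h \<le> card V - h" using card_mono[of "V - range c" "range w"] crw card_outside[OF c] fin by simp
  then have "card (V - range c) = h" using order_le[OF c] card_outside[OF c] h_ge_3 by linarith
  then have Vw: "range w = V - range c"
    using \<open>range w \<subseteq> V - range c\<close> crw fin by (intro card_subset_eq) auto
  have ww: "hi dvd j - i - 3 \<or> hi dvd j - i + 3" if a: "w i \<sim> w j" for i j
  proof -
    have sq: False if b: "w l \<sim> w (l + 1)" for l
    proof -
      have "square (c l) (c (l + 1)) (w l)"
        using w(1)[of "l + 1"] b w(2)[of "l + 1"] by (intro squareI[of _ "w (l + 1)"]) auto
      moreover have "c (l + 1) \<noteq> w l" using w(2)[of l] by (metis DiffD2 rangeI)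
      ultimately show False using nosq w(1) cyc_step[OF c] by blast
    qed
    have "hi dvd j - i - 1 \<or> hi dvd j - i + 1 \<or> hi dvd j - i - 3 \<or> hi dvd j - i + 3"
      using cyc_walk_3[OF c w(1) a] adj_sym[OF w(1)] by blast
    moreover have "\<not> hi dvd j - i - 1"
    proof
      assume "hi dvd j - i - 1"
      then have "w (i + 1) = w j" by (simp add: weq algebra_simps)
      then show False using sq a by metis
    qed
    moreover have "\<not> hi dvd j - i + 1"
    proof
      assume "hi dvd j - i + 1"
      then have "w i = w (j + 1)" by (simp add: weq dvd_diff_commute algebra_simps)
      then show False using sq a adj_sym by metis
    qed
    ultimately show ?thesis by blast
  qed
  have nbw: "w i \<sim> w (i + 3) \<and> w i \<sim> w (i - 3) \<and> w (i + 3) \<noteq> w (i - 3)" for i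
  proof -
    have "nbrs (w i) - {c i} \<subseteq> {w (i + 3), w (i - 3)}"
    proof
      fix x assume x: "x \<in> nbrs (w i) - {c i}"
      then have xa: "w i \<sim> x" by (simp add: nbrs_def)
      have "x \<notin> range c"
      proof
        assume "x \<in> range c"
        then obtain j where "x = c j" by blast
        then show False using xa x adj_sym cw eq by (metis Diff_iff insertI1 dvd_diff_commute)
      qed
      then obtain j where j: "x = w j" using Vw xa adj_verts by blast
      then have "hi dvd j - (i + 3) \<or> hi dvd j - (i - 3)" using ww xa by (simp add: algebra_simps)
      then have "w (i + 3) = w j \<or> w (i - 3) = w j" using weq by blast
      then show "x \<in> {w (i + 3), w (i - 3)}" using j by auto
    qed
    moreover have "card (nbrs (w i) - {c i}) = 2"
      using card_nbrs[of "w i"] w(1,2)[of i] adj_sym cubic by (simp add: nbrs_def card_Diff_singleton)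
    ultimately have e: "nbrs (w i) - {c i} = {w (i + 3), w (i - 3)}" "card {w (i + 3), w (i - 3)} = 2"
      using card_seteq[of "{w (i + 3), w (i - 3)}" "nbrs (w i) - {c i}"]
      by (auto simp: card_insert_if split: if_splits)
    then show ?thesis by (cases "w (i + 3) = w (i - 3)") (auto simp: nbrs_def)
  qed
  have ww': "w i \<sim> w j \<longleftrightarrow> hi dvd j - i - 3 \<or> hi dvd j - i + 3" for i j
  proof
    assume "hi dvd j - i - 3 \<or> hi dvd j - i + 3"
    then have "w (i + 3) = w j \<or> w (i - 3) = w j" by (simp add: weq algebra_simps)
    then show "w i \<sim> w j" using nbw by metis
  qed (rule ww)
  have "h = 5"
  proof (rule ccontr)
    assume "h \<noteq> 5"
    moreover have "h \<noteq> 3" using nbw[of 0] weq[of 3 "-3"] by auto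
    ultimately have h7: "h \<ge> 7" using h_ge_3 odd_h by presburger
    have "w 0 \<sim> w 3" "w 3 \<sim> w 6" using nbw[of 0] nbw[of 3] by auto
    then have "walk (1 + (1 + (1 + 1))) (c 0) (c 6)"
      using w(1)[of 0] adj_sym[OF w(1)[of 6]] by (blast intro: walk_add walk_1)
    then obtain s where s: "s < h" "hi dvd 6 - 0 - int s"
        "even (1 + (1 + (1 + 1)) + s) \<and> s \<le> 1 + (1 + (1 + 1)) \<or> odd (1 + (1 + (1 + 1)) + s) \<and> h \<le> 1 + (1 + (1 + 1)) + s"
      by (rule cyc_dist[OF c])
    have "6 - int s = 0"
    proof (rule ccontr)
      assume "6 - int s \<noteq> 0"
      then show False using small_not_dvd[OF c, of "6 - int s"] s(1,2) h7 by auto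
    qed
    then show False using s(3) by simp
  qed
  moreover have "c i \<noteq> w j" for i j using w(2)[of j] by (metis DiffD2 rangeI)
  moreover have "V = range c \<union> range w" using Vw cyc_V[OF c] by blast
  ultimately show ?thesis using c cw ww' weq by blast
qed

text \<open>It remains to exclude that each vertex lies on exactly one square. Then the squares partition the
vertices, so four divides their number. A count of the vertices off the shortest odd cycle, however,
gives \<open>card V = 2 * h\<close> with \<open>h\<close> odd.\<close>

context
  assumes no_rung: "\<And>x. x \<in> V \<Longrightarrow> \<not> has_rung x"
begin

text \<open>Two square pairs share a neighbour \<open>a\<close> of \<open>x\<close>, and this neighbour would be a rung.\<close>

lemma one_square:
  assumes "x \<sim> a" "x \<sim> b" "x \<sim> d" "a \<noteq> b" "a \<noteq> d" "b \<noteq> d" "square x a b" "square x a d"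
  shows False
proof -
  have x: "x \<in> V" using adj_verts assms by blast
  have "has_rung x"
    unfolding has_rung_def
  proof (intro exI[of _ a] conjI allI impI)
    fix y assume "x \<sim> y" "y \<noteq> a"
    then show "square x a y" using nbrs_cases[OF x, of a b d y] assms by blast
  qed (use assms in blast)
  then show False using no_rung[OF x] by blast
qed

text \<open>The unique square \<open>{x, a, b, z}\<close> at \<open>x\<close> is also the square at each of its other vertices.\<close>

lemma squares_partition:
  assumes some: "\<And>x. x \<in> V \<Longrightarrow> some_square x"
  shows "4 dvd card V"
proof -
  define sq4 where "sq4 B x \<longleftrightarrow> (\<exists>a b z. B = {x, a, b, z} \<and> x \<sim> a \<and> x \<sim> b \<and> a \<noteq> b \<and> z \<noteq> x \<and> a \<sim> z \<and> b \<sim> z)" for B x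
  have uniq: "B = B'" if B: "sq4 B x" "sq4 B' x" for B B' x
  proof -
    obtain a b z where ab: "B = {x, a, b, z}" "x \<sim> a" "x \<sim> b" "a \<noteq> b" "z \<noteq> x" "a \<sim> z" "b \<sim> z"
      using B(1) by (auto simp: sq4_def)
    obtain a' b' z' where ab': "B' = {x, a', b', z'}" "x \<sim> a'" "x \<sim> b'" "a' \<noteq> b'" "z' \<noteq> x" "a' \<sim> z'" "b' \<sim> z'"
      using B(2) by (auto simp: sq4_def)
    have s: "square x a b" "square x b a" "square x a' b'" "square x b' a'"
      using ab ab' by (auto intro: squareI)
    have x: "x \<in> V" using adj_verts ab by blast
    have "{a, b} = {a', b'}"
    proof (rule ccontr)
      assume "{a, b} \<noteq> {a', b'}"
      then consider "a' \<noteq> a" "a' \<noteq> b" | "b' \<noteq> a" "b' \<noteq> b" using ab'(4) by fastforce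
      then show False
      proof cases
        case 1
        then have "b' = a \<or> b' = b" using nbrs_cases[OF x, of a b a' b'] ab ab' by auto
        then show False using one_square[of x a b a'] one_square[of x b a a'] ab ab' s 1 by auto
      next
        case 2
        then have "a' = a \<or> a' = b" using nbrs_cases[OF x, of a b b' a'] ab ab' by auto
        then show False using one_square[of x a b b'] one_square[of x b a b'] ab ab' s 2 by auto
      qed
    qed
    moreover have "z = z'"
    proof (rule ccontr)
      assume "z \<noteq> z'"
      have "a \<sim> z'" "b \<sim> z'" using calculation ab' by (auto simp: doubleton_eq_iff)
      then have "square a x z" "square a x z'" using ab adj_sym by (auto intro: squareI)
      then show False using one_square[of a x z z'] ab ab' \<open>a \<sim> z'\<close> \<open>z \<noteq> z'\<close> adj_sym by auto
    qed
    ultimately show ?thesis using ab(1) ab'(1) by auto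
  qed
  have move: "sq4 B y" if B: "sq4 B x" "y \<in> B" for B x y
  proof -
    obtain a b z where ab: "B = {x, a, b, z}" "x \<sim> a" "x \<sim> b" "a \<noteq> b" "z \<noteq> x" "a \<sim> z" "b \<sim> z"
      using B(1) by (auto simp: sq4_def)
    have "sq4 B a" unfolding sq4_def
      by (rule exI[of _ x], rule exI[of _ z], rule exI[of _ b]) (use ab adj_sym in auto)
    moreover have "sq4 B b" unfolding sq4_def
      by (rule exI[of _ x], rule exI[of _ z], rule exI[of _ a]) (use ab adj_sym in auto)
    moreover have "sq4 B z" unfolding sq4_def
      by (rule exI[of _ a], rule exI[of _ b], rule exI[of _ x]) (use ab adj_sym in auto)
    ultimately show ?thesis using B ab(1) by auto
  qed
  define Q where "Q = {B. \<exists>x. sq4 B x}"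
  have "4 dvd card (\<Union>Q)"
  proof (rule dvd_partition)
    have sub: "\<Union>Q \<subseteq> V"
      unfolding Q_def sq4_def using adj_verts by blast
    show "finite (\<Union>Q)" using sub fin by (rule finite_subset)
    show "\<forall>B\<in>Q. 4 dvd card B"
    proof
      fix B assume "B \<in> Q"
      then obtain x a b z where ab: "B = {x, a, b, z}" "x \<sim> a" "x \<sim> b" "a \<noteq> b" "z \<noteq> x" "a \<sim> z" "b \<sim> z"
        by (auto simp: Q_def sq4_def)
      have "x \<noteq> a" "x \<noteq> b" "a \<noteq> z" "b \<noteq> z" using ab adj_irrefl by metis+
      then have "card B = 4" using ab by simp
      then show "4 dvd card B" by simp
    qed
    show "\<forall>B\<in>Q. \<forall>C\<in>Q. B \<noteq> C \<longrightarrow> B \<inter> C = {}"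
    proof (intro ballI impI, rule ccontr)
      fix B C assume BC: "B \<in> Q" "C \<in> Q" "B \<noteq> C" "B \<inter> C \<noteq> {}"
      then obtain y x x' where "y \<in> B" "y \<in> C" "sq4 B x" "sq4 C x'" by (auto simp: Q_def)
      then have "sq4 B y" "sq4 C y" using move by blast+
      then show False using uniq BC(3) by blast
    qed
  qed
  moreover have "\<Union>Q = V"
  proof
    show "\<Union>Q \<subseteq> V" unfolding Q_def sq4_def using adj_verts by blast
    show "V \<subseteq> \<Union>Q"
    proof
      fix x assume "x \<in> V"
      then have "some_square x" by (rule some)
      then obtain a b z where "x \<sim> a" "x \<sim> b" "a \<noteq> b" "z \<noteq> x" "a \<sim> z" "b \<sim> z"
        unfolding some_square_def square_def by blast
      then have "sq4 {x, a, b, z} x" unfolding sq4_def by blast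
      then show "x \<in> \<Union>Q" unfolding Q_def by blast
    qed
  qed
  ultimately show ?thesis by simp
qed

text \<open>Let \<open>v\<close> be attached to the cycle at \<open>c (i - 1)\<close> and \<open>c (i + 1)\<close>, and suppose its third
neighbour \<open>u\<close> is adjacent to \<open>c j\<close>. On the cycle with \<open>v\<close> in place of \<open>c i\<close>, the
neighbours \<open>v\<close> and \<open>c j\<close> of \<open>u\<close> are two steps apart, so \<open>c j\<close> is one of
\<open>c i\<close>, \<open>c (i + 2)\<close>, \<open>c (i - 2)\<close>. Each possibility gives a second square at \<open>v\<close>.\<close>

lemma fork_third_nbr:
  assumes c: "shortest c" and v: "v \<notin> range c" "v \<sim> c (i - 1)" "v \<sim> c (i + 1)"
    and u: "v \<sim> u" "u \<noteq> c (i - 1)" "u \<noteq> c (i + 1)"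
  shows "nbrs u \<inter> range c = {}"
proof (rule ccontr)
  assume "nbrs u \<inter> range c \<noteq> {}"
  then obtain j where j: "u \<sim> c j" by (auto simp: nbrs_def)
  have vc: "v \<noteq> c l" for l using v(1) by blast
  have d: "c (i - 1) \<noteq> c (i + 1)" by (rule nbrs_cyc(2)[OF c])
  have s1: "square v (c (i + 1)) (c (i - 1))" "square v (c (i - 1)) (c (i + 1))"
    using cyc_step[OF c, of "i + 1"] cyc_step[OF c, of "i - 1"] vc[of i] by (auto intro: squareI[of _ "c i"])
  have "c j \<in> {c i, c (i + 2), c (i - 2)}"
  proof (rule ccontr)
    assume no: "c j \<notin> {c i, c (i + 2), c (i - 2)}"
    let ?c = "\<lambda>l. if hi dvd l - i then v else c l"
    have sc: "shortest ?c" by (rule swap_shortest[OF c v(2,3)])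
    have "\<not> hi dvd j - i" using no cyc_eq[OF c, of i j] by auto
    then have e: "?c i = v" "?c j = c j" "?c (i + 2) = c (i + 2)" "?c (i - 2) = c (i - 2)"
      using not_dvd_2_4 by auto
    have "u \<sim> ?c i" "u \<sim> ?c j" "?c i \<noteq> ?c j" unfolding e using u(1) j adj_sym vc by auto
    then have "?c j = ?c (i + 2) \<or> ?c j = ?c (i - 2)" by (rule cyc_two_nbrs[OF sc])
    then show False unfolding e using no by blast
  qed
  then consider "c j = c i" | "c j = c (i + 2)" | "c j = c (i - 2)" by blast
  then show False
  proof cases
    case 1
    then have "square v (c (i + 1)) u" using j cyc_step[OF c, of "i + 1"] vc[of i] by (intro squareI[of _ "c i"]) auto
    then show False using one_square[of v "c (i + 1)" "c (i - 1)" u] v u d s1 by auto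
  next
    case 2
    have "c (i + 1) \<sim> c (i + 2)" using cyc_step(1)[OF c, of "i + 1"] by (simp add: add.commute)
    then have "square v (c (i + 1)) u" using j 2 vc[of "i + 2"] by (intro squareI[of _ "c (i + 2)"]) auto
    then show False using one_square[of v "c (i + 1)" "c (i - 1)" u] v u d s1 by auto
  next
    case 3
    have "c (i - 1) \<sim> c (i - 2)" using cyc_step(2)[OF c, of "i - 1"] by simp
    then have "square v (c (i - 1)) u" using j 3 vc[of "i - 2"] by (intro squareI[of _ "c (i - 2)"]) auto
    then show False using one_square[of v "c (i - 1)" "c (i + 1)" u] v u d s1 by auto
  qed
qed

text \<open>Let \<open>F\<close> and \<open>Z\<close> be the sets of vertices off the cycle with two neighbours and with no neighbour
on it. Counting the \<open>h\<close> edges that leave the cycle gives \<open>h + card Z = card ?R + card F\<close>. The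
third neighbour \<open>u v\<close> of \<open>v \<in> F\<close> belongs to \<open>Z\<close>. The map \<open>u\<close> is injective: if
\<open>u v1 = u v2\<close>, then on the cycle with \<open>v1\<close> in place of \<open>c (I v1)\<close> the third neighbour of
\<open>v2\<close> has the neighbour \<open>v1\<close>. So \<open>card F \<le> card Z\<close>, and \<open>h \<le> card ?R\<close>.\<close>

lemma one_square_order: "card V = 2 * h"
proof -
  obtain c where c: "shortest c" using shortest_exists by blast
  note eq = cyc_eq[OF c]
  let ?R = "V - range c" and ?d = "\<lambda>v. card (nbrs v \<inter> range c)"
  define F where "F = {v \<in> ?R. ?d v = 2}"
  define Z where "Z = {v \<in> ?R. ?d v = 0}"
  have finR: "finite ?R" using fin by simp
  have fork: "\<exists>i u. v \<sim> c (i - 1) \<and> v \<sim> c (i + 1) \<and> v \<sim> u \<and> u \<noteq> c (i - 1) \<and> u \<noteq> c (i + 1)" if "v \<in> F" for v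
  proof -
    have v: "v \<in> ?R" "?d v = 2" using that by (auto simp: F_def)
    obtain i where i: "nbrs v \<inter> range c = {c (i - 1), c (i + 1)}" using two_nbrs_between[OF c v(2)] by blast
    then have "v \<sim> c (i - 1)" "v \<sim> c (i + 1)" by (auto simp: nbrs_def)
    moreover then obtain u where "v \<sim> u" "u \<noteq> c (i - 1)" "u \<noteq> c (i + 1)"
      using third_nbr[of v] v(1) nbrs_cyc(2)[OF c] by blast
    ultimately show ?thesis by blast
  qed
  then obtain I u where Iu: "\<And>v. v \<in> F \<Longrightarrow> v \<sim> c (I v - 1)" "\<And>v. v \<in> F \<Longrightarrow> v \<sim> c (I v + 1)"
      "\<And>v. v \<in> F \<Longrightarrow> v \<sim> u v" "\<And>v. v \<in> F \<Longrightarrow> u v \<noteq> c (I v - 1)" "\<And>v. v \<in> F \<Longrightarrow> u v \<noteq> c (I v + 1)"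
    by metis
  have out: "v \<notin> range c" if "v \<in> F" for v using that by (simp add: F_def)
  have uR: "u v \<notin> range c" if v: "v \<in> F" for v
  proof
    assume "u v \<in> range c"
    then obtain l where "u v = c l" by blast
    then show False
      using three_nbrs_absurd[OF c, of v "I v - 1" "I v + 1" l] Iu[OF v] nbrs_cyc(2)[OF c, of "I v"] by auto
  qed
  have uZ: "u v \<in> Z" if v: "v \<in> F" for v
    using fork_third_nbr[OF c out[OF v] Iu[OF v]] uR[OF v] adj_verts[OF Iu(3)[OF v]] by (auto simp: Z_def)
  have "inj_on u F"
  proof (rule inj_onI, rule ccontr)
    fix v1 v2 assume v: "v1 \<in> F" "v2 \<in> F" "u v1 = u v2" "v1 \<noteq> v2"
    let ?i = "I v1" and ?j = "I v2"
    let ?c = "\<lambda>l. if hi dvd l - ?i then v1 else c l"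
    have sc: "shortest ?c" by (rule swap_shortest[OF c Iu(1,2)[OF v(1)]])
    have s1: "square (c ?i) (c (?i + 1)) (c (?i - 1))" "square (c ?i) (c (?i - 1)) (c (?i + 1))"
      using Iu(1,2)[OF v(1)] out[OF v(1)] adj_sym by (auto intro: squareI[of _ v1])
    have d: "c (?i - 1) \<noteq> c (?i + 1)" by (rule nbrs_cyc(2)[OF c])
    have vc: "v2 \<noteq> c l" for l using out[OF v(2)] by blast
    have n1: "\<not> hi dvd (?j - 1) - ?i"
    proof
      assume "hi dvd (?j - 1) - ?i"
      then have e: "c ?i = c (?j - 1)" "c (?i + 1) = c ?j" "c (?i + 2) = c (?j + 1)"
        by (simp_all add: eq algebra_simps)
      have "c ?i \<noteq> c (?i + 2)" using not_dvd_2_4 by (simp add: eq)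
      moreover have "c (?i + 1) \<sim> c (?i + 2)" using cyc_step(1)[OF c, of "?i + 1"] by (simp add: add.commute)
      ultimately have "square (c ?i) (c (?i + 1)) v2"
        using Iu(2)[OF v(2)] e by (intro squareI[of _ "c (?i + 2)"]) auto
      moreover have "c ?i \<sim> v2" using Iu(1)[OF v(2)] e adj_sym by auto
      ultimately show False
        using one_square[of "c ?i" "c (?i + 1)" "c (?i - 1)" v2] s1 cyc_step[OF c, of ?i] d vc by metis
    qed
    have n2: "\<not> hi dvd (?j + 1) - ?i"
    proof
      assume "hi dvd (?j + 1) - ?i"
      then have e: "c ?i = c (?j + 1)" "c (?i - 1) = c ?j" "c (?i - 2) = c (?j - 1)"
        by (simp_all add: eq algebra_simps)
      have "c (?i - 2) \<noteq> c ?i" using not_dvd_2_4 by (simp add: eq)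
      moreover have "c (?i - 1) \<sim> c (?i - 2)" using cyc_step(2)[OF c, of "?i - 1"] by simp
      ultimately have "square (c ?i) (c (?i - 1)) v2"
        using Iu(1)[OF v(2)] e by (intro squareI[of _ "c (?i - 2)"]) auto
      moreover have "c ?i \<sim> v2" using Iu(2)[OF v(2)] e adj_sym by auto
      ultimately show False
        using one_square[of "c ?i" "c (?i - 1)" "c (?i + 1)" v2] s1 cyc_step[OF c, of ?i] d vc by metis
    qed
    have e: "?c (?j - 1) = c (?j - 1)" "?c (?j + 1) = c (?j + 1)" "?c ?i = v1" using n1 n2 by auto
    have "v2 \<notin> range ?c" using v(4) out[OF v(2)] by auto
    moreover have "v2 \<sim> ?c (?j - 1)" "v2 \<sim> ?c (?j + 1)" "u v2 \<noteq> ?c (?j - 1)" "u v2 \<noteq> ?c (?j + 1)"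
      unfolding e using Iu[OF v(2)] by auto
    ultimately have "nbrs (u v2) \<inter> range ?c = {}" by (intro fork_third_nbr[OF sc _ _ _ Iu(3)[OF v(2)]])
    moreover have "?c ?i \<in> nbrs (u v2)" unfolding e using Iu(3)[OF v(1)] v(3) adj_sym by (simp add: nbrs_def)
    ultimately show False by blast
  qed
  moreover have "finite Z" using fin by (simp add: Z_def)
  ultimately have FZ: "card F \<le> card Z" using uZ by (intro card_inj_on_le[of u]) auto
  have count: "card {v \<in> ?R. P v} = (\<Sum>v\<in>?R. if P v then 1 else 0)" for P
    using finR by (simp add: sum.If_cases Int_def)
  have "(\<Sum>v\<in>?R. ?d v) + card Z = card ?R + card F"
  proof -
    have "(\<Sum>v\<in>?R. ?d v) + card Z = (\<Sum>v\<in>?R. ?d v + (if ?d v = 0 then 1 else 0))"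
      unfolding Z_def count by (simp add: sum.distrib)
    also have "\<dots> = (\<Sum>v\<in>?R. 1 + (if ?d v = 2 then 1 else 0))"
    proof (rule sum.cong[OF refl])
      fix v
      have "?d v = 0 \<or> ?d v = 1 \<or> ?d v = 2" using cyc_nbrs_le_2[OF c, of v] by linarith
      then show "?d v + (if ?d v = 0 then 1 else 0) = 1 + (if ?d v = 2 then 1 else 0)" by auto
    qed
    also have "\<dots> = card ?R + card F" unfolding F_def count by (simp only: sum.distrib card_eq_sum)
    finally show ?thesis .
  qed
  then have "h \<le> card ?R" using outside_sum[OF c] cubic FZ by simp
  then show ?thesis using order_le[OF c] card_outside[OF c] h_ge_3 by linarith
qed

end

lemma petersen_explicit:
  assumes "\<forall>x\<in>V. \<not> some_square x"
  shows "isomorphic G petersen_graph"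
proof -
  obtain c w where c: "shortest c" and h: "h = 5" and V: "V = range c \<union> range w"
    and all: "\<forall>i j. c i \<sim> w j \<longleftrightarrow> hi dvd j - i"
      "\<forall>i j. w i \<sim> w j \<longleftrightarrow> hi dvd j - i - 3 \<or> hi dvd j - i + 3"
      "\<forall>i j. w i = w j \<longleftrightarrow> hi dvd j - i" "\<forall>i j. c i \<noteq> w j"
    using no_squares_petersen_structure[OF assms] by (elim exE conjE) (rule that)
  note cw = all(1)[rule_format] and ww = all(2)[rule_format] and weq = all(3)[rule_format]
    and ne = all(4)[rule_format]
  let ?I = "{0..<10::nat}"
  define e where "e i = (if i < 5 then c (int i) else w (int i))" for i
  have r: "range c = c ` {0..<5}" "card (range c) = 5" "range w = w ` {0..<5}" "card (range w) = 5"
    using card_range_periodic[of 5 c] card_range_periodic[of 5 w] cyc_eq[OF c] weq h by auto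
  have fins: "finite (range c)" "finite (range w)" using V fin by (auto intro: finite_subset[of _ V])
  have "range c \<inter> range w = {}"
  proof (rule equals0I)
    fix x assume "x \<in> range c \<inter> range w"
    then obtain i j where "x = c i" "x = w j" by blast
    then show False using ne by metis
  qed
  then have cardV: "card V = 10" unfolding V using r(2,4) fins by (simp add: card_Un_disjoint)
  have "V \<subseteq> e ` ?I"
  proof
    fix x assume "x \<in> V"
    then have "x \<in> range c \<or> x \<in> range w" by (simp add: V)
    then have "x \<in> c ` {0..<5} \<or> x \<in> w ` {0..<5}" by (simp only: r(1,3))
    then consider i where "x = c i" "0 \<le> i" "i < 5" | i where "x = w i" "0 \<le> i" "i < 5" by auto
    then show "x \<in> e ` ?I"
    proof cases
      case (1 i)
      then have "x = e (nat i)" "nat i \<in> ?I" by (auto simp: e_def)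
      then show ?thesis by blast
    next
      case (2 i)
      then have "x = e (nat i + 5)" "nat i + 5 \<in> ?I" using weq[of i "i + 5"] h by (auto simp: e_def)
      then show ?thesis by blast
    qed
  qed
  moreover have "card (e ` ?I) \<le> 10" using card_image_le[of ?I e] by simp
  ultimately have eV: "V = e ` ?I" using card_seteq[of "e ` ?I" V] cardV by simp
  have bij_e: "bij_betw e ?I V"
    unfolding bij_betw_def using eV cardV by (auto intro: eq_card_imp_inj_on)
  have adj: "e i \<sim> e j \<longleftrightarrow> adj petersen_graph (petersen_vertex i) (petersen_vertex j)"
    if ij: "i \<in> ?I" "j \<in> ?I" for i j
  proof -
    have "e i \<sim> e j \<longleftrightarrow> petersen_index_adj i j"
      using cyc_adj[OF c, of "int i" "int j"] cw[of "int i" "int j"] cw[of "int j" "int i"]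
        ww[of "int i" "int j"] adj_commute[of "w (int i)" "c (int j)"]
        dvd_diff_commute[of 5 "int i" "int j"] h
      by (auto simp: e_def petersen_index_adj_def)
    then show ?thesis using petersen_vertex_adj ij by simp
  qed
  show ?thesis by (rule isomorphic_by_index[OF bij_e petersen_vertex_bij adj])
qed

lemma cubic_classification:
  "(\<exists>n::nat\<ge>1. isomorphic G (cayley_Z (4 * n) {1, 4 * int n - 1, 2 * int n}))
    \<or> (\<exists>n::nat\<ge>1. isomorphic G (cayley_Z (4 * n + 2) {2, 4 * int n, 2 * int n + 1}))
    \<or> isomorphic G petersen_graph"
proof -
  obtain x where x: "x \<in> V" using V_nonempty by blast
  consider "has_rung x" | "\<not> has_rung x" "some_square x" | "\<not> some_square x" by blast
  then show ?thesis
  proof cases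
    case 1
    then show ?thesis using rungs_ladder has_rung_transfer x by blast
  next
    case 2
    then have all: "\<And>y. y \<in> V \<Longrightarrow> \<not> has_rung y" "\<And>y. y \<in> V \<Longrightarrow> some_square y"
      using has_rung_transfer some_square_transfer x by blast+
    have "4 dvd 2 * h" using squares_partition[OF all] one_square_order[OF all(1)] by simp
    then show ?thesis using odd_h by presburger
  next
    case 3
    then show ?thesis using petersen_explicit some_square_transfer x by blast
  qed
qed

end

section \<open>Non-trivial preclusion sets\<close>

context vertex_transitive_graph
begin

lemma star_preclusion:
  assumes v: "v \<in> V"
  shows "matching_preclusion_set G (incident_edges G v)" "card (incident_edges G v) = k"
proof -
  show "card (incident_edges G v) = k" using regular v by (simp add: regular_graph_def)
  have "\<not> perfect_matching (delete_edges G (incident_edges G v)) M" for M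
    using v unfolding perfect_matching_def delete_edges_def incident_edges_def by fastforce
  then show "matching_preclusion_set G (incident_edges G v)"
    by (auto simp: matching_preclusion_set_def incident_edges_def)
qed

lemma mp_le: "matching_preclusion_set G S \<Longrightarrow> mp G \<le> card S"
  unfolding mp_def by (rule Least_le) blast

lemma mp_le_degree: "mp G \<le> k"
proof -
  obtain v where "v \<in> V" using V_nonempty by blast
  then show ?thesis using mp_le star_preclusion by fastforce
qed

lemma optimal_exists: "\<exists>S. optimal_solution G S"
proof -
  obtain v where "v \<in> V" using V_nonempty by blast
  then have "\<exists>n S. matching_preclusion_set G S \<and> card S = n" using star_preclusion(1) by blast
  then have "\<exists>S. matching_preclusion_set G S \<and> card S = mp G" unfolding mp_def by (rule LeastI_ex)
  then show ?thesis by (simp add: optimal_solution_def)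
qed

text \<open>If all optimal solutions are stars, then the optimum is \<open>k\<close>, and a preclusion set with at most
\<open>k\<close> edges is optimal.\<close>

lemma not_super_matchedI:
  assumes S: "matching_preclusion_set G S" "card S \<le> k"
    and nontriv: "\<And>v. v \<in> V \<Longrightarrow> S \<noteq> incident_edges G v"
  shows "\<not> super_matched G"
proof
  assume sm: "super_matched G"
  obtain S' where S': "optimal_solution G S'" using optimal_exists by blast
  then have "mp G = k"
    using sm star_preclusion(2) by (auto simp: super_matched_def trivial_solution_def optimal_solution_def)
  then have "optimal_solution G S" using S mp_le[OF S(1)] by (simp add: optimal_solution_def)
  then show False using sm nontriv by (auto simp: super_matched_def trivial_solution_def)
qed

text \<open>Without the edges inside \<open>W\<close>, a perfect matching would inject \<open>W\<close> into its smaller complement.\<close>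

lemma large_part_not_super_matched:
  assumes k: "k \<ge> 1" and W: "W \<subseteq> V" "card (V - W) < card W"
    and T: "finite T" "card T \<le> k" "\<And>x y. x \<in> W \<Longrightarrow> y \<in> W \<Longrightarrow> x \<sim> y \<Longrightarrow> {x, y} \<in> T"
    and out: "\<And>v. v \<in> W \<Longrightarrow> \<exists>y\<in>V - W. v \<sim> y"
  shows "\<not> super_matched G"
proof (rule not_super_matchedI)
  define S where "S = {e \<in> edges G. e \<subseteq> W}"
  show "matching_preclusion_set G S"
    unfolding matching_preclusion_set_def
  proof (intro conjI notI)
    show "S \<subseteq> edges G" by (auto simp: S_def)
    assume "\<exists>M. perfect_matching (delete_edges G S) M"
    then obtain M where M: "M \<subseteq> edges G - S" "pairwise disjnt M" "\<Union>M = V"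
      by (auto simp: perfect_matching_def delete_edges_def)
    have "\<exists>u. u \<in> V - W \<and> {w, u} \<in> M" if w: "w \<in> W" for w
    proof -
      obtain e where e: "e \<in> M" "w \<in> e" using M(3) W(1) w by blast
      then have "e \<in> edges G" using M(1) by blast
      then obtain x y where xy: "e = {x, y}" "x \<sim> y" by (rule edge_pair)
      then obtain u where u: "e = {w, u}" using e(2) by (auto simp: insert_commute)
      then have "u \<notin> W" using e M(1) w by (auto simp: S_def)
      moreover have "u \<in> V" using e M(3) u by blast
      ultimately show ?thesis using e u by blast
    qed
    then obtain m where m: "\<And>w. w \<in> W \<Longrightarrow> m w \<in> V - W" "\<And>w. w \<in> W \<Longrightarrow> {w, m w} \<in> M" by metis
    have "inj_on m W"
    proof (rule inj_onI)
      fix a b assume ab: "a \<in> W" "b \<in> W" "m a = m b"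
      have "\<not> disjnt {a, m a} {b, m b}" using ab(3) by (simp add: disjnt_def)
      then have "{a, m a} = {b, m b}"
        using pairwiseD[OF M(2) m(2)[OF ab(1)] m(2)[OF ab(2)]] by metis
      then show "a = b" using ab by (auto simp: doubleton_eq_iff)
    qed
    then have "card W \<le> card (V - W)" using m(1) fin by (intro card_inj_on_le[of m]) auto
    then show False using W(2) by simp
  qed
  have "S \<subseteq> T"
  proof
    fix e assume e: "e \<in> S"
    then have "e \<in> edges G" by (simp add: S_def)
    then obtain x y where "e = {x, y}" "x \<sim> y" by (rule edge_pair)
    then show "e \<in> T" using T(3) e by (auto simp: S_def)
  qed
  then have "card S \<le> card T" by (rule card_mono[OF T(1)])
  then show "card S \<le> k" using T(2) by simp
  fix v assume v: "v \<in> V"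
  show "S \<noteq> incident_edges G v"
  proof
    assume eq: "S = incident_edges G v"
    have "incident_edges G v \<noteq> {}" using star_preclusion(2)[OF v] k by auto
    then obtain e where "e \<in> incident_edges G v" by blast
    then have "v \<in> W" using eq by (auto simp: S_def incident_edges_def)
    then obtain y where y: "y \<in> V - W" "v \<sim> y" using out by blast
    then have "{v, y} \<in> S" unfolding eq by (simp add: incident_edges_def adj_def)
    then show False using y by (simp add: S_def)
  qed
qed

text \<open>Without the edges that leave \<open>X\<close>, a perfect matching would pair up the vertices of the odd set
\<open>X\<close> among themselves.\<close>

lemma odd_part_not_super_matched:
  assumes X: "X \<subseteq> V" "odd (card X)"
    and T: "finite T" "card T \<le> k" "\<And>x y. x \<in> X \<Longrightarrow> y \<notin> X \<Longrightarrow> x \<sim> y \<Longrightarrow> {x, y} \<in> T"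
    and out: "\<And>v. v \<in> V \<Longrightarrow> \<exists>x y. x \<in> X \<and> y \<notin> X \<and> x \<sim> y \<and> x \<noteq> v \<and> y \<noteq> v"
  shows "\<not> super_matched G"
proof (rule not_super_matchedI)
  define S where "S = {e \<in> edges G. e \<inter> X \<noteq> {} \<and> \<not> e \<subseteq> X}"
  show "matching_preclusion_set G S"
    unfolding matching_preclusion_set_def
  proof (intro conjI notI)
    show "S \<subseteq> edges G" by (auto simp: S_def)
    assume "\<exists>M. perfect_matching (delete_edges G S) M"
    then obtain M where M: "M \<subseteq> edges G - S" "pairwise disjnt M" "\<Union>M = V"
      by (auto simp: perfect_matching_def delete_edges_def)
    define N where "N = {e \<in> M. e \<subseteq> X}"
    have XN: "X = \<Union>N"
    proof
      show "X \<subseteq> \<Union>N"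
      proof
        fix x assume x: "x \<in> X"
        then obtain e where e: "e \<in> M" "x \<in> e" using M(3) X(1) by blast
        then have "e \<subseteq> X" using M(1) x by (auto simp: S_def)
        then show "x \<in> \<Union>N" using e by (auto simp: N_def)
      qed
    qed (auto simp: N_def)
    have "2 dvd card (\<Union>N)"
    proof (rule dvd_partition)
      show "finite (\<Union>N)" using XN X(1) fin finite_subset by metis
      show "\<forall>e\<in>N. 2 dvd card e" using M(1) simple by (auto simp: N_def simple_graph_def)
      show "\<forall>c1\<in>N. \<forall>c2\<in>N. c1 \<noteq> c2 \<longrightarrow> c1 \<inter> c2 = {}"
        using M(2) unfolding N_def pairwise_def disjnt_def by simp
    qed
    then show False using X(2) XN by simp
  qed
  have "S \<subseteq> T"
  proof
    fix e assume e: "e \<in> S"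
    then have "e \<in> edges G" by (simp add: S_def)
    then obtain x y where xy: "e = {x, y}" "x \<sim> y" by (rule edge_pair)
    then have "x \<in> X \<and> y \<notin> X \<or> y \<in> X \<and> x \<notin> X" using e by (auto simp: S_def)
    then show "e \<in> T" using T(3)[of x y] T(3)[of y x] xy adj_sym by (auto simp: insert_commute)
  qed
  then have "card S \<le> card T" by (rule card_mono[OF T(1)])
  then show "card S \<le> k" using T(2) by simp
  fix v assume v: "v \<in> V"
  show "S \<noteq> incident_edges G v"
  proof
    assume eq: "S = incident_edges G v"
    obtain x y where xy: "x \<in> X" "y \<notin> X" "x \<sim> y" "x \<noteq> v" "y \<noteq> v" using out[OF v] by blast
    then have "{x, y} \<in> S" by (auto simp: S_def adj_def)
    then show False using eq xy by (auto simp: incident_edges_def)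
  qed
qed

lemma degree_1_order:
  assumes "k = 1"
  shows "card V = 2"
proof -
  obtain x where x: "x \<in> V" using V_nonempty by blast
  have "card (nbrs x) = 1" using card_nbrs[OF x] assms by simp
  then obtain y where y: "nbrs x = {y}" by (auto simp: card_1_singleton_iff)
  then have xy: "x \<sim> y" by (auto simp: nbrs_def)
  have yV: "y \<in> V" using xy adj_verts by blast
  have "card (nbrs y) = 1" using card_nbrs[OF yV] assms by simp
  then obtain z where z: "nbrs y = {z}" by (auto simp: card_1_singleton_iff)
  then have "nbrs y = {x}" using adj_sym[OF xy] by (auto simp: nbrs_def)
  then have "{x, y} = V" using y x yV by (intro connected_closed) (auto simp: nbrs_def)
  moreover have "x \<noteq> y" using xy adj_irrefl by auto
  ultimately show ?thesis by (metis card_2_iff)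
qed

text \<open>Every vertex of the clique has one neighbour outside it, so \<open>k\<close> edges leave the clique. If all of them
ended in the same vertex, this vertex and the clique would form the whole graph.\<close>

lemma odd_clique_not_super_matched:
  assumes k: "odd k" "k + 2 \<le> card V" and C: "clique G C" "card C = k"
  shows "\<not> super_matched G"
proof (rule odd_part_not_super_matched)
  show CV: "C \<subseteq> V" and "odd (card C)" using C k by (auto simp: clique_def)
  have finC: "finite C" using CV fin by (rule finite_subset)
  have "k \<noteq> 1" using k degree_1_order by auto
  then have k3: "k \<ge> 3" using k(1) by presburger
  have inn: "C - {x} \<subseteq> nbrs x" if "x \<in> C" for x
    using C(1) that by (auto simp: clique_def pairwise_def nbrs_def)
  have one: "card (nbrs x - C) = 1" if x: "x \<in> C" for x
  proof -
    have "nbrs x \<inter> C = C - {x}" using inn[OF x] adj_irrefl by (auto simp: nbrs_def)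
    then have "card (nbrs x \<inter> C) = k - 1" using C(2) x finC by simp
    then show ?thesis
      using card_Diff_subset_Int[of "nbrs x" C] fin_nbrs card_nbrs[of x] x CV k3 by auto
  qed
  then have "cut_size C = k" using cut_size_sum[OF CV] C(2) by simp
  define T where "T = (\<lambda>(x, y). {x, y}) ` boundary C"
  show "finite T" using finite_boundary by (simp add: T_def)
  show "card T \<le> k"
    using card_image_le[OF finite_boundary, of "\<lambda>(x, y). {x, y}" C] \<open>cut_size C = k\<close>
    by (simp add: T_def cut_size_def)
  show "{x, y} \<in> T" if "x \<in> C" "y \<notin> C" "x \<sim> y" for x y
    using that by (auto simp: T_def boundary_def intro!: image_eqI[of _ _ "(x, y)"])
  have ex: "\<exists>y. y \<notin> C \<and> x \<sim> y" if x: "x \<in> C" for x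
  proof -
    obtain y where "nbrs x - C = {y}" using one[OF x] by (auto simp: card_1_singleton_iff)
    then show ?thesis by (auto simp: nbrs_def)
  qed
  fix v assume v: "v \<in> V"
  show "\<exists>x y. x \<in> C \<and> y \<notin> C \<and> x \<sim> y \<and> x \<noteq> v \<and> y \<noteq> v"
  proof (cases "v \<in> C")
    case True
    have "\<not> C \<subseteq> {v}" using card_mono[of "{v}" C] C(2) k3 by auto
    then obtain x where x: "x \<in> C" "x \<noteq> v" by blast
    then show ?thesis using ex[OF x(1)] True by blast
  next
    case False
    show ?thesis
    proof (rule ccontr)
      assume no: "\<not> ?thesis"
      then have only: "y = v" if "x \<in> C" "y \<notin> C" "x \<sim> y" for x y using that False by blast
      have "C \<subseteq> nbrs v"
      proof
        fix x assume x: "x \<in> C"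
        then obtain y where "y \<notin> C" "x \<sim> y" using ex by blast
        then show "x \<in> nbrs v" using only x adj_sym by (auto simp: nbrs_def)
      qed
      then have nv: "nbrs v = C" using card_nbrs[OF v] C(2) fin_nbrs by (metis card_subset_eq)
      have "insert v C = V"
        using CV v only nv by (intro connected_closed) (auto simp: nbrs_def)
      then have "card V = k + 1" using finC False C(2) by (metis Suc_eq_plus1 card_insert_disjoint)
      then show False using k(2) by simp
    qed
  qed
qed

end

lemma isomorphic_index:
  assumes "isomorphic G H"
  obtains e where "bij_betw e (verts H) (verts G)"
    "\<And>i j. i \<in> verts H \<Longrightarrow> j \<in> verts H \<Longrightarrow> adj G (e i) (e j) \<longleftrightarrow> adj H i j"
proof -
  obtain f where f: "bij_betw f (verts G) (verts H)"
    "\<And>x y. x \<in> verts G \<Longrightarrow> y \<in> verts G \<Longrightarrow> adj G x y \<longleftrightarrow> adj H (f x) (f y)"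
    using assms by (auto simp: isomorphic_def graph_isomorphism_def)
  define e where "e = inv_into (verts G) f"
  have e: "bij_betw e (verts H) (verts G)" unfolding e_def by (rule bij_betw_inv_into[OF f(1)])
  have "f (e i) = i" "e i \<in> verts G" if "i \<in> verts H" for i
    using that f(1) by (auto simp: e_def bij_betw_def f_inv_into_f inv_into_into)
  then show ?thesis using that[OF e] f(2) by metis
qed

text \<open>A graph whose vertices are enumerated by \<open>I\<close>, so that the exceptional graphs can be treated in
their own coordinates.\<close>

locale indexed_graph = vertex_transitive_graph G k for G :: "'a ugraph" and k +
  fixes I :: "'i set" and e :: "'i \<Rightarrow> 'a" and rel :: "'i \<Rightarrow> 'i \<Rightarrow> bool"
  assumes bij: "bij_betw e I V"
    and rel: "\<And>i j. i \<in> I \<Longrightarrow> j \<in> I \<Longrightarrow> e i \<sim> e j \<longleftrightarrow> rel i j"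
begin

lemma e_inj: "inj_on e I" and e_image: "e ` I = V" and finite_I: "finite I"
  using bij fin bij_betw_finite by (auto simp: bij_betw_def)

lemma index_degree:
  assumes "i \<in> I" "D \<subseteq> I" "\<And>j. j \<in> D \<Longrightarrow> rel i j"
  shows "card D \<le> k"
proof -
  have "e ` D \<subseteq> nbrs (e i)" using assms rel by (auto simp: nbrs_def)
  then have "card (e ` D) \<le> k" using card_mono[OF fin_nbrs] card_nbrs assms(1) e_image by blast
  then show ?thesis using card_image inj_on_subset[OF e_inj assms(2)] by metis
qed

lemma index_large_part:
  assumes W: "W \<subseteq> I" "card (I - W) < card W"
    and T: "finite T" "card T \<le> k"
      "\<And>i j. i \<in> W \<Longrightarrow> j \<in> W \<Longrightarrow> rel i j \<Longrightarrow> (i, j) \<in> T \<or> (j, i) \<in> T"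
    and out: "\<And>i. i \<in> W \<Longrightarrow> \<exists>j\<in>I - W. rel i j"
  shows "\<not> super_matched G"
proof (rule large_part_not_super_matched)
  let ?T = "(\<lambda>(i, j). {e i, e j}) ` T"
  have VW: "V - e ` W = e ` (I - W)" using e_image e_inj W(1) by (simp add: inj_on_image_set_diff)
  show "e ` W \<subseteq> V" using W(1) e_image by blast
  show "card (V - e ` W) < card (e ` W)"
    unfolding VW using W e_inj by (metis Diff_subset card_image inj_on_subset)
  show "finite ?T" using T(1) by simp
  show "card ?T \<le> k" using card_image_le[OF T(1), of "\<lambda>(i, j). {e i, e j}"] T(2) by linarith
  show "{x, y} \<in> ?T" if xy: "x \<in> e ` W" "y \<in> e ` W" "x \<sim> y" for x y
  proof -
    obtain i j where ij: "i \<in> W" "j \<in> W" "x = e i" "y = e j" using xy(1,2) by blast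
    then have "rel i j" using rel xy(3) W(1) by blast
    then have "(i, j) \<in> T \<or> (j, i) \<in> T" using T(3) ij by blast
    then show ?thesis using ij(3,4) by (auto simp: insert_commute intro: rev_image_eqI)
  qed
  show "\<exists>y\<in>V - e ` W. v \<sim> y" if v: "v \<in> e ` W" for v
  proof -
    obtain i where i: "i \<in> W" "v = e i" using v by blast
    then obtain j where "j \<in> I - W" "rel i j" using out by blast
    then show ?thesis unfolding VW using rel i W(1) by blast
  qed
  obtain i where "i \<in> W" using W(2) by fastforce
  then obtain j where "j \<in> I" "rel i j" using out by blast
  then show "1 \<le> k" using index_degree[of i "{j}"] \<open>i \<in> W\<close> W(1) by auto
qed

end

lemma involution_card:
  assumes "finite I" "A \<subseteq> I" "a \<in> I - A" "inj_on \<tau> (I - A)" "\<tau> ` (I - A) \<subseteq> A"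
  shows "card (I - insert a A) < card (insert a A)"
proof -
  have finA: "finite A" using assms(1,2) finite_subset by blast
  have "card (I - A) \<le> card A" using assms finA by (intro card_inj_on_le[of \<tau>]) auto
  moreover have "card (I - insert a A) < card (I - A)"
    using assms by (intro psubset_card_mono) auto
  moreover have "card (insert a A) = Suc (card A)" using assms(3) finA by simp
  ultimately show ?thesis by simp
qed

lemma dvd_small_diff:
  fixes m x y a :: int
  assumes "0 \<le> x" "x < m" "0 \<le> y" "y < m" "0 < a" "a < m"
  shows "m dvd x - y - a \<longleftrightarrow> x - y = a \<or> x - y = a - m"
proof
  assume "m dvd x - y - a"
  then obtain q where q: "x - y - a = m * q" by blast
  have "m * q < m * 1" "m * (- 2) < m * q" using assms q by linarith+
  moreover have "0 < m" using assms by simp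
  ultimately have "q < 1" "- 2 < q" by (simp_all only: mult_less_cancel_left_pos)
  then have "q = 0 \<or> q = - 1" by auto
  then show "x - y = a \<or> x - y = a - m" using q by auto
qed auto

text \<open>The rungs of the Moebius ladder join \<open>x\<close> and \<open>x + 2 * N\<close>. Colouring the ladder alternately
along the rails, with different colours at the two ends of each rung, succeeds except where the ladder is closed
up with a twist. Moving the vertex \<open>0\<close> to the other colour leaves three edges in this colour class.\<close>

lemma moebius_monochromatic:
  fixes x y N :: int
  assumes "x - y = 1 \<or> x - y = 4 * N - 1 \<or> x - y = 2 * N" "1 \<le> N" "0 \<le> y" "x < 4 * N"
    and "y = 0 \<or> (if y < 2 * N then odd y else even y)" "x = 0 \<or> (if x < 2 * N then odd x else even x)"
  shows "y = 0 \<and> x = 1 \<or> y = 0 \<and> x = 2 * N \<or> y = 2 * N - 1 \<and> x = 2 * N"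
proof -
  consider "x = y + 1" | "x = 4 * N - 1" "y = 0" | "x = y + 2 * N"
    using assms(1-4) by fastforce
  then show ?thesis using assms(2-) by cases (auto split: if_splits)
qed

text \<open>The positions \<open>0, 2, \<dots>, 2 * N\<close> of the odd cycle, of which only the first and the last are
adjacent, taken with both copies.\<close>

lemma blown_up_cycle_monochromatic:
  fixes x y N :: int
  assumes "x - y = 1 \<or> x - y = 4 * N + 1 \<or> x - y = 2 * N \<or> x - y = 2 * N + 2" "1 \<le> N" "0 \<le> y" "x < 4 * N + 2"
    and "y = 0 \<or> (if y < 2 * N + 1 then even y else odd y)" "x = 0 \<or> (if x < 2 * N + 1 then even x else odd x)"
  shows "y = 0 \<and> x = 2 * N \<or> y = 0 \<and> x = 4 * N + 1 \<or> y = 2 * N \<and> x = 2 * N + 1 \<or>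
    y = 2 * N + 1 \<and> x = 4 * N + 1"
proof -
  consider "x = y + 1" | "x = y + 4 * N + 1" | "x = y + 2 * N" | "x = y + 2 * N + 2"
    using assms(1) by fastforce
  then show ?thesis using assms(2-) by cases (auto split: if_splits)
qed

text \<open>The alternating colouring of the prism in which \<open>x\<close> and \<open>x + (2 * N + 1)\<close> have different
colours. Its only defects are the two rail edges between the first rung and the last.\<close>

definition ladder_colour :: "int \<Rightarrow> int \<Rightarrow> bool" where
  "ladder_colour N x \<longleftrightarrow> (if even x then odd (x div 2) else if x < 2 * N + 1 then odd (x div 2 + N) else even (x div 2 + N))"
lemma ladder_colour_even: "ladder_colour N (2 * r) \<longleftrightarrow> odd r" by (simp add: ladder_colour_def)
lemma ladder_colour_odd: "ladder_colour N (2 * r + 1) \<longleftrightarrow> (if r < N then odd (r + N) else even (r + N))" by (simp add: ladder_colour_def)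

lemma prism_monochromatic:
  assumes d: "x - y = 2 \<or> x - y = 4 * N \<or> x - y = 2 * N + 1" and N: "1 \<le> (N::int)" "0 \<le> y" "x < 4 * N + 2"
    and c: "y = 0 \<or> ladder_colour N y" "x = 0 \<or> ladder_colour N x"
  shows "y = 0 \<and> x = 2 \<or> y = 0 \<and> x = 2 * N + 1 \<or> y = 2 * N - 1 \<and> x = 2 * N + 1"
proof (cases "even y")
  case True
  then obtain r where r: "y = 2 * r" by blast
  have "r = 0 \<or> 1 \<le> r" using N(2) r by auto
  from d have "x = 2 * (r + 1) \<or> x = 2 * (r + 2 * N) \<or> x = 2 * (r + N) + 1" unfolding r by auto
  then show ?thesis
    using c N ladder_colour_even[of N r] ladder_colour_even[of N "r + 1"] ladder_colour_even[of N "r + 2 * N"] ladder_colour_odd[of N "r + N"] \<open>r = 0 \<or> 1 \<le> r\<close> unfolding r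
    by (elim disjE) (auto split: if_splits)
next
  case False
  then obtain r where r: "y = 2 * r + 1" by (rule oddE)
  have r0: "0 \<le> r" using N(2) r by auto
  have "y \<noteq> 0" using False by auto
  then have cy: "ladder_colour N (2 * r + 1)" using c(1) r by simp
  from d have "x = 2 * (r + 1) + 1 \<or> x = 2 * (r + 2 * N) + 1 \<or> x = 2 * (r + N + 1)" unfolding r by auto
  then show ?thesis
    using c(2) cy r0 N(1,3) ladder_colour_odd[of N r] ladder_colour_odd[of N "r + 1"] ladder_colour_odd[of N "r + 2 * N"]
      ladder_colour_even[of N "r + N + 1"] unfolding r
    by (elim disjE) (auto split: if_splits)
qed

lemma prism_flip:
  assumes "1 \<le> (N::int)" "0 \<le> x" "x < 4 * N + 2"
  shows "(if x < 2 * N + 1 then ladder_colour N (x + (2 * N + 1)) else ladder_colour N (x - (2 * N + 1))) \<longleftrightarrow> \<not> ladder_colour N x"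
proof (cases "even x")
  case True
  then obtain r where r: "x = 2 * r" by blast
  have e: "x + (2 * N + 1) = 2 * (r + N) + 1" "x - (2 * N + 1) = 2 * (r - N - 1) + 1" using r by auto
  show ?thesis unfolding e unfolding r ladder_colour_even ladder_colour_odd using assms r by auto
next
  case False
  then obtain r where r: "x = 2 * r + 1" by (rule oddE)
  have e: "x + (2 * N + 1) = 2 * (r + N + 1)" "x - (2 * N + 1) = 2 * (r - N)" using r by auto
  show ?thesis unfolding e unfolding r ladder_colour_even ladder_colour_odd using assms r by auto
qed

context vertex_transitive_graph
begin

lemma cayley_index:
  assumes iso: "isomorphic G (cayley_Z m A)"
    and sym: "\<And>a. a \<in> A \<Longrightarrow> int m - a \<in> A" and range: "\<And>a. a \<in> A \<Longrightarrow> 0 < a \<and> a < int m"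
  obtains e where "indexed_graph G k {0..<int m} e (\<lambda>x y. \<exists>a\<in>A. x - y = a \<or> x - y = a - int m)"
proof -
  have v: "verts (cayley_Z m A) = {0..<int m}" by (simp add: cayley_Z_def)
  obtain e where e: "bij_betw e {0..<int m} V"
    "\<And>i j. i \<in> {0..<int m} \<Longrightarrow> j \<in> {0..<int m} \<Longrightarrow> e i \<sim> e j \<longleftrightarrow> adj (cayley_Z m A) i j"
    using isomorphic_index[OF iso] v by metis
  have "e i \<sim> e j \<longleftrightarrow> (\<exists>a\<in>A. i - j = a \<or> i - j = a - int m)"
    if ij: "i \<in> {0..<int m}" "j \<in> {0..<int m}" for i j
  proof -
    have "\<exists>b\<in>A. [- a = b] (mod int m)" if "a \<in> A" for a
      using sym[OF that] by (intro bexI[of _ "int m - a"]) (simp_all add: cong_iff_dvd_diff)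
    then have "adj (cayley_Z m A) i j \<longleftrightarrow> (\<exists>a\<in>A. int m dvd i - j - a)"
      using cayley_Z_adj[of A m i j] ij v by (simp add: cong_iff_dvd_diff)
    also have "\<dots> \<longleftrightarrow> (\<exists>a\<in>A. i - j = a \<or> i - j = a - int m)"
      using dvd_small_diff[of i "int m" j] ij range by (intro bex_cong refl) auto
    finally show ?thesis using e(2)[OF ij] by blast
  qed
  then have "indexed_graph G k {0..<int m} e (\<lambda>x y. \<exists>a\<in>A. x - y = a \<or> x - y = a - int m)"
    using e(1) by unfold_locales auto
  then show ?thesis by (rule that)
qed

text \<open>The set \<open>insert 0 B\<close> has more than half of the vertices and spans at most as many edges, those
listed in \<open>T\<close>, as there are generators.\<close>

lemma cayley_not_super_matched:
  assumes iso: "isomorphic G (cayley_Z m A)" and m: "m > 0"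
    and sym: "\<And>a. a \<in> A \<Longrightarrow> int m - a \<in> A" and range: "\<And>a. a \<in> A \<Longrightarrow> 0 < a \<and> a < int m"
    and B: "B \<subseteq> {0..<int m}" "0 \<notin> B" "inj_on \<tau> ({0..<int m} - B)" "\<tau> ` ({0..<int m} - B) \<subseteq> B"
    and T: "finite T" "card T \<le> card A"
      "\<And>x y. x \<in> insert 0 B \<Longrightarrow> y \<in> insert 0 B \<Longrightarrow> x - y \<in> A \<Longrightarrow> (y, x) \<in> T"
    and out: "\<And>x. x \<in> insert 0 B \<Longrightarrow> \<exists>y\<in>{0..<int m} - insert 0 B. x - y \<in> A \<or> y - x \<in> A"
  shows "\<not> super_matched G"
proof -
  let ?rel = "\<lambda>x y. \<exists>a\<in>A. x - y = a \<or> x - y = a - int m"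
  obtain e where "indexed_graph G k {0..<int m} e ?rel"
    by (rule cayley_index[OF iso sym range])
  then interpret indexed_graph G k "{0..<int m}" e ?rel .
  have rel_iff: "?rel x y \<longleftrightarrow> x - y \<in> A \<or> y - x \<in> A" for x y
  proof -
    have "(\<exists>a\<in>A. x - y = a - int m) \<longleftrightarrow> y - x \<in> A"
    proof
      assume "\<exists>a\<in>A. x - y = a - int m"
      then obtain a where "a \<in> A" "y - x = int m - a" by force
      then show "y - x \<in> A" using sym by simp
    next
      assume "y - x \<in> A"
      then show "\<exists>a\<in>A. x - y = a - int m" using sym[of "y - x"] by (intro bexI[of _ "int m - (y - x)"]) auto
    qed
    then show ?thesis by blast
  qed
  show ?thesis
  proof (rule index_large_part)
    show "insert 0 B \<subseteq> {0..<int m}" using B(1) m by auto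
    show "card ({0..<int m} - insert 0 B) < card (insert 0 B)"
      using B m by (intro involution_card[of _ _ _ \<tau>]) auto
    have "card A \<le> k"
    proof (rule index_degree[of 0])
      show "0 \<in> {0..<int m}" "A \<subseteq> {0..<int m}" using m range by fastforce+
      show "?rel 0 a" if "a \<in> A" for a unfolding rel_iff using that by simp
    qed
    then show "card T \<le> k" using T(2) by simp
    show "(x, y) \<in> T \<or> (y, x) \<in> T" if "x \<in> insert 0 B" "y \<in> insert 0 B" "?rel x y" for x y
      using that T(3) unfolding rel_iff by blast
    show "\<exists>y\<in>{0..<int m} - insert 0 B. ?rel x y" if "x \<in> insert 0 B" for x
      using out[OF that] unfolding rel_iff .
  qed (rule T(1))
qed

lemma moebius_not_super_matched:
  assumes n: "n \<ge> 1" and iso: "isomorphic G (cayley_Z (4 * n) {1, 4 * int n - 1, 2 * int n})"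
  shows "\<not> super_matched G"
proof -
  define N where "N = int n"
  have N: "N \<ge> 1" and m: "int (4 * n) = 4 * N" using n by (simp_all add: N_def)
  let ?I = "{0..<4 * N}" and ?A = "{1, 4 * N - 1, 2 * N}"
  define B where "B = {x \<in> ?I. if x < 2 * N then odd x else even x}"
  define T :: "(int \<times> int) set" where "T = {(0, 1), (0, 2 * N), (2 * N - 1, 2 * N)}"
  define \<tau> where "\<tau> x = (if x < 2 * N then x + 2 * N else x - 2 * N)" for x
  show ?thesis
  proof (rule cayley_not_super_matched[where A = ?A and m = "4 * n" and B = B and T = T and \<tau> = \<tau>],
      unfold m)
    show "isomorphic G (cayley_Z (4 * n) ?A)" using iso by (simp add: N_def)
    show "inj_on \<tau> (?I - B)" by (auto simp: inj_on_def \<tau>_def split: if_splits)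
    have "4 * N - 1 \<noteq> 2 * N" using N by presburger
    moreover have "card T \<le> 3" unfolding T_def by (simp add: card_insert_if)
    ultimately show "card T \<le> card ?A" using N by simp
    show "(y, x) \<in> T" if "x \<in> insert 0 B" "y \<in> insert 0 B" "x - y \<in> ?A" for x y
      using that N moebius_monochromatic[of x y N] by (auto simp: B_def T_def)
    fix x assume x: "x \<in> insert 0 B"
    define y where "y = (if x = 0 then 4 * N - 1 else if x = 2 * N then x + 1 else \<tau> x)"
    have "y \<in> ?I - insert 0 B" "x - y \<in> ?A \<or> y - x \<in> ?A"
      using x N by (auto simp: y_def \<tau>_def B_def split: if_splits)
    then show "\<exists>y\<in>?I - insert 0 B. x - y \<in> ?A \<or> y - x \<in> ?A" by blast
  qed (use n N in \<open>auto simp: B_def T_def \<tau>_def\<close>)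
qed

lemma prism_not_super_matched:
  assumes n: "n \<ge> 1" and iso: "isomorphic G (cayley_Z (4 * n + 2) {2, 4 * int n, 2 * int n + 1})"
  shows "\<not> super_matched G"
proof -
  define N where "N = int n"
  have N: "N \<ge> 1" and m: "int (4 * n + 2) = 4 * N + 2" using n by (simp_all add: N_def)
  let ?I = "{0..<4 * N + 2}" and ?A = "{2, 4 * N, 2 * N + 1}"
  define B where "B = {x \<in> ?I. ladder_colour N x}"
  define T :: "(int \<times> int) set" where "T = {(0, 2), (0, 2 * N + 1), (2 * N - 1, 2 * N + 1)}"
  define \<tau> where "\<tau> x = (if x < 2 * N + 1 then x + (2 * N + 1) else x - (2 * N + 1))" for x
  have flip: "ladder_colour N (\<tau> x) \<longleftrightarrow> \<not> ladder_colour N x" if "x \<in> ?I" for x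
    using prism_flip[OF N, of x] that by (auto simp: \<tau>_def)
  show ?thesis
  proof (rule cayley_not_super_matched[where A = ?A and m = "4 * n + 2" and B = B and T = T and \<tau> = \<tau>],
      unfold m)
    show "isomorphic G (cayley_Z (4 * n + 2) ?A)" using iso by (simp add: N_def)
    show "inj_on \<tau> (?I - B)" by (auto simp: inj_on_def \<tau>_def split: if_splits)
    show "\<tau> ` (?I - B) \<subseteq> B"
    proof (rule image_subsetI)
      fix x assume x: "x \<in> ?I - B"
      then have "\<tau> x \<in> ?I" by (auto simp: \<tau>_def)
      then show "\<tau> x \<in> B" using x flip[of x] by (simp add: B_def)
    qed
    have "2 \<noteq> 2 * N + 1" "4 * N \<noteq> 2 * N + 1" by presburger+
    moreover have "card T \<le> 3" unfolding T_def by (simp add: card_insert_if)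
    ultimately show "card T \<le> card ?A" using N by simp
    show "(y, x) \<in> T" if "x \<in> insert 0 B" "y \<in> insert 0 B" "x - y \<in> ?A" for x y
      using that N prism_monochromatic[of x y N] by (auto simp: B_def T_def)
    fix x assume x: "x \<in> insert 0 B"
    define y where "y = (if x = 0 then 4 * N else if x = 2 * N + 1 then x + 2 else \<tau> x)"
    have "\<not> ladder_colour N (4 * N)" using ladder_colour_even[of N "2 * N"] by simp
    moreover have "\<not> ladder_colour N (2 * N + 1 + 2)"
      using ladder_colour_odd[of N "N + 1"] by (simp add: algebra_simps)
    moreover have "x = 0 \<or> x \<in> ?I \<and> ladder_colour N x" using x by (auto simp: B_def)
    ultimately have "y \<in> ?I - insert 0 B"
      using flip[of x] N unfolding y_def B_def by (auto simp: \<tau>_def split: if_splits)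
    moreover have "x - y \<in> ?A \<or> y - x \<in> ?A" by (auto simp: y_def \<tau>_def)
    ultimately show "\<exists>y\<in>?I - insert 0 B. x - y \<in> ?A \<or> y - x \<in> ?A" by blast
  qed (use n N in \<open>auto simp: B_def T_def ladder_colour_def\<close>)
qed

lemma blown_up_cycle_not_super_matched:
  assumes n: "n \<ge> 1"
    and iso: "isomorphic G (cayley_Z (4 * n + 2) {1, 4 * int n + 1, 2 * int n, 2 * int n + 2})"
  shows "\<not> super_matched G"
proof -
  define N where "N = int n"
  have N: "N \<ge> 1" and m: "int (4 * n + 2) = 4 * N + 2" using n by (simp_all add: N_def)
  let ?I = "{0..<4 * N + 2}" and ?A = "{1, 4 * N + 1, 2 * N, 2 * N + 2}"
  define B where "B = {x \<in> ?I. x \<noteq> 0 \<and> (if x < 2 * N + 1 then even x else odd x)}"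
  define T :: "(int \<times> int) set" where
    "T = {(0, 2 * N), (0, 4 * N + 1), (2 * N, 2 * N + 1), (2 * N + 1, 4 * N + 1)}"
  define \<tau> where "\<tau> x = (if x = 0 then 2 * N + 1 else x + 1)" for x
  show ?thesis
  proof (rule cayley_not_super_matched[where A = ?A and m = "4 * n + 2" and B = B and T = T and \<tau> = \<tau>],
      unfold m)
    show "isomorphic G (cayley_Z (4 * n + 2) ?A)" using iso by (simp add: N_def)
    show "inj_on \<tau> (?I - B)" using N by (auto simp: inj_on_def \<tau>_def B_def split: if_splits)
    show "\<tau> ` (?I - B) \<subseteq> B"
      using N unfolding B_def \<tau>_def by (auto split: if_splits; presburger)
    have "4 * N + 1 \<noteq> 2 * N + 2" "1 \<noteq> 2 * N" "1 \<noteq> 2 * N + 2" by presburger+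
    moreover have "card T \<le> 4" unfolding T_def by (simp add: card_insert_if)
    ultimately show "card T \<le> card ?A" using N by simp
    show "(y, x) \<in> T" if "x \<in> insert 0 B" "y \<in> insert 0 B" "x - y \<in> ?A" for x y
    proof -
      have xy: "0 \<le> y" "x < 4 * N + 2" "y = 0 \<or> (if y < 2 * N + 1 then even y else odd y)"
        "x = 0 \<or> (if x < 2 * N + 1 then even x else odd x)"
        using that(1,2) N by (auto simp: B_def)
      have "x - y = 1 \<or> x - y = 4 * N + 1 \<or> x - y = 2 * N \<or> x - y = 2 * N + 2" using that(3) by auto
      from blown_up_cycle_monochromatic[OF this N xy] show ?thesis by (auto simp: T_def)
    qed
    fix x assume x: "x \<in> insert 0 B"
    define y where "y = (if x = 2 * N \<or> x = 4 * N + 1 then x - 1 else x + 1)"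
    have "y \<in> ?I - insert 0 B"
      using x N unfolding y_def B_def by (auto split: if_splits; presburger)
    moreover have "x - y \<in> ?A \<or> y - x \<in> ?A" by (auto simp: y_def)
    ultimately show "\<exists>y\<in>?I - insert 0 B. x - y \<in> ?A \<or> y - x \<in> ?A" by blast
  qed (use n N in \<open>auto simp: B_def T_def\<close>)
qed

text \<open>The pairs that avoid \<open>0\<close> are six of the ten vertices and span three edges.\<close>

lemma petersen_not_super_matched:
  assumes iso: "isomorphic G petersen_graph"
  shows "\<not> super_matched G"
proof -
  obtain e where e: "bij_betw e (verts petersen_graph) V"
    "\<And>i j. i \<in> verts petersen_graph \<Longrightarrow> j \<in> verts petersen_graph \<Longrightarrow> e i \<sim> e j \<longleftrightarrow> adj petersen_graph i j"
    using isomorphic_index[OF iso] by metis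
  let ?I = "{0..<10::nat}" and ?e = "\<lambda>i. e (petersen_vertex i)"
  interpret indexed_graph G k ?I ?e petersen_index_adj
  proof
    show "bij_betw ?e ?I V" using bij_betw_trans[OF petersen_vertex_bij e(1)] by (simp add: comp_def)
    show "?e i \<sim> ?e j \<longleftrightarrow> petersen_index_adj i j" if "i \<in> ?I" "j \<in> ?I" for i j
      using e(2) petersen_vertex_bij petersen_vertex_adj[OF that] that by (metis bij_betwE)
  qed
  show ?thesis
  proof (rule index_large_part[of "{1, 3, 4, 5, 6, 7}" "{(3, 4), (1, 6), (5, 7)}"])
    have "card {1, 4, 5::nat} \<le> k" by (rule index_degree[of 0]) (auto simp: petersen_index_adj_def)
    then show "card {(3, 4), (1, 6), (5::nat, 7::nat)} \<le> k" by simp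
    have c: "?I - {1, 3, 4, 5, 6, 7} = {0, 2, 8, 9}" unfolding petersen_index by auto
    show "card (?I - {1, 3, 4, 5, 6, 7}) < card {1, 3, 4, 5, 6, 7::nat}" unfolding c by simp
    show "(i, j) \<in> {(3, 4), (1, 6), (5, 7)} \<or> (j, i) \<in> {(3, 4), (1, 6), (5, 7)}"
      if "i \<in> {1, 3, 4, 5, 6, 7}" "j \<in> {1, 3, 4, 5, 6, 7}" "petersen_index_adj i j" for i j
      using that by (auto simp: petersen_index_adj_def)
    show "\<exists>j\<in>?I - {1, 3, 4, 5, 6, 7}. petersen_index_adj i j" if "i \<in> {1, 3, 4, 5, 6, 7}" for i
      unfolding c using that by (auto simp: petersen_index_adj_def)
  qed auto
qed

lemma cycle_adj:
  assumes "i < n" "j < n"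
  shows "adj (cycle_graph n) i j \<longleftrightarrow> j = Suc i mod n \<or> i = Suc j mod n"
  using assms by (auto simp: adj_def cycle_graph_def doubleton_eq_iff)

text \<open>The two edges that leave a path of three vertices are disjoint.\<close>

lemma cycle_not_super_matched:
  assumes n: "n \<ge> 6" and iso: "isomorphic G (cycle_graph n)"
  shows "\<not> super_matched G"
proof -
  have v: "verts (cycle_graph n) = {..<n}" by (simp add: cycle_graph_def)
  obtain e where e: "bij_betw e {..<n} V"
    "\<And>i j. i \<in> {..<n} \<Longrightarrow> j \<in> {..<n} \<Longrightarrow> e i \<sim> e j \<longleftrightarrow> adj (cycle_graph n) i j"
    using isomorphic_index[OF iso] v by metis
  interpret indexed_graph G k "{..<n}" e "\<lambda>i j. j = Suc i mod n \<or> i = Suc j mod n"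
    by unfold_locales (use e cycle_adj in auto)
  have small: "Suc i mod n = Suc i" if "i < 5" for i using that n by simp
  have inj: "e i = e j \<longleftrightarrow> i = j" if "i < n" "j < n" for i j using e_inj that by (auto simp: inj_on_def)
  show ?thesis
  proof (rule odd_part_not_super_matched)
    show "e ` {0, 1, 2} \<subseteq> V" using e_image n by auto
    have "inj_on e {0, 1, 2}" by (rule inj_on_subset[OF e_inj]) (use n in auto)
    then show "odd (card (e ` {0, 1, 2}))" by (simp add: card_image)
    let ?T = "{{e 0, e (n - 1)}, {e 2, e 3}}"
    show "finite ?T" by simp
    have "card {0, 2::nat} \<le> k" by (rule index_degree[of 1]) (use n small in auto)
    moreover have "card ?T \<le> 2" by (simp add: card_insert_if)
    ultimately show "card ?T \<le> k" by simp
    show "{x, y} \<in> ?T" if x: "x \<in> e ` {0, 1, 2}" and y: "y \<notin> e ` {0, 1, 2}" and xy: "x \<sim> y" for x y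
    proof -
      obtain j where j: "j < n" "y = e j" using adj_verts[OF xy] e_image by auto
      have "e j \<notin> e ` {0, 1, 2}" using y j by simp
      then have "j \<notin> {0, 1, 2}" by (metis imageI)
      then have j': "j \<noteq> 0" "j \<noteq> 1" "j \<noteq> 2" by simp_all
      obtain i where i: "i \<in> {0, 1, 2}" "x = e i" using x by blast
      have "j = Suc i mod n \<or> i = Suc j mod n" using rel[of i j] xy i j n by auto
      moreover have "Suc j mod n = (if j = n - 1 then 0 else Suc j)" using j(1) by auto
      ultimately show ?thesis using i j j' small[of i] by (auto split: if_splits)
    qed
    fix w assume "w \<in> V"
    have a1: "e 0 \<sim> e (n - 1)" "e 2 \<sim> e 3" using rel[of 0 "n - 1"] rel[of 2 3] n small[of 2] by auto
    have "e (n - 1) \<notin> e ` {0, 1, 2}" "e 3 \<notin> e ` {0, 1, 2}" "e 0 \<noteq> e 2" "e 0 \<noteq> e 3"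
      "e (n - 1) \<noteq> e 2" "e (n - 1) \<noteq> e 3"
      using n by (auto simp: inj)
    then show "\<exists>x y. x \<in> e ` {0, 1, 2} \<and> y \<notin> e ` {0, 1, 2} \<and> x \<sim> y \<and> x \<noteq> w \<and> y \<noteq> w"
      using a1 by (metis image_eqI insertI1 insertI2)
  qed
qed

section \<open>The classification\<close>

text \<open>The adjacency relation itself is two-regular.\<close>

lemma degree_2_cycle:
  assumes k2: "k = 2"
  shows "isomorphic G (cycle_graph (card V))"
proof -
  obtain x0 where x0: "x0 \<in> V" using V_nonempty by blast
  have two: "\<exists>a\<in>V. \<exists>b\<in>V. a \<noteq> b \<and> {y. x \<sim> y} = {a, b}" if x: "x \<in> V" for x
  proof -
    have "card (nbrs x) = 2" using card_nbrs[OF x] k2 by simp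
    then obtain a b where "nbrs x = {a, b}" "a \<noteq> b" by (auto simp: card_2_iff)
    then show ?thesis using nbrs_sub[of x] by (auto simp: nbrs_def)
  qed
  obtain c L where L: "L \<ge> 3" and cR: "\<And>i. {y. c i \<sim> y} = {c (i - 1), c (i + 1)}"
    and cV: "\<And>i. c i \<in> V" and ceq: "\<And>i j. c i = c j \<longleftrightarrow> int L dvd j - i"
    using two_regular_cycle[of V x0 "adj G", OF fin x0 two adj_sym adj_irrefl] by metis
  have V: "range c = V"
  proof (rule connected_closed)
    fix x y assume "x \<in> range c" and xy: "x \<sim> y"
    then obtain i where "x = c i" by blast
    then have "y \<in> {y. c i \<sim> y}" using xy by simp
    then show "y \<in> range c" unfolding cR by auto
  qed (use cV in auto)
  have cardV: "card V = L" and img: "V = c ` {0..<int L}"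
    using card_range_periodic[of L c] ceq L V by auto
  have nxt: "int L dvd int j - int i - 1 \<longleftrightarrow> j = Suc i mod L" if "j < L" for i j
  proof -
    have "int L dvd int j - int (Suc i) \<longleftrightarrow> j mod L = Suc i mod L"
      by (metis mod_eq_dvd_iff of_nat_eq_iff zmod_int)
    then show ?thesis using that by (simp add: algebra_simps)
  qed
  let ?I = "{..<L}" and ?e = "\<lambda>i::nat. c (int i)"
  have img': "?e ` ?I = V"
  proof -
    have "V = c ` int ` ?I" unfolding img by (simp add: image_int_atLeastLessThan lessThan_atLeast0)
    then show ?thesis by (simp add: image_image)
  qed
  have "bij_betw ?e ?I V"
    unfolding bij_betw_def using img' cardV by (auto intro: eq_card_imp_inj_on)
  moreover have "bij_betw (\<lambda>i. i) ?I (verts (cycle_graph L))" by (simp add: cycle_graph_def bij_betw_def)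
  moreover have "?e i \<sim> ?e j \<longleftrightarrow> adj (cycle_graph L) i j" if ij: "i \<in> ?I" "j \<in> ?I" for i j
  proof -
    have "c (int i) \<sim> c (int j) \<longleftrightarrow> c (int j) = c (int i + 1) \<or> c (int i) = c (int j + 1)"
    proof -
      have "c (int i) \<sim> c (int j) \<longleftrightarrow> c (int j) = c (int i - 1) \<or> c (int j) = c (int i + 1)"
        using cR[of "int i"] by auto
      moreover have "c (int j) = c (int i - 1) \<longleftrightarrow> c (int i) = c (int j + 1)"
        unfolding ceq using dvd_diff_commute[of "int L" "int i - 1" "int j"] by (simp add: algebra_simps)
      ultimately show ?thesis by blast
    qed
    also have "\<dots> \<longleftrightarrow> int L dvd int j - int i - 1 \<or> int L dvd int i - int j - 1"
      unfolding ceq using dvd_diff_commute[of "int L"] by (simp add: algebra_simps)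
    also have "\<dots> \<longleftrightarrow> j = Suc i mod L \<or> i = Suc j mod L" using nxt ij by simp
    finally show ?thesis using cycle_adj ij by simp
  qed
  ultimately show ?thesis unfolding cardV by (rule isomorphic_by_index)
qed

text \<open>The complete graph on four vertices is the smallest Moebius ladder.\<close>

lemma K4_isomorphic:
  assumes "clique G Q" "card Q = 4" "card V = 4"
  shows "isomorphic G (cayley_Z (4 * 1) {1, 4 * int 1 - 1, 2 * int 1})"
proof -
  have QV: "Q = V" using assms fin by (intro card_subset_eq) (auto simp: clique_def)
  obtain g where g: "bij_betw g {0..<4::nat} V" using ex_bij_betw_nat_finite[OF fin] assms(3) by auto
  have adj: "g i \<sim> g j \<longleftrightarrow> i \<noteq> j" if "i < 4" "j < 4" for i j
  proof -
    have "g i \<in> V" "g j \<in> V" "g i = g j \<longleftrightarrow> i = j"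
      using g that by (auto simp: bij_betw_def inj_on_def)
    then show ?thesis using assms(1) adj_irrefl unfolding QV clique_def pairwise_def by metis
  qed
  show ?thesis
  proof (rule isomorphic_cayleyI[where f = "\<lambda>i. g (nat i)"])
    show "V \<subseteq> (\<lambda>i. g (nat i)) ` {0..<int (4 * 1)}"
    proof
      fix x assume "x \<in> V"
      then have "x \<in> g ` {0..<4}" using g by (simp add: bij_betw_def)
      then obtain i where "i < 4" "x = g i" by auto
      then show "x \<in> (\<lambda>i. g (nat i)) ` {0..<int (4 * 1)}" by (intro image_eqI[of _ _ "int i"]) auto
    qed
    show "card V = 4 * 1" using assms by simp
    show "\<exists>b\<in>{1, 4 * int 1 - 1, 2 * int 1}. int (4 * 1) dvd - a - b"
      if "a \<in> {1, 4 * int 1 - 1, 2 * int 1}" for a using that by auto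
    fix x y :: int assume xy: "x \<in> {0..<int (4 * 1)}" "y \<in> {0..<int (4 * 1)}"
    then have "nat x < 4" "nat y < 4" "nat x = nat y \<longleftrightarrow> x = y" by auto
    then have "g (nat x) \<sim> g (nat y) \<longleftrightarrow> x \<noteq> y" using adj by simp
    also have "\<dots> \<longleftrightarrow> (\<exists>a\<in>{1, 4 * int 1 - 1, 2 * int 1}. int (4 * 1) dvd x - y - a)"
      using xy dvd_small_diff[of x 4 y 1] dvd_small_diff[of x 4 y 2] dvd_small_diff[of x 4 y 3] by auto
    finally show "g (nat x) \<sim> g (nat y) \<longleftrightarrow> (\<exists>a\<in>{1, 4 * int 1 - 1, 2 * int 1}. int (4 * 1) dvd x - y - a)" .
  qed
qed

text \<open>Unless one of the first two exceptions occurs, all tight odd cuts are trivial, and a preclusion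
set provides a barrier in a graph that is not bipartite. The cliques of size four and the
degrees three and four are then settled one by one.\<close>

lemma exceptional_cases:
  assumes k: "k \<ge> 1" and even: "even (card V)" and nsm: "\<not> super_matched G"
  shows "(odd k \<and> k + 2 \<le> card V \<and> (\<exists>C. clique G C \<and> card C = k))
      \<or> (\<exists>n\<ge>6. isomorphic G (cycle_graph n))
      \<or> (\<exists>n::nat\<ge>1. isomorphic G (cayley_Z (4 * n) {1, 4 * int n - 1, 2 * int n}))
      \<or> (\<exists>n::nat\<ge>1. isomorphic G (cayley_Z (4 * n + 2) {2, 4 * int n, 2 * int n + 1}))
      \<or> (\<exists>n::nat\<ge>1. isomorphic G (cayley_Z (4 * n + 2) {1, 4 * int n + 1, 2 * int n, 2 * int n + 2}))
      \<or> isomorphic G petersen_graph" (is "?clique \<or> ?cycle \<or> ?rest")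
proof -
  obtain S where S: "matching_preclusion_set G S" "card S \<le> k" "\<And>v. v \<in> V \<Longrightarrow> S \<noteq> incident_edges G v"
    using nsm mp_le_degree by (auto simp: super_matched_def optimal_solution_def trivial_solution_def)
  have splitV: "card X + card (V - X) = card V" if "X \<subseteq> V" for X
    using card_Diff_subset[OF finite_subset[OF that fin] that] card_mono[OF fin that] by linarith
  have small: "tight_odd_cuts_trivial" if "card V \<le> 4"
    unfolding tight_odd_cuts_trivial_def
  proof (intro allI impI)
    fix X assume "X \<subseteq> V" "odd (card X)" "odd (card (V - X))"
    then show "card X = 1 \<or> card (V - X) = 1" using splitV[of X] that by presburger
  qed
  have "?clique \<or> ?cycle \<or> tight_odd_cuts_trivial"
  proof (cases "k \<ge> 3")
    case True
    show ?thesis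
    proof (cases "\<exists>X\<subseteq>V. cut_size X = k \<and> 2 \<le> card X \<and> 2 \<le> card (V - X)")
      case ex: True
      obtain Q where "clique G Q" "card Q = k" "k + 2 \<le> card V"
        "even k \<Longrightarrow> \<forall>X\<subseteq>V. odd (card X) \<longrightarrow> odd (card (V - X)) \<longrightarrow> cut_size X = k \<longrightarrow>
          card X = 1 \<or> card (V - X) = 1"
        using minimum_cuts[OF True ex] by blast
      then show ?thesis unfolding tight_odd_cuts_trivial_def by blast
    next
      case False
      have "tight_odd_cuts_trivial"
        unfolding tight_odd_cuts_trivial_def
      proof (intro allI impI)
        fix X assume X: "X \<subseteq> V" "odd (card X)" "odd (card (V - X))" "cut_size X = k"
        then have "\<not> (2 \<le> card X \<and> 2 \<le> card (V - X))" using False by blast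
        then show "card X = 1 \<or> card (V - X) = 1" using X(2,3) by presburger
      qed
      then show ?thesis by blast
    qed
  next
    case False
    then consider "k = 1" | "k = 2" using k by linarith
    then show ?thesis
    proof cases
      case 1
      then show ?thesis using small degree_1_order by simp
    next
      case 2
      show ?thesis
      proof (cases "card V \<le> 4")
        case False
        then have "card V \<ge> 6" using even by presburger
        then show ?thesis using degree_2_cycle[OF 2] by blast
      qed (use small in blast)
    qed
  qed
  then consider "?clique \<or> ?cycle" | "tight_odd_cuts_trivial" by blast
  then show ?thesis
  proof cases
    case 2
    obtain U where U: "barrier U" by (rule barrier_exists[OF k even S 2])
    interpret nonbipartite_barrier G k U
      by unfold_locales (use U barrier_not_bipartite[OF k even 2 U] in auto)
    show ?thesis
    proof (cases "\<exists>Q. clique G Q \<and> card Q = 4")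
      case True
      then obtain Q where Q: "clique G Q" "card Q = 4" by blast
      then have "isomorphic G (cayley_Z (4 * 1) {1, 4 * int 1 - 1, 2 * int 1})"
        using K4_isomorphic clique_4_order by blast
      then have "\<exists>n::nat\<ge>1. isomorphic G (cayley_Z (4 * n) {1, 4 * int n - 1, 2 * int n})" by blast
      then show ?thesis by blast
    next
      case False
      interpret nonbipartite_barrier_no_K4 G k U by unfold_locales (rule False)
      obtain c where "shortest c" using shortest_exists by blast
      then consider "k = 3" | "k = 4" using degree_ge_3[of c] degree_le_4 by linarith
      then show ?thesis
      proof cases
        case 1
        interpret cubic_barrier G k U by unfold_locales (rule 1)
        show ?thesis using cubic_classification by blast
      next
        case 2
        show ?thesis using tetravalent[OF 2] by blast
      qed
    qed
  qed blast
qed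

end

theorem theorem1p2:
  fixes G :: "'a ugraph" and k :: nat
  assumes "k \<ge> 1"
    and "simple_graph G"
    and "connected_graph G"
    and "regular_graph k G"
    and "vertex_transitive G"
    and "even (graph_order G)"
  shows "super_matched G \<longleftrightarrow>
    \<not> ((odd k \<and> k + 2 \<le> graph_order G \<and> (\<exists>C. clique G C \<and> card C = k))
      \<or> (\<exists>n\<ge>6. isomorphic G (cycle_graph n))
      \<or> (\<exists>n::nat\<ge>1. isomorphic G (cayley_Z (4 * n) {1, 4 * int n - 1, 2 * int n}))
      \<or> (\<exists>n::nat\<ge>1. isomorphic G (cayley_Z (4 * n + 2) {2, 4 * int n, 2 * int n + 1}))
      \<or> (\<exists>n::nat\<ge>1. isomorphic G (cayley_Z (4 * n + 2) {1, 4 * int n + 1, 2 * int n, 2 * int n + 2}))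
      \<or> isomorphic G petersen_graph)"
proof -
  interpret vertex_transitive_graph G k using assms by unfold_locales
  show ?thesis
    unfolding graph_order_def
    using exceptional_cases[OF assms(1)] assms(6) odd_clique_not_super_matched cycle_not_super_matched
      moebius_not_super_matched prism_not_super_matched blown_up_cycle_not_super_matched
      petersen_not_super_matched
    unfolding graph_order_def by blast
qed

end
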